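(* If testers receive $|V(G)|$ as part of the input, then every hereditary graph property is testable with one-sided error in the VDF model. That is, for every hereditary graph property $\mathcal{P}$ there are a function $q:(0,1)\to\mathbb{N}$ and a randomized algorithm which, given $\varepsilon\in(0,1)$, the number $|V(G)|$, and sample-and-query access to a vertex-weighted graph $(G,\mathcal{D})$, makes at most $q(\varepsilon)$ vertex samples and edge queries in total, accepts with probability $1$ if $G$ satisfies $\mathcal{P}$, and rejects with probability at least $2/3$ if $(G,\mathcal{D})$ is $\varepsilon$-far from $\mathcal{P}$.
   Context: All graphs are finite, simple, undirected, with nonempty vertex set. A graph property is a family of graphs closed under isomorphism; it is hereditary if it is closed under removal of vertices. A vertex-weighted graph is a pair $(G,\mathcal{D})$ with $G$ a graph and $\mathcal{D}$ a probability distribution on $V(G)$ (weight $0$ is allowed). For graphs $G_1,G_2$ on the same vertex set $V$ and a distribution $\mathcal{D}$ on $V$, their distance with respect to $\mathcal{D}$ is $\sum_{\{x,y\}\in E(G_1)\triangle E(G_2)}\mathcal{D}(x)\mathcal{D}(y)$. $(G,\mathcal{D})$ is $\varepsilon$-far from $\mathcal{P}$ if for every $G'\in\mathcal{P}$ with $V(G')=V(G)$ the distance between $G$ and $G'$ with respect to $\mathcal{D}$ is at least $\varepsilon$ (vacuously true if no such $G'$ exists). Sample-and-query access: the algorithm may draw independent random vertices distributed according to the (unknown) distribution $\mathcal{D}$ (it can tell whether two samples are the same vertex, but vertex names carry no other information) and make edge queries "is $\{u,v\}$ an edge of $G$?" for sampled vertices $u,v$. There is no restriction on computation. *)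

theory Defs
  imports "HOL-Probability.Probability"
begin

section \<open>Finite simple graphs and hereditary properties\<close>

record 'a ugraph =
  verts :: "'a set"
  edges :: "'a set set"

definition simple_graph :: "'a ugraph \<Rightarrow> bool" where
  "simple_graph G \<longleftrightarrow>
     finite (verts G) \<and> verts G \<noteq> {} \<and> edges G \<subseteq> {e. e \<subseteq> verts G \<and> card e = 2}"

definition isomorphic :: "'a ugraph \<Rightarrow> 'a ugraph \<Rightarrow> bool" where
  "isomorphic G H \<longleftrightarrow>
     (\<exists>f. bij_betw f (verts G) (verts H) \<and>
          (\<forall>x\<in>verts G. \<forall>y\<in>verts G. {x, y} \<in> edges G \<longleftrightarrow> {f x, f y} \<in> edges H))"

definition graph_property :: "'a ugraph set \<Rightarrow> bool" where
  "graph_property P \<longleftrightarrow>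
     (\<forall>G\<in>P. simple_graph G) \<and>
     (\<forall>G\<in>P. \<forall>H. simple_graph H \<and> isomorphic G H \<longrightarrow> H \<in> P)"

definition remove_verts :: "'a ugraph \<Rightarrow> 'a set \<Rightarrow> 'a ugraph" where
  "remove_verts G S = \<lparr>verts = verts G - S, edges = {e \<in> edges G. e \<inter> S = {}}\<rparr>"

text \<open>The side condition reflects that the graph without vertices is not a graph here.\<close>

definition hereditary :: "'a ugraph set \<Rightarrow> bool" where
  "hereditary P \<longleftrightarrow>
     (\<forall>G\<in>P. \<forall>S. verts G - S \<noteq> {} \<longrightarrow> remove_verts G S \<in> P)"


section \<open>Vertex-weighted graphs\<close>

text \<open>Vertices of weight 0 are allowed: the support of the distribution may be a proper
  subset of the vertex set.\<close>

definition weighted_graph :: "'a ugraph \<Rightarrow> 'a pmf \<Rightarrow> bool" where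
  "weighted_graph G D \<longleftrightarrow> simple_graph G \<and> set_pmf D \<subseteq> verts G"

text \<open>An edge is the set of its two endpoints, so the product below is the product of the
  weights of the endpoints.\<close>

definition graph_dist :: "'a pmf \<Rightarrow> 'a ugraph \<Rightarrow> 'a ugraph \<Rightarrow> real" where
  "graph_dist D G1 G2 = (\<Sum>e\<in>sym_diff (edges G1) (edges G2). \<Prod>x\<in>e. pmf D x)"

definition far_from :: "real \<Rightarrow> 'a ugraph \<Rightarrow> 'a pmf \<Rightarrow> 'a ugraph set \<Rightarrow> bool" where
  "far_from \<epsilon> G D P \<longleftrightarrow> (\<forall>G'\<in>P. verts G' = verts G \<longrightarrow> graph_dist D G G' \<ge> \<epsilon>)"


section \<open>Algorithms with sample-and-query access\<close>

text \<open>Adaptive randomized algorithms as interaction trees. The \<open>i\<close>-th distinct vertex that was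
  sampled is known to the algorithm only through its handle \<open>i\<close>: the answer to
  \<open>Sample\<close> is the handle of the sampled vertex, and \<open>Query\<close> refers to two handles. The type of
  algorithms does not mention the type of vertices, so nothing but equality of samples can be
  learned from them. \<open>Coin\<close> is internal randomness; a discrete distribution has countable
  support, so distributions on \<^typ>\<open>nat\<close> suffice. Continuations are arbitrary functions, hence
  there is no restriction on computation.\<close>

datatype algorithm =
    Verdict bool
  | Coin "nat pmf" "nat \<Rightarrow> algorithm"
  | Sample "nat \<Rightarrow> algorithm"
  | Query nat nat "bool \<Rightarrow> algorithm"

text \<open>If \<open>vs\<close> lists the distinct vertices seen so far, the handle of \<open>v\<close> is its position in
  \<open>vs\<close>, or the length of \<open>vs\<close> if \<open>v\<close> is new.\<close>

definition handle :: "'a list \<Rightarrow> 'a \<Rightarrow> nat" where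
  "handle vs v = length (takeWhile (\<lambda>u. u \<noteq> v) vs)"

definition remember :: "'a list \<Rightarrow> 'a \<Rightarrow> 'a list" where
  "remember vs v = (if v \<in> set vs then vs else vs @ [v])"

text \<open>Only sampled vertices can be queried; a query with an unassigned handle is answered
  negatively and carries no information.\<close>

definition edge_query :: "'a ugraph \<Rightarrow> 'a list \<Rightarrow> nat \<Rightarrow> nat \<Rightarrow> bool" where
  "edge_query G vs i j \<longleftrightarrow>
     i < length vs \<and> j < length vs \<and> {vs ! i, vs ! j} \<in> edges G"

text \<open>Joint distribution of the verdict and of the total number of samples and edge queries.\<close>

primrec run_from :: "'a ugraph \<Rightarrow> 'a pmf \<Rightarrow> algorithm \<Rightarrow> 'a list \<Rightarrow> (bool \<times> nat) pmf" where
  "run_from G D (Verdict b) vs = return_pmf (b, 0)"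
| "run_from G D (Coin p k) vs = bind_pmf p (\<lambda>c. run_from G D (k c) vs)"
| "run_from G D (Sample k) vs =
     bind_pmf D (\<lambda>v. map_pmf (apsnd Suc) (run_from G D (k (handle vs v)) (remember vs v)))"
| "run_from G D (Query i j k) vs =
     map_pmf (apsnd Suc) (run_from G D (k (edge_query G vs i j)) vs)"

definition run :: "'a ugraph \<Rightarrow> 'a pmf \<Rightarrow> algorithm \<Rightarrow> (bool \<times> nat) pmf" where
  "run G D A = run_from G D A []"

definition prob_accept :: "'a ugraph \<Rightarrow> 'a pmf \<Rightarrow> algorithm \<Rightarrow> real" where
  "prob_accept G D A = measure_pmf.prob (run G D A) {r. fst r}"

definition prob_reject :: "'a ugraph \<Rightarrow> 'a pmf \<Rightarrow> algorithm \<Rightarrow> real" where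
  "prob_reject G D A = measure_pmf.prob (run G D A) {r. \<not> fst r}"

text \<open>One-sided error testers in the vertex-distribution-free model that receive \<open>\<epsilon>\<close> and the
  number of vertices as input. The bound \<open>q\<close> depends on \<open>\<epsilon>\<close> only.\<close>

definition one_sided_VDF_tester ::
    "'a ugraph set \<Rightarrow> (real \<Rightarrow> nat) \<Rightarrow> (real \<Rightarrow> nat \<Rightarrow> algorithm) \<Rightarrow> bool" where
  "one_sided_VDF_tester P q T \<longleftrightarrow>
     (\<forall>\<epsilon>\<in>{0<..<1}. \<forall>G D. weighted_graph G D \<longrightarrow>
        (let A = T \<epsilon> (card (verts G)) in
           (\<forall>(b, c)\<in>set_pmf (run G D A). c \<le> q \<epsilon>) \<and>
           (G \<in> P \<longrightarrow> prob_accept G D A = 1) \<and>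
           (far_from \<epsilon> G D P \<longrightarrow> prob_reject G D A \<ge> 2 / 3)))"

end

theory Submission
  imports Defs "HOL-Library.Diagonal_Subsequence"
begin

text \<open>The tester accepts iff the sampled induced subgraph embeds, as an induced subgraph, into a
  member of \<open>P\<close> with the given number of vertices. If this fails for some \<open>\<epsilon>\<close>, there is a sequence
  of \<open>\<epsilon>\<close>-far graphs \<open>G\<^sub>i\<close> whose samples of size \<open>i\<close> are extendable with probability at least
  \<open>1 - 1 / (i + 1)\<close>. As in the work of Lovasz and Szegedy on hereditary properties, a member of \<open>P\<close>
  close to \<open>G\<^sub>i\<close> is then obtained by rounding: send every vertex \<open>u\<close> of \<open>G\<^sub>i\<close> to an independent
  random vertex \<open>g u\<close> of similar type, and change a pair \<open>u, v\<close> only if its status in \<open>G\<^sub>i\<close> has almost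
  zero density near \<open>(g u, g v)\<close>. Instead of a limit object, the targets \<open>g u\<close> live in a graph \<open>G\<^sub>i'\<close>
  much later in the sequence, whose cells at three nested levels \<open>k \<le> j \<le> l\<close> of a weakly regular
  sequence of partitions play its role: level \<open>k\<close> identifies similar vertices of \<open>G\<^sub>i\<close> and \<open>G\<^sub>i'\<close>;
  level \<open>j\<close>, chosen after \<open>G\<^sub>i\<close>, determines the rounding; and level \<open>l\<close> is so regular that by the
  counting lemma the rounded graph occurs in samples of \<open>G\<^sub>i'\<close> with a probability bounded below
  independently of \<open>i'\<close>. Hence it is extendable, and extending it yields a member of \<open>P\<close> close to
  \<open>G\<^sub>i\<close>.

  Heavy vertices cannot be blown up. Therefore the partitions also isolate the vertices one by one in
  order of decreasing weight: the \<open>k\<close> heaviest vertices of \<open>G\<^sub>i\<close> are sent to their counterparts, and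
  vertices sent to one of the following \<open>j - k\<close> heaviest ones are given up. The vertices that are
  given up or have weight 0 are the reason why the sampled graph has to be extended to the full
  number of vertices, which is where the tester needs to know it.\<close>

section \<open>Expectations over finite distributions\<close>

abbreviation ex :: "'a pmf \<Rightarrow> ('a \<Rightarrow> real) \<Rightarrow> real" where
  "ex p f \<equiv> measure_pmf.expectation p f"

text \<open>All distributions on vertices have finite support, so expectations turn into finite sums
  and integrability conditions disappear.\<close>

abbreviation fin_pmf :: "'a pmf \<Rightarrow> bool" where
  "fin_pmf p \<equiv> finite (set_pmf p)"

lemma ex_eq_sum: "fin_pmf p \<Longrightarrow> ex p f = (\<Sum>x\<in>set_pmf p. pmf p x * f x)"
  by (subst integral_measure_pmf[of "set_pmf p"]) (auto simp: mult.commute)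

lemma ex_cong: "(\<And>x. x \<in> set_pmf p \<Longrightarrow> f x = g x) \<Longrightarrow> ex p f = ex p g"
  by (intro integral_cong_AE) (auto simp: AE_measure_pmf_iff)

lemma ex_mono: "fin_pmf p \<Longrightarrow> (\<And>x. x \<in> set_pmf p \<Longrightarrow> f x \<le> g x) \<Longrightarrow> ex p f \<le> ex p g"
  by (simp add: ex_eq_sum sum_mono mult_left_mono)

lemma ex_nonneg: "(\<And>x. x \<in> set_pmf p \<Longrightarrow> 0 \<le> f x) \<Longrightarrow> 0 \<le> ex p f"
  by (intro integral_nonneg_AE) (auto simp: AE_measure_pmf_iff)

lemma ex_add: "fin_pmf p \<Longrightarrow> ex p (\<lambda>x. f x + g x) = ex p f + ex p g"
  by (simp add: ex_eq_sum sum.distrib algebra_simps)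

lemma ex_diff: "fin_pmf p \<Longrightarrow> ex p (\<lambda>x. f x - g x) = ex p f - ex p g"
  by (simp add: ex_eq_sum sum_subtractf algebra_simps)

lemma ex_sum: "fin_pmf p \<Longrightarrow> ex p (\<lambda>x. \<Sum>i\<in>I. f i x) = (\<Sum>i\<in>I. ex p (f i))"
  by (simp add: ex_eq_sum sum_distrib_left sum.swap[of _ I])

lemma ex_abs_le: "fin_pmf p \<Longrightarrow> \<bar>ex p f\<bar> \<le> ex p (\<lambda>x. \<bar>f x\<bar>)"
  unfolding ex_eq_sum by (rule order_trans[OF sum_abs]) (simp add: abs_mult)

lemma ex_le_const: "fin_pmf p \<Longrightarrow> (\<And>x. x \<in> set_pmf p \<Longrightarrow> f x \<le> c) \<Longrightarrow> ex p f \<le> c"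
  using ex_mono[of p f "\<lambda>_. c"] by simp

lemma ex_swap: "fin_pmf p \<Longrightarrow> fin_pmf q \<Longrightarrow> ex p (\<lambda>x. ex q (f x)) = ex q (\<lambda>y. ex p (\<lambda>x. f x y))"
  by (simp add: ex_eq_sum sum_distrib_left sum.swap[of _ "set_pmf p"] mult.left_commute)

lemma ex_bind: "fin_pmf p \<Longrightarrow> (\<And>x. x \<in> set_pmf p \<Longrightarrow> fin_pmf (f x)) \<Longrightarrow>
    ex (bind_pmf p f) h = ex p (\<lambda>x. ex (f x) h)"
  by (subst pmf_expectation_bind[of "set_pmf p"]) (auto simp: ex_eq_sum)

lemma ex_pair: "fin_pmf p \<Longrightarrow> fin_pmf q \<Longrightarrow> ex (pair_pmf p q) f = ex p (\<lambda>x. ex q (\<lambda>y. f (x, y)))"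
  unfolding pair_pmf_def by (simp add: ex_bind)

lemma prob_eq_ex: "measure_pmf.prob p {x. Q x} = ex p (\<lambda>x. of_bool (Q x))"
proof -
  have "ex p (\<lambda>x. of_bool (Q x)) = ex p (indicator {x. Q x})"
    by (intro Bochner_Integration.integral_cong) (auto simp: indicator_def)
  then show ?thesis by simp
qed

lemma ex_square_le: "fin_pmf p \<Longrightarrow> (ex p f)\<^sup>2 \<le> ex p (\<lambda>x. (f x)\<^sup>2)"
proof -
  assume fin: "fin_pmf p"
  have "0 \<le> ex p (\<lambda>x. (f x - ex p f)\<^sup>2)" by simp
  also have "\<dots> = ex p (\<lambda>x. (f x)\<^sup>2 - 2 * ex p f * f x + (ex p f)\<^sup>2)"
    by (simp add: power2_diff algebra_simps)
  also have "\<dots> = ex p (\<lambda>x. (f x)\<^sup>2) - (ex p f)\<^sup>2"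
    using fin by (simp add: ex_add ex_diff) (simp add: power2_eq_square)
  finally show ?thesis by simp
qed

lemma ex_lt_imp: "fin_pmf p \<Longrightarrow> ex p f < c \<Longrightarrow> \<exists>x\<in>set_pmf p. f x < c"
  using ex_mono[of p "\<lambda>_. c" f] by (force simp: not_less)

section \<open>Conditioning on cells\<close>

text \<open>A partition is represented by its labelling \<open>\<kappa>\<close>. For a label of mass
  0 the conditional distribution is unspecified, which is why the lemmas below ask for labels
  attained on the support.\<close>

definition cell :: "'a pmf \<Rightarrow> ('a \<Rightarrow> 'w) \<Rightarrow> 'w \<Rightarrow> 'a pmf" where
  "cell D \<kappa> w = cond_pmf D {x. \<kappa> x = w}"

definition mass :: "'a pmf \<Rightarrow> ('a \<Rightarrow> 'w) \<Rightarrow> 'w \<Rightarrow> real" where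
  "mass D \<kappa> w = measure_pmf.prob D {x. \<kappa> x = w}"

lemma mass_ex: "mass D \<kappa> w = ex D (\<lambda>x. of_bool (\<kappa> x = w))"
  unfolding mass_def by (rule prob_eq_ex)

lemma mass_nonneg: "0 \<le> mass D \<kappa> w"
  by (simp add: mass_def)

lemma mass_pos_iff: "mass D \<kappa> w > 0 \<longleftrightarrow> w \<in> \<kappa> ` set_pmf D"
  unfolding mass_def using measure_pmf_zero_iff[of D "{x. \<kappa> x = w}"]
  by (auto simp: zero_less_measure_iff)


lemma set_cell: "w \<in> \<kappa> ` set_pmf D \<Longrightarrow> set_pmf (cell D \<kappa> w) = {x \<in> set_pmf D. \<kappa> x = w}"
  unfolding cell_def by (subst set_cond_pmf) auto

lemma fin_cell: "fin_pmf D \<Longrightarrow> w \<in> \<kappa> ` set_pmf D \<Longrightarrow> fin_pmf (cell D \<kappa> w)"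
  by (simp add: set_cell)

lemma pmf_cell: "w \<in> \<kappa> ` set_pmf D \<Longrightarrow> pmf (cell D \<kappa> w) x = (if \<kappa> x = w then pmf D x / mass D \<kappa> w else 0)"
  unfolding cell_def mass_def by (subst pmf_cond) auto

lemma ex_cell:
  assumes "fin_pmf D" "w \<in> \<kappa> ` set_pmf D"
  shows "ex (cell D \<kappa> w) h = ex D (\<lambda>x. of_bool (\<kappa> x = w) * h x) / mass D \<kappa> w"
proof -
  have "ex (cell D \<kappa> w) h = (\<Sum>x\<in>set_pmf D. h x * pmf (cell D \<kappa> w) x)"
    using assms by (subst integral_measure_pmf[of "set_pmf D"]) (auto simp: set_cell mult.commute)
  also have "\<dots> = (\<Sum>x\<in>set_pmf D. pmf D x * (of_bool (\<kappa> x = w) * h x) / mass D \<kappa> w)"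
    using pmf_cell[OF assms(2)] by (intro sum.cong refl) simp
  also have "\<dots> = ex D (\<lambda>x. of_bool (\<kappa> x = w) * h x) / mass D \<kappa> w"
    using assms(1) by (simp only: ex_eq_sum sum_divide_distrib)
  finally show ?thesis .
qed

lemma bind_cell: "bind_pmf D (\<lambda>x. cell D \<kappa> (\<kappa> x)) = D"
proof -
  have ne: "set_pmf D \<inter> {y. \<kappa> y = \<kappa> x} \<noteq> {}" "set_pmf D \<inter> {y. \<kappa> x = \<kappa> y} \<noteq> {}" if "x \<in> set_pmf D" for x
    using that by (simp_all add: disjoint_iff) metis+
  have eq: "measure_pmf.prob D {y. \<kappa> y = \<kappa> x} = measure_pmf.prob D {x. \<kappa> y = \<kappa> x}" if "\<kappa> y = \<kappa> x" for x y
    by (rule arg_cong[where f = "measure_pmf.prob D"]) (use that in auto)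
  show ?thesis unfolding cell_def
    by (rule bind_cond_pmf_cancel[where R = "\<lambda>x y. \<kappa> y = \<kappa> x", OF ne(1) ne(2) eq])
qed

definition finer :: "('a \<Rightarrow> 'v) \<Rightarrow> ('a \<Rightarrow> 'w) \<Rightarrow> bool" where
  "finer \<rho> \<kappa> \<longleftrightarrow> (\<forall>x y. \<rho> x = \<rho> y \<longrightarrow> \<kappa> x = \<kappa> y)"

lemma finerD: "finer \<rho> \<kappa> \<Longrightarrow> \<rho> x = \<rho> y \<Longrightarrow> \<kappa> x = \<kappa> y"
  unfolding finer_def by blast

lemma finer_refl [simp]: "finer \<kappa> \<kappa>"
  by (simp add: finer_def)

text \<open>A \<open>\<rho>\<close>-cell lies inside one \<open>\<kappa>\<close>-cell, so
  conditioning the latter further agrees with conditioning \<open>D\<close> directly; then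
  \<open>bind_cell\<close> applies inside the \<open>\<kappa>\<close>-cell.\<close>

lemma bind_cell_cell:
  assumes "fin_pmf D" and "w \<in> \<kappa> ` set_pmf D" and refines: "finer \<rho> \<kappa>"
  shows "bind_pmf (cell D \<kappa> w) (\<lambda>x. cell D \<rho> (\<rho> x)) = cell D \<kappa> w"
proof (rule trans[OF _ bind_cell[of _ \<rho>]], rule bind_pmf_cong[OF refl])
  fix x assume x: "x \<in> set_pmf (cell D \<kappa> w)"
  then have *: "x \<in> set_pmf D" "\<kappa> x = w" using assms by (auto simp: set_cell)
  have mem: "\<rho> x \<in> \<rho> ` set_pmf (cell D \<kappa> w)" "\<rho> x \<in> \<rho> ` set_pmf D" using x * by auto
  have sub: "{y. \<rho> y = \<rho> x} \<subseteq> {y. \<kappa> y = w}" using finerD[OF refines] * by blast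
  have m: "mass (cell D \<kappa> w) \<rho> (\<rho> x) = mass D \<rho> (\<rho> x) / mass D \<kappa> w"
  proof -
    have "mass (cell D \<kappa> w) \<rho> (\<rho> x) = ex D (\<lambda>y. of_bool (\<kappa> y = w) * of_bool (\<rho> y = \<rho> x)) / mass D \<kappa> w"
      unfolding mass_ex[of "cell D \<kappa> w"] using assms(1,2) by (rule ex_cell)
    also have "ex D (\<lambda>y. of_bool (\<kappa> y = w) * of_bool (\<rho> y = \<rho> x)) = mass D \<rho> (\<rho> x)"
      unfolding mass_ex using sub by (intro ex_cong) auto
    finally show ?thesis .
  qed
  have pos: "mass D \<kappa> w > 0" using assms(2) mass_pos_iff by metis
  show "cell D \<rho> (\<rho> x) = cell (cell D \<kappa> w) \<rho> (\<rho> x)"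
    using assms(2) mem pos sub by (intro pmf_eqI) (auto simp: pmf_cell m)
qed

lemma ex_cell_avg:
  assumes "fin_pmf D"
  shows "ex D (\<lambda>x. ex (cell D \<kappa> (\<kappa> x)) h) = ex D h"
  using ex_bind[of D "\<lambda>x. cell D \<kappa> (\<kappa> x)" h] assms by (simp add: bind_cell fin_cell)

text \<open>The weight \<open>h\<close> is constant on cells and can be moved inside the cell
  averages, which then dissolve in each variable by \<open>ex_cell_avg\<close>.\<close>

lemma ex2_cell_avg:
  assumes fin: "fin_pmf D"
  shows "ex D (\<lambda>x. ex D (\<lambda>y. h (\<kappa> x) (\<kappa> y) * ex (cell D \<kappa> (\<kappa> x)) (\<lambda>x'. ex (cell D \<kappa> (\<kappa> y)) (\<lambda>y'. \<phi> x' y'))))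
       = ex D (\<lambda>x. ex D (\<lambda>y. h (\<kappa> x) (\<kappa> y) * \<phi> x y))"
proof -
  have "ex D (\<lambda>x. ex D (\<lambda>y. h (\<kappa> x) (\<kappa> y) * ex (cell D \<kappa> (\<kappa> x)) (\<lambda>x'. ex (cell D \<kappa> (\<kappa> y)) (\<lambda>y'. \<phi> x' y'))))
    = ex D (\<lambda>x. ex D (\<lambda>y. ex (cell D \<kappa> (\<kappa> x)) (\<lambda>x'. ex (cell D \<kappa> (\<kappa> y)) (\<lambda>y'. h (\<kappa> x') (\<kappa> y') * \<phi> x' y'))))"
    (is "_ = ex D (\<lambda>x. ex D (\<lambda>y. ex (?c x) (\<lambda>x'. ex (?c y) (?\<psi> x'))))")
  proof (intro ex_cong)
    fix x y assume xy: "x \<in> set_pmf D" "y \<in> set_pmf D"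
    have "h (\<kappa> x) (\<kappa> y) * ex (?c x) (\<lambda>x'. ex (?c y) (\<phi> x')) = ex (?c x) (\<lambda>x'. ex (?c y) (\<lambda>y'. h (\<kappa> x) (\<kappa> y) * \<phi> x' y'))"
      by simp
    also have "\<dots> = ex (?c x) (\<lambda>x'. ex (?c y) (?\<psi> x'))"
      using xy by (intro ex_cong) (simp add: set_cell)
    finally show "h (\<kappa> x) (\<kappa> y) * ex (?c x) (\<lambda>x'. ex (?c y) (\<phi> x')) = ex (?c x) (\<lambda>x'. ex (?c y) (?\<psi> x'))" .
  qed
  also have "\<dots> = ex D (\<lambda>x. ex (?c x) (\<lambda>x'. ex D (\<lambda>y. ex (?c y) (?\<psi> x'))))"
    using fin by (intro ex_cong ex_swap) (auto simp: fin_cell)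
  also have "\<dots> = ex D (\<lambda>x. ex (?c x) (\<lambda>x'. ex D (?\<psi> x')))"
    using fin by (simp add: ex_cell_avg)
  also have "\<dots> = ex D (\<lambda>x. ex D (?\<psi> x))"
    using fin by (simp add: ex_cell_avg)
  finally show ?thesis .
qed

section \<open>Edge densities, energy and cut discrepancy\<close>

definition emass :: "'a pmf \<Rightarrow> ('a \<Rightarrow> 'a \<Rightarrow> bool) \<Rightarrow> ('a \<Rightarrow> 'w) \<Rightarrow> 'w \<Rightarrow> 'w \<Rightarrow> real" where
  "emass D E \<kappa> w w' = ex D (\<lambda>x. ex D (\<lambda>y. of_bool (\<kappa> x = w \<and> \<kappa> y = w' \<and> E x y)))"

text \<open>The stepping of the adjacency function over the product partition. Taking points instead
  of labels makes steppings over different partitions directly comparable.\<close>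

definition dens :: "'a pmf \<Rightarrow> ('a \<Rightarrow> 'a \<Rightarrow> bool) \<Rightarrow> ('a \<Rightarrow> 'w) \<Rightarrow> 'a \<Rightarrow> 'a \<Rightarrow> real" where
  "dens D E \<kappa> x y = ex (cell D \<kappa> (\<kappa> x)) (\<lambda>x'. ex (cell D \<kappa> (\<kappa> y)) (\<lambda>y'. of_bool (E x' y')))"

text \<open>The mean square density, known as the index of a partition in proofs of regularity
  lemmas.\<close>

definition energy :: "'a pmf \<Rightarrow> ('a \<Rightarrow> 'a \<Rightarrow> bool) \<Rightarrow> ('a \<Rightarrow> 'w) \<Rightarrow> real" where
  "energy D E \<kappa> = ex D (\<lambda>x. ex D (\<lambda>y. (dens D E \<kappa> x y)\<^sup>2))"

text \<open>The supremum of its absolute value over \<open>S\<close> and \<open>T\<close> is the cut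
  norm of the adjacency function minus its stepping.\<close>

definition cut_gap :: "'a pmf \<Rightarrow> ('a \<Rightarrow> 'a \<Rightarrow> bool) \<Rightarrow> ('a \<Rightarrow> 'w) \<Rightarrow> 'a set \<Rightarrow> 'a set \<Rightarrow> real" where
  "cut_gap D E \<kappa> S T =
     ex D (\<lambda>x. ex D (\<lambda>y. (of_bool (E x y) - dens D E \<kappa> x y) * of_bool (x \<in> S) * of_bool (y \<in> T)))"

lemma dens_nonneg: "0 \<le> dens D E \<kappa> x y"
  unfolding dens_def by (intro ex_nonneg) auto

lemma dens_le_1: "fin_pmf D \<Longrightarrow> x \<in> set_pmf D \<Longrightarrow> y \<in> set_pmf D \<Longrightarrow> dens D E \<kappa> x y \<le> 1"
  unfolding dens_def by (intro ex_le_const fin_cell) auto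

lemma dens_cong: "\<kappa> x = \<kappa> x' \<Longrightarrow> \<kappa> y = \<kappa> y' \<Longrightarrow> dens D E \<kappa> x y = dens D E \<kappa> x' y'"
  by (simp add: dens_def)

lemma dens_not:
  assumes "fin_pmf D" "x \<in> set_pmf D" "y \<in> set_pmf D"
  shows "dens D (\<lambda>x y. \<not> E x y) \<kappa> x y = 1 - dens D E \<kappa> x y"
  using assms by (simp add: dens_def of_bool_not_iff ex_diff fin_cell)

lemma dens_proj:
  assumes "fin_pmf D"
  shows "ex D (\<lambda>x. ex D (\<lambda>y. h (\<kappa> x) (\<kappa> y) * dens D E \<kappa> x y)) = ex D (\<lambda>x. ex D (\<lambda>y. h (\<kappa> x) (\<kappa> y) * of_bool (E x y)))"
  unfolding dens_def by (rule ex2_cell_avg[OF assms])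

lemma dens_proj_coarse:
  assumes fin: "fin_pmf D"
    and h: "\<And>x x' y y'. \<rho> x = \<rho> x' \<Longrightarrow> \<rho> y = \<rho> y' \<Longrightarrow> h x y = h x' y'"
  shows "ex D (\<lambda>x. ex D (\<lambda>y. h x y * dens D E \<rho> x y)) = ex D (\<lambda>x. ex D (\<lambda>y. h x y * of_bool (E x y)))"
proof -
  \<comment> \<open>A representative of every label turns \<open>h\<close> into a function of
    labels, as \<open>dens_proj\<close> demands.\<close>
  define r where "r w = (SOME x. \<rho> x = w)" for w
  have r: "\<rho> (r (\<rho> x)) = \<rho> x" for x unfolding r_def by (rule someI[of _ x]) simp
  have "h x y = h (r (\<rho> x)) (r (\<rho> y))" for x y by (rule h) (simp_all add: r)
  then show ?thesis using dens_proj[OF fin, of "\<lambda>w w'. h (r w) (r w')" \<rho> E] by simp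
qed

text \<open>Pythagoras: the stepping over \<open>\<kappa>\<close> is the orthogonal projection of
  the one over \<open>\<rho>\<close>. Both the cross term and the square of the coarse stepping
  equal the inner product of the coarse stepping with \<open>E\<close>.\<close>

lemma energy_increment:
  assumes fin: "fin_pmf D" and refines: "finer \<rho> \<kappa>"
  shows "ex D (\<lambda>x. ex D (\<lambda>y. (dens D E \<rho> x y - dens D E \<kappa> x y)\<^sup>2)) = energy D E \<rho> - energy D E \<kappa>"
proof -
  let ?k = "dens D E \<kappa>" and ?r = "dens D E \<rho>"
  have a: "ex D (\<lambda>x. ex D (\<lambda>y. ?k x y * ?r x y)) = ex D (\<lambda>x. ex D (\<lambda>y. ?k x y * of_bool (E x y)))"
    by (rule dens_proj_coarse[OF fin], rule dens_cong) (erule finerD[OF refines])+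
  have b: "ex D (\<lambda>x. ex D (\<lambda>y. ?k x y * ?k x y)) = ex D (\<lambda>x. ex D (\<lambda>y. ?k x y * of_bool (E x y)))"
    by (rule dens_proj_coarse[OF fin], rule dens_cong)
  have "(?r x y - ?k x y)\<^sup>2 = ((?r x y)\<^sup>2 - 2 * (?k x y * ?r x y)) + ?k x y * ?k x y" for x y
    by (simp add: power2_eq_square algebra_simps)
  then have "ex D (\<lambda>x. ex D (\<lambda>y. (?r x y - ?k x y)\<^sup>2))
     = energy D E \<rho> - 2 * ex D (\<lambda>x. ex D (\<lambda>y. ?k x y * ?r x y)) + ex D (\<lambda>x. ex D (\<lambda>y. ?k x y * ?k x y))"
    unfolding energy_def using fin by (simp add: ex_add ex_diff)
  also have "ex D (\<lambda>x. ex D (\<lambda>y. ?k x y * ?k x y)) = energy D E \<kappa>"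
    unfolding energy_def power2_eq_square ..
  finally show ?thesis using a b unfolding energy_def power2_eq_square by linarith
qed

lemma energy_nonneg: "0 \<le> energy D E \<kappa>"
  unfolding energy_def by (intro ex_nonneg) auto

lemma energy_le_1: "fin_pmf D \<Longrightarrow> energy D E \<kappa> \<le> 1"
  unfolding energy_def by (intro ex_le_const) (auto simp: dens_nonneg dens_le_1 power_le_one)

lemma energy_mono:
  assumes fin: "fin_pmf D" and refines: "finer \<rho> \<kappa>"
  shows "energy D E \<kappa> \<le> energy D E \<rho>"
proof -
  have "0 \<le> ex D (\<lambda>x. ex D (\<lambda>y. (dens D E \<rho> x y - dens D E \<kappa> x y)\<^sup>2))"
    by (intro ex_nonneg) auto
  then show ?thesis using energy_increment[OF assms, where E=E] by simp
qed

lemma ex2_square_le: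
  assumes fin: "fin_pmf D"
  shows "(ex D (\<lambda>x. ex D (\<lambda>y. f x y)))\<^sup>2 \<le> ex D (\<lambda>x. ex D (\<lambda>y. (f x y)\<^sup>2))"
proof -
  have "(ex D (\<lambda>x. ex D (\<lambda>y. f x y)))\<^sup>2 \<le> ex D (\<lambda>x. (ex D (\<lambda>y. f x y))\<^sup>2)"
    using fin by (rule ex_square_le)
  also have "\<dots> \<le> ex D (\<lambda>x. ex D (\<lambda>y. (f x y)\<^sup>2))"
    using fin by (intro ex_mono ex_square_le)
  finally show ?thesis .
qed

text \<open>The L1 distance is at most the L2 distance, which \<open>energy_increment\<close>
  evaluates.\<close>

lemma dens_L1_le:
  assumes fin: "fin_pmf D" and refines: "finer \<rho> \<kappa>"
  shows "ex D (\<lambda>x. ex D (\<lambda>y. \<bar>dens D E \<rho> x y - dens D E \<kappa> x y\<bar>)) \<le> sqrt (energy D E \<rho> - energy D E \<kappa>)"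
  using ex2_square_le[OF fin, of "\<lambda>x y. \<bar>dens D E \<rho> x y - dens D E \<kappa> x y\<bar>"] energy_increment[OF assms, where E=E]
  by (intro real_le_rsqrt) simp

text \<open>Since \<open>S\<close> and \<open>T\<close> are unions of \<open>\<rho>\<close>-cells,
  \<open>E\<close> may be replaced by its stepping over \<open>\<rho>\<close> in the gap. What
  remains is bounded by the L2 distance of the two steppings.\<close>

lemma cut_gap_energy:
  assumes fin: "fin_pmf D" and refines: "finer \<rho> \<kappa>"
    and ST: "\<And>x y. \<rho> x = \<rho> y \<Longrightarrow> (x \<in> S \<longleftrightarrow> y \<in> S) \<and> (x \<in> T \<longleftrightarrow> y \<in> T)"
  shows "(cut_gap D E \<kappa> S T)\<^sup>2 \<le> energy D E \<rho> - energy D E \<kappa>"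
proof -
  have a: "ex D (\<lambda>x. ex D (\<lambda>y. of_bool (x \<in> S \<and> y \<in> T) * dens D E \<rho> x y)) = ex D (\<lambda>x. ex D (\<lambda>y. of_bool (x \<in> S \<and> y \<in> T) * of_bool (E x y)))"
  proof (rule dens_proj_coarse[OF fin])
    fix x x' y y' assume "\<rho> x = \<rho> x'" "\<rho> y = \<rho> y'"
    then show "of_bool (x \<in> S \<and> y \<in> T) = (of_bool (x' \<in> S \<and> y' \<in> T) :: real)"
      using ST[of x x'] ST[of y y'] by simp
  qed
  have "cut_gap D E \<kappa> S T = ex D (\<lambda>x. ex D (\<lambda>y. of_bool (x \<in> S \<and> y \<in> T) * of_bool (E x y) - of_bool (x \<in> S \<and> y \<in> T) * dens D E \<kappa> x y))"
    unfolding cut_gap_def by (intro ex_cong) (auto simp: algebra_simps)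
  also have "\<dots> = ex D (\<lambda>x. ex D (\<lambda>y. of_bool (x \<in> S \<and> y \<in> T) * dens D E \<rho> x y - of_bool (x \<in> S \<and> y \<in> T) * dens D E \<kappa> x y))"
    using fin a by (simp add: ex_diff)
  finally have "(cut_gap D E \<kappa> S T)\<^sup>2 \<le> ex D (\<lambda>x. ex D (\<lambda>y. (of_bool (x \<in> S \<and> y \<in> T) * dens D E \<rho> x y - of_bool (x \<in> S \<and> y \<in> T) * dens D E \<kappa> x y)\<^sup>2))"
    by (simp only: ex2_square_le[OF fin])
  also have "\<dots> \<le> ex D (\<lambda>x. ex D (\<lambda>y. (dens D E \<rho> x y - dens D E \<kappa> x y)\<^sup>2))"
    using fin by (intro ex_mono) auto
  finally show ?thesis using energy_increment[OF fin refines, where E=E] by simp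
qed

section \<open>Weakly regular partitions\<close>

text \<open>Each refinement step contributes a letter of three bits. Labels of all graphs are thus
  words over one alphabet, which lets cells of different graphs be matched and their masses
  compared.\<close>

type_synonym code = "(bool \<times> bool \<times> bool) list"

definition worst_cut :: "'a pmf \<Rightarrow> ('a \<Rightarrow> 'a \<Rightarrow> bool) \<Rightarrow> ('a \<Rightarrow> 'w) \<Rightarrow> 'a set \<times> 'a set" where
  "worst_cut D E \<kappa> = (SOME p. \<forall>S T. \<bar>cut_gap D E \<kappa> S T\<bar> \<le> \<bar>cut_gap D E \<kappa> (fst p) (snd p)\<bar>)"

text \<open>Only the traces of \<open>S\<close> and \<open>T\<close> on the finite support matter,
  so the maximum exists and \<open>SOME\<close> attains it.\<close>

lemma worst_cut:
  assumes "fin_pmf D"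
  shows "\<bar>cut_gap D E \<kappa> S T\<bar> \<le> \<bar>cut_gap D E \<kappa> (fst (worst_cut D E \<kappa>)) (snd (worst_cut D E \<kappa>))\<bar>"
proof -
  let ?X = "set_pmf D" and ?g = "\<lambda>p. \<bar>cut_gap D E \<kappa> (fst p) (snd p)\<bar>"
  have eq: "cut_gap D E \<kappa> S T = cut_gap D E \<kappa> (S \<inter> ?X) (T \<inter> ?X)" for S T
    unfolding cut_gap_def by (intro ex_cong) simp
  have fin: "finite (?g ` (Pow ?X \<times> Pow ?X))" and "?g ` (Pow ?X \<times> Pow ?X) \<noteq> {}" using assms by auto
  then have "Max (?g ` (Pow ?X \<times> Pow ?X)) \<in> ?g ` (Pow ?X \<times> Pow ?X)" by (rule Max_in)
  then obtain p where p: "Max (?g ` (Pow ?X \<times> Pow ?X)) = ?g p" by (rule imageE)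
  have "?g q \<le> ?g p" if "q \<in> Pow ?X \<times> Pow ?X" for q
    unfolding p[symmetric] by (rule Max_ge[OF fin]) (rule imageI[OF that])
  from this[of "(S \<inter> ?X, T \<inter> ?X)" for S T]
  have "\<bar>cut_gap D E \<kappa> (S \<inter> ?X) (T \<inter> ?X)\<bar> \<le> ?g p" for S T by simp
  then have "\<forall>S T. \<bar>cut_gap D E \<kappa> S T\<bar> \<le> ?g p" using eq by metis
  from someI[of "\<lambda>p. \<forall>S T. \<bar>cut_gap D E \<kappa> S T\<bar> \<le> ?g p", OF this]
  show ?thesis unfolding worst_cut_def by blast
qed

text \<open>Every refinement step splits the cells along a worst cut, as in the weak regularity lemma
  of Frieze and Kannan, and isolates one more vertex in the order given by \<open>rk\<close>.\<close>

primrec code :: "'a pmf \<Rightarrow> ('a \<Rightarrow> 'a \<Rightarrow> bool) \<Rightarrow> ('a \<Rightarrow> nat) \<Rightarrow> nat \<Rightarrow> 'a \<Rightarrow> code" where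
  "code D E rk 0 = (\<lambda>x. [])"
| "code D E rk (Suc r) = (\<lambda>x. (x \<in> fst (worst_cut D E (code D E rk r)),
     x \<in> snd (worst_cut D E (code D E rk r)), rk x = r) # code D E rk r x)"

lemma length_code [simp]: "length (code D E rk r x) = r"
  by (induction r) auto

lemma finer_code: "r \<le> r' \<Longrightarrow> finer (code D E rk r') (code D E rk r)"
proof (induction r' rule: dec_induct)
  case (step n)
  have "finer (code D E rk (Suc n)) (code D E rk n)"
    unfolding finer_def code.simps list.inject by blast
  then show ?case using step.IH unfolding finer_def by blast
qed (rule finer_refl)

text \<open>The third bits of a word reveal every rank below \<open>r\<close>, even when the two
  words come from different graphs.\<close>

lemma code_rk:
  "code D E rk r x = code D' E' rk' r y \<Longrightarrow> a < r \<Longrightarrow> rk x = a \<longleftrightarrow> rk' y = a"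
  by (induction r) (auto simp: less_Suc_eq)

lemma finite_words: "finite {w :: code. length w = r}" and card_words: "card {w :: code. length w = r} = 8 ^ r"
proof -
  have "card (UNIV :: (bool \<times> bool \<times> bool) set) = 8"
    by (simp add: card_cartesian_product flip: UNIV_Times_UNIV)
  then show "finite {w :: code. length w = r}" "card {w :: code. length w = r} = 8 ^ r"
    using finite_lists_length_eq[of "UNIV :: (bool \<times> bool \<times> bool) set" r]
      card_lists_length_eq[of "UNIV :: (bool \<times> bool \<times> bool) set" r] by simp_all
qed

text \<open>Energy increment: at an irregular level the split along a worst cut gains more than
  \<open>d\<^sup>2\<close>. Energy never exceeds 1, so a window of levels whose length depends on
  \<open>d\<close> only contains a regular one.\<close>

lemma ex_regular_level:
  assumes fin: "fin_pmf D" and "0 < d"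
  shows "\<exists>l\<ge>j. l \<le> j + nat \<lceil>1 / d\<^sup>2\<rceil> \<and> (\<forall>S T. \<bar>cut_gap D E (code D E rk l) S T\<bar> \<le> d)"
proof (rule ccontr)
  assume neg: "\<not> ?thesis"
  let ?e = "\<lambda>l. energy D E (code D E rk l)"
  have step: "?e (Suc l) - ?e l > d\<^sup>2" if l: "j \<le> l" "l \<le> j + nat \<lceil>1 / d\<^sup>2\<rceil>" for l
  proof -
    let ?p = "worst_cut D E (code D E rk l)"
    have "\<not> (\<forall>S T. \<bar>cut_gap D E (code D E rk l) S T\<bar> \<le> d)" using neg l by blast
    then obtain S T where "d < \<bar>cut_gap D E (code D E rk l) S T\<bar>" by (meson not_le)
    also have "\<dots> \<le> \<bar>cut_gap D E (code D E rk l) (fst ?p) (snd ?p)\<bar>" using fin by (rule worst_cut)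
    finally have "d\<^sup>2 < (cut_gap D E (code D E rk l) (fst ?p) (snd ?p))\<^sup>2"
      using \<open>0 < d\<close> by (metis abs_of_pos abs_less_iff power2_abs power_strict_mono less_eq_real_def pos2)
    also have "\<dots> \<le> ?e (Suc l) - ?e l"
      using fin by (intro cut_gap_energy finer_code) auto
    finally show ?thesis .
  qed
  have "m \<le> nat \<lceil>1 / d\<^sup>2\<rceil> + 1 \<Longrightarrow> real m * d\<^sup>2 \<le> ?e (j + m) - ?e j" for m
  proof (induction m)
    case (Suc m)
    then show ?case using step[of "j + m"] by (simp add: algebra_simps)
  qed simp
  \<comment> \<open>The window allows one step more than
    \<open>nat \<lceil>1 / d\<^sup>2\<rceil>\<close>; this surplus step pushes the gain beyond
    1.\<close>
  from this[of "nat \<lceil>1 / d\<^sup>2\<rceil> + 1"]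
  have "(real (nat \<lceil>1 / d\<^sup>2\<rceil>) + 1) * d\<^sup>2 \<le> 1"
    using energy_le_1[OF fin, of E "code D E rk (j + (nat \<lceil>1 / d\<^sup>2\<rceil> + 1))"] energy_nonneg[of D E "code D E rk j"]
    by (simp add: algebra_simps)
  moreover have "1 / d\<^sup>2 \<le> real (nat \<lceil>1 / d\<^sup>2\<rceil>)" by linarith
  then have "1 \<le> real (nat \<lceil>1 / d\<^sup>2\<rceil>) * d\<^sup>2"
    by (subst (asm) pos_divide_le_eq) (use \<open>0 < d\<close> in simp_all)
  ultimately have "d\<^sup>2 \<le> 0" unfolding distrib_right by linarith
  then show False using \<open>0 < d\<close> by simp
qed

section \<open>The counting lemma\<close>

text \<open>A function that is linear in a variable ranging over [0,1] is extremal at an indicator.\<close>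

lemma ex_extreme:
  assumes "fin_pmf D" "\<And>x. 0 \<le> g x \<and> g x \<le> (1::real)"
  shows "\<bar>ex D (\<lambda>x. b x * g x)\<bar> \<le> max \<bar>ex D (\<lambda>x. b x * of_bool (x \<in> {x. b x > 0}))\<bar> \<bar>ex D (\<lambda>x. b x * of_bool (x \<in> {x. b x < 0}))\<bar>"
proof -
  have "ex D (\<lambda>x. b x * g x) \<le> ex D (\<lambda>x. b x * of_bool (x \<in> {x. b x > 0}))"
    using assms by (intro ex_mono) (auto simp: mult_left_le mult_nonpos_nonneg)
  moreover have "ex D (\<lambda>x. b x * of_bool (x \<in> {x. b x < 0})) \<le> ex D (\<lambda>x. b x * g x)"
    using assms mult_left_mono_neg[of "g _" 1 "b _"] by (intro ex_mono) (auto simp: not_less)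
  ultimately show ?thesis by linarith
qed

text \<open>The form is linear in \<open>g\<close> and in \<open>h\<close> separately, so they are
  replaced by extremal indicators one after the other.\<close>

lemma bilinear_extreme:
  assumes fin: "fin_pmf D" and g: "\<And>x. 0 \<le> g x \<and> g x \<le> (1::real)" and h: "\<And>x. 0 \<le> h x \<and> h x \<le> (1::real)"
    and d: "\<And>S T. \<bar>ex D (\<lambda>x. ex D (\<lambda>y. \<Delta> x y * of_bool (x \<in> S) * of_bool (y \<in> T)))\<bar> \<le> d"
  shows "\<bar>ex D (\<lambda>x. ex D (\<lambda>y. \<Delta> x y * g x * h y))\<bar> \<le> d"
proof -
  have one: "\<bar>ex D (\<lambda>x. ex D (\<lambda>y. \<Delta> x y * of_bool (x \<in> S) * h y))\<bar> \<le> d" for S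
  proof -
    let ?b = "\<lambda>y. ex D (\<lambda>x. \<Delta> x y * of_bool (x \<in> S))"
    have eq: "ex D (\<lambda>x. ex D (\<lambda>y. \<Delta> x y * of_bool (x \<in> S) * k y)) = ex D (\<lambda>y. ?b y * k y)" for k
      using fin by (subst ex_swap) auto
    show ?thesis
      using ex_extreme[where g = h and b = ?b, OF fin h] d[of S "{y. ?b y > 0}"] d[of S "{y. ?b y < 0}"] unfolding eq by linarith
  qed
  let ?b = "\<lambda>x. ex D (\<lambda>y. \<Delta> x y * h y)"
  have eq: "ex D (\<lambda>x. ex D (\<lambda>y. \<Delta> x y * k x * h y)) = ex D (\<lambda>x. ?b x * k x)" for k
  proof (intro ex_cong)
    fix x
    have "ex D (\<lambda>y. \<Delta> x y * k x * h y) = ex D (\<lambda>y. k x * (\<Delta> x y * h y))" by (simp only: mult_ac)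
    also have "\<dots> = k x * ?b x" by (rule integral_mult_right_zero)
    finally show "ex D (\<lambda>y. \<Delta> x y * k x * h y) = ?b x * k x" by (simp only: mult.commute)
  qed
  show ?thesis
    using ex_extreme[where g = g and b = ?b, OF fin g] one[of "{y. ?b y > 0}"] one[of "{y. ?b y < 0}"] unfolding eq by linarith
qed

lemma fin_Pi_pmf: "finite A \<Longrightarrow> (\<And>a. a \<in> A \<Longrightarrow> fin_pmf (p a)) \<Longrightarrow> fin_pmf (Pi_pmf A d p)"
  by (simp add: set_Pi_pmf finite_PiE_dflt)

lemma ex_Pi_insert:
  assumes "finite A" "a \<notin> A" "\<And>b. b \<in> insert a A \<Longrightarrow> fin_pmf (p b)"
  shows "ex (Pi_pmf (insert a A) d p) h = ex (p a) (\<lambda>x. ex (Pi_pmf A d p) (\<lambda>f. h (f(a := x))))"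
  using assms by (simp add: Pi_pmf_insert ex_pair fin_Pi_pmf case_prod_unfold)

lemma ex_Pi_two:
  assumes "finite A" "a \<in> A" "b \<in> A" "a \<noteq> b" "\<And>c. c \<in> A \<Longrightarrow> fin_pmf (p c)"
  shows "ex (Pi_pmf A d p) h =
    ex (Pi_pmf (A - {a, b}) d p) (\<lambda>f. ex (p a) (\<lambda>x. ex (p b) (\<lambda>y. h (f(a := x, b := y)))))"
proof -
  let ?B = "A - {a, b}"
  have A: "A = insert a (insert b ?B)" using assms by auto
  have fB: "fin_pmf (Pi_pmf ?B d p)" using assms by (intro fin_Pi_pmf) auto
  have "ex (Pi_pmf A d p) h = ex (p a) (\<lambda>x. ex (Pi_pmf (insert b ?B) d p) (\<lambda>f. h (f(a := x))))"
    using assms by (subst A, subst ex_Pi_insert) auto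
  also have "\<dots> = ex (p a) (\<lambda>x. ex (p b) (\<lambda>y. ex (Pi_pmf ?B d p) (\<lambda>f. h (f(b := y, a := x)))))"
    using assms by (subst ex_Pi_insert) auto
  also have "\<dots> = ex (p a) (\<lambda>x. ex (Pi_pmf ?B d p) (\<lambda>f. ex (p b) (\<lambda>y. h (f(b := y, a := x)))))"
    using assms fB by (intro ex_cong ex_swap) auto
  also have "\<dots> = ex (Pi_pmf ?B d p) (\<lambda>f. ex (p a) (\<lambda>x. ex (p b) (\<lambda>y. h (f(b := y, a := x)))))"
    using assms fB by (intro ex_swap) auto
  finally show ?thesis using assms by (simp add: fun_upd_twist)
qed

lemma ex_Pi_marginal2:
  assumes "finite A" "a \<in> A" "b \<in> A" "a \<noteq> b" "\<And>c. c \<in> A \<Longrightarrow> fin_pmf (p c)"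
  shows "ex (Pi_pmf A d p) (\<lambda>f. h (f a) (f b)) = ex (p a) (\<lambda>x. ex (p b) (\<lambda>y. h x y))"
  using assms by (simp add: ex_Pi_two[of A a b])

lemma ex_Pi_marginal:
  assumes "finite A" "a \<in> A"
  shows "ex (Pi_pmf A d p) (\<lambda>f. h (f a)) = ex (p a) h"
  using Pi_pmf_component[OF assms(1), of a d p] assms(2) integral_map_pmf[of "\<lambda>f. f a" "Pi_pmf A d p" h] by simp

text \<open>With all coordinates but \<open>a\<close> and \<open>b\<close> fixed, the product of the other factors splits into a
  function of the coordinate \<open>a\<close> times one of the coordinate \<open>b\<close>.\<close>

lemma count_one:
  fixes K :: "'i \<times> 'i \<Rightarrow> 'a \<Rightarrow> 'a \<Rightarrow> real"
  assumes A: "finite A" "a \<in> A" "b \<in> A" "a \<noteq> b" "\<And>c. c \<in> A \<Longrightarrow> fin_pmf (p c)"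
    and Q: "finite Q" "Q \<subseteq> A \<times> A" "(a, b) \<notin> Q" "(b, a) \<notin> Q" "\<And>c. (c, c) \<notin> Q"
    and K: "\<And>q x y. 0 \<le> K q x y \<and> K q x y \<le> 1"
    and d: "\<And>g h. (\<And>x. 0 \<le> g x \<and> g x \<le> (1::real)) \<Longrightarrow> (\<And>x. 0 \<le> h x \<and> h x \<le> (1::real)) \<Longrightarrow>
        \<bar>ex (p a) (\<lambda>x. ex (p b) (\<lambda>y. \<Delta> x y * g x * h y))\<bar> \<le> d"
  shows "\<bar>ex (Pi_pmf A dflt p) (\<lambda>f. \<Delta> (f a) (f b) * (\<Prod>q\<in>Q. K q (f (fst q)) (f (snd q))))\<bar> \<le> d"
proof -
  let ?B = "A - {a, b}" and ?Qa = "{q \<in> Q. fst q = a \<or> snd q = a}" and ?Qb = "{q \<in> Q. fst q \<noteq> a \<and> snd q \<noteq> a}"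
  have fB: "fin_pmf (Pi_pmf ?B dflt p)" using A by (intro fin_Pi_pmf) auto
  have Qsplit: "Q = ?Qa \<union> ?Qb" "?Qa \<inter> ?Qb = {}" by auto
  define g where "g f x = (\<Prod>q\<in>?Qa. K q ((f(a := x)) (fst q)) ((f(a := x)) (snd q)))" for f x
  define h where "h f y = (\<Prod>q\<in>?Qb. K q ((f(b := y)) (fst q)) ((f(b := y)) (snd q)))" for f y
  have split: "(\<Prod>q\<in>Q. K q ((f(a := x, b := y)) (fst q)) ((f(a := x, b := y)) (snd q))) = g f x * h f y" for f x y
  proof -
    have "(\<Prod>q\<in>Q. K q ((f(a := x, b := y)) (fst q)) ((f(a := x, b := y)) (snd q)))
      = (\<Prod>q\<in>?Qa. K q ((f(a := x, b := y)) (fst q)) ((f(a := x, b := y)) (snd q)))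
      * (\<Prod>q\<in>?Qb. K q ((f(a := x, b := y)) (fst q)) ((f(a := x, b := y)) (snd q)))"
      using Q(1) Qsplit by (metis (no_types, lifting) finite_Un prod.union_disjoint)
    also have "\<dots> = g f x * h f y"
    proof (rule arg_cong2[where f = "(*)"])
      show "(\<Prod>q\<in>?Qa. K q ((f(a := x, b := y)) (fst q)) ((f(a := x, b := y)) (snd q))) = g f x"
        unfolding g_def
      proof (rule prod.cong[OF refl])
        fix q assume q: "q \<in> ?Qa"
        then have "fst q \<noteq> b" "snd q \<noteq> b" using Q(3,4) A(4) by (cases q; auto)+
        then show "K q ((f(a := x, b := y)) (fst q)) ((f(a := x, b := y)) (snd q)) = K q ((f(a := x)) (fst q)) ((f(a := x)) (snd q))"
          by simp
      qed
      show "(\<Prod>q\<in>?Qb. K q ((f(a := x, b := y)) (fst q)) ((f(a := x, b := y)) (snd q))) = h f y"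
        unfolding h_def by (rule prod.cong) auto
    qed
    finally show ?thesis .
  qed
  have two: "ex (Pi_pmf A dflt p) k = ex (Pi_pmf ?B dflt p) (\<lambda>f. ex (p a) (\<lambda>x. ex (p b) (\<lambda>y. k (f(a := x, b := y)))))" for k
    by (rule ex_Pi_two) (use A in auto)
  have bnd: "0 \<le> g f x \<and> g f x \<le> 1" "0 \<le> h f x \<and> h f x \<le> 1" for f x
    unfolding g_def h_def using K by (auto intro!: prod_nonneg prod_le_1)
  have "ex (Pi_pmf A dflt p) (\<lambda>f. \<Delta> (f a) (f b) * (\<Prod>q\<in>Q. K q (f (fst q)) (f (snd q))))
    = ex (Pi_pmf ?B dflt p) (\<lambda>f. ex (p a) (\<lambda>x. ex (p b) (\<lambda>y. \<Delta> x y * g f x * h f y)))"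
    unfolding two split using A(4) by (simp add: mult.assoc)
  also have "\<bar>\<dots>\<bar> \<le> ex (Pi_pmf ?B dflt p) (\<lambda>f. \<bar>ex (p a) (\<lambda>x. ex (p b) (\<lambda>y. \<Delta> x y * g f x * h f y))\<bar>)"
    by (rule ex_abs_le[OF fB])
  also have "\<dots> \<le> d" by (intro ex_le_const[OF fB] d bnd)
  finally show ?thesis .
qed

text \<open>Telescoping: the factors \<open>W q\<close> are exchanged for \<open>F q\<close> one at
  a time, and by \<open>count_one\<close> each exchange changes the expectation by at most
  \<open>d\<close>.\<close>

lemma counting:
  fixes F W :: "'i \<times> 'i \<Rightarrow> 'a \<Rightarrow> 'a \<Rightarrow> real" and d :: real
  assumes A: "finite A" "\<And>c. c \<in> A \<Longrightarrow> fin_pmf (p c)"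
    and Q: "Q \<subseteq> A \<times> A" "\<And>a b. (a, b) \<in> Q \<Longrightarrow> (b, a) \<notin> Q"
    and F: "\<And>q x y. 0 \<le> F q x y \<and> F q x y \<le> 1" and W: "\<And>q x y. 0 \<le> W q x y \<and> W q x y \<le> 1"
    and d: "\<And>a b g h. (a, b) \<in> Q \<Longrightarrow> (\<And>x. 0 \<le> g x \<and> g x \<le> (1::real)) \<Longrightarrow> (\<And>x. 0 \<le> h x \<and> h x \<le> (1::real)) \<Longrightarrow>
        \<bar>ex (p a) (\<lambda>x. ex (p b) (\<lambda>y. (F (a, b) x y - W (a, b) x y) * g x * h y))\<bar> \<le> d"
  shows "ex (Pi_pmf A dflt p) (\<lambda>f. \<Prod>q\<in>Q. W q (f (fst q)) (f (snd q))) - card Q * d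
    \<le> ex (Pi_pmf A dflt p) (\<lambda>f. \<Prod>q\<in>Q. F q (f (fst q)) (f (snd q)))"
proof -
  have finQ: "finite Q" using finite_subset[OF Q(1)] A(1) by simp
  have fA: "fin_pmf (Pi_pmf A dflt p)" using A by (intro fin_Pi_pmf)
  \<comment> \<open>The hybrid in which exactly the factors indexed by \<open>M\<close> have been
    exchanged.\<close>
  define K where "K M q = (if q \<in> M then F q else W q)" for M q
  define t where "t M = ex (Pi_pmf A dflt p) (\<lambda>f. \<Prod>q\<in>Q. K M q (f (fst q)) (f (snd q)))" for M
  have "t {} - card M * d \<le> t M" if "finite M" "M \<subseteq> Q" for M
    using that
  proof (induction M rule: finite_induct)
    case (insert q M)
    obtain a b where q: "q = (a, b)" by (cases q)
    have qQ: "q \<in> Q" and ab: "(a, b) \<in> Q" using insert q by auto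
    have "a \<noteq> b" using Q(2) ab by blast
    let ?r = "\<lambda>f. \<Prod>q\<in>Q - {q}. K M q (f (fst q)) (f (snd q))"
    have e: "(\<Prod>q\<in>Q. K N q (f (fst q)) (f (snd q))) = K N q (f a) (f b) * ?r f"
      if "N - {q} = M" for N and f :: "'i \<Rightarrow> 'a"
    proof -
      have "(\<Prod>q\<in>Q. K N q (f (fst q)) (f (snd q))) = K N q (f a) (f b) * (\<Prod>q\<in>Q - {q}. K N q (f (fst q)) (f (snd q)))"
        using prod.remove[OF finQ qQ, of "\<lambda>q. K N q (f (fst q)) (f (snd q))"] q by simp
      also have "(\<Prod>q\<in>Q - {q}. K N q (f (fst q)) (f (snd q))) = ?r f"
        using that by (intro prod.cong) (auto simp: K_def)
      finally show ?thesis .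
    qed
    have "t (insert q M) - t M = ex (Pi_pmf A dflt p) (\<lambda>f. (F q (f a) (f b) - W q (f a) (f b)) * ?r f)"
      unfolding t_def using insert e[of "insert q M"] e[of M] fA
      by (simp add: ex_diff[symmetric] K_def[of _ q] algebra_simps)
    moreover have "\<bar>ex (Pi_pmf A dflt p) (\<lambda>f. (F q (f a) (f b) - W q (f a) (f b)) * ?r f)\<bar> \<le> d"
      using A Q ab finQ \<open>a \<noteq> b\<close> F W q unfolding q
      by (intro count_one[where \<Delta> = "\<lambda>x y. F (a, b) x y - W (a, b) x y"] d) (auto simp: K_def)
    ultimately show ?case using insert by (simp add: algebra_simps)
  qed simp
  from this[OF finQ order_refl] show ?thesis by (simp add: t_def K_def)
qed

section \<open>Rounding a graph along a similar one\<close>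

lemma ex_bounded:
  assumes "\<And>x. 0 \<le> f x \<and> f x \<le> (1::real)"
  shows "0 \<le> ex p f \<and> ex p f \<le> 1"
proof
  have "integrable p f"
    by (rule measure_pmf.integrable_const_bound[where B = 1]) (use assms in auto)
  then show "ex p f \<le> 1"
    by (rule measure_pmf.integral_le_const) (use assms in auto)
qed (use assms in \<open>auto intro: ex_nonneg\<close>)

lemma dens_bounded: "0 \<le> dens D E \<kappa> x y \<and> dens D E \<kappa> x y \<le> 1"
  unfolding dens_def by (intro ex_bounded) auto

text \<open>Through this linear expression in the cell masses, expectations of functions of labels
  become comparable between two graphs; \<open>ex2_words\<close> does the same for pairs.\<close>

lemma ex_words:
  fixes \<kappa> :: "'a \<Rightarrow> code"
  assumes fin: "fin_pmf D" and len: "\<And>x. length (\<kappa> x) = k"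
  shows "ex D (\<lambda>x. h (\<kappa> x)) = (\<Sum>w | length w = k. mass D \<kappa> w * h w)"
proof -
  have e: "h (\<kappa> x) = (\<Sum>w | length w = k. of_bool (\<kappa> x = w) * h w)" for x
  proof -
    have "(\<Sum>w | length w = k. of_bool (\<kappa> x = w) * h w) = (\<Sum>w | length w = k. if \<kappa> x = w then h w else 0)"
      by (intro sum.cong) auto
    also have "\<dots> = h (\<kappa> x)" using len[of x] by (simp add: sum.delta' finite_words)
    finally show ?thesis ..
  qed
  have "ex D (\<lambda>x. h (\<kappa> x)) = ex D (\<lambda>x. \<Sum>w | length w = k. of_bool (\<kappa> x = w) * h w)"
    by (intro ex_cong e)
  then show ?thesis using fin by (simp add: ex_sum mass_ex)
qed

lemma ex2_words:
  fixes \<kappa> :: "'a \<Rightarrow> code"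
  assumes fin: "fin_pmf D" and len: "\<And>x. length (\<kappa> x) = k"
  shows "ex D (\<lambda>x. ex D (\<lambda>y. h (\<kappa> x) (\<kappa> y) * of_bool (E x y)))
    = (\<Sum>w | length w = k. \<Sum>w' | length w' = k. emass D E \<kappa> w w' * h w w')"
proof -
  have e: "h (\<kappa> x) (\<kappa> y) * of_bool (E x y) = (\<Sum>w | length w = k. \<Sum>w' | length w' = k. of_bool (\<kappa> x = w \<and> \<kappa> y = w' \<and> E x y) * h w w')" for x y
  proof -
    have "(\<Sum>w | length w = k. \<Sum>w' | length w' = k. of_bool (\<kappa> x = w \<and> \<kappa> y = w' \<and> E x y) * h w w')
      = (\<Sum>w | length w = k. if \<kappa> x = w then \<Sum>w' | length w' = k. if \<kappa> y = w' then of_bool (E x y) * h w w' else 0 else 0)"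
      by (intro sum.cong refl) (auto intro!: sum.cong sum.neutral)
    also have "(\<Sum>w | length w = k. if \<kappa> x = w then \<Sum>w' | length w' = k. if \<kappa> y = w' then c * h w w' else 0 else 0) = h (\<kappa> x) (\<kappa> y) * c" for c :: real
      using len[of x] len[of y] by (simp add: sum.delta' finite_words)
    finally show ?thesis ..
  qed
  have "ex D (\<lambda>x. ex D (\<lambda>y. h (\<kappa> x) (\<kappa> y) * of_bool (E x y)))
     = ex D (\<lambda>x. ex D (\<lambda>y. \<Sum>w | length w = k. \<Sum>w' | length w' = k. of_bool (\<kappa> x = w \<and> \<kappa> y = w' \<and> E x y) * h w w'))"
    by (intro ex_cong e)
  also have "\<dots> = (\<Sum>w | length w = k. \<Sum>w' | length w' = k. emass D E \<kappa> w w' * h w w')"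
    using fin by (simp add: ex_sum emass_def)
  finally show ?thesis .
qed

lemma ex_cell_le:
  assumes fin: "fin_pmf D" and "0 < \<tau>" "\<tau> \<le> mass D \<kappa> w" and f: "\<And>x. 0 \<le> f x"
  shows "ex (cell D \<kappa> w) f \<le> ex D f / \<tau>"
proof -
  have w: "w \<in> \<kappa> ` set_pmf D" using assms mass_pos_iff[of D \<kappa> w] by auto
  have "ex (cell D \<kappa> w) f = ex D (\<lambda>x. of_bool (\<kappa> x = w) * f x) / mass D \<kappa> w" by (rule ex_cell[OF fin w])
  also have "\<dots> \<le> ex D f / mass D \<kappa> w"
    using f by (intro divide_right_mono mass_nonneg ex_mono[OF fin]) auto
  also have "\<dots> \<le> ex D f / \<tau>" using assms by (intro divide_left_mono ex_nonneg) (auto intro: mult_pos_pos)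
  finally show ?thesis .
qed

lemma ex2_cell_le:
  assumes fin: "fin_pmf D" and \<tau>: "0 < \<tau>" "\<tau> \<le> mass D \<kappa> w" "\<tau> \<le> mass D \<kappa> w'" and f: "\<And>x y. 0 \<le> f x y"
  shows "ex (cell D \<kappa> w) (\<lambda>x. ex (cell D \<kappa> w') (f x)) \<le> ex D (\<lambda>x. ex D (f x)) / \<tau>\<^sup>2"
proof -
  have w: "w \<in> \<kappa> ` set_pmf D" using assms mass_pos_iff[of D \<kappa> w] by auto
  have "ex (cell D \<kappa> w) (\<lambda>x. ex (cell D \<kappa> w') (f x)) \<le> ex (cell D \<kappa> w) (\<lambda>x. ex D (f x) / \<tau>)"
    using assms by (intro ex_mono ex_cell_le fin_cell w) auto
  also have "\<dots> \<le> ex D (\<lambda>x. ex D (f x) / \<tau>) / \<tau>"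
    using assms by (intro ex_cell_le) (auto intro!: divide_nonneg_pos ex_nonneg)
  finally show ?thesis by (simp add: power2_eq_square)
qed

text \<open>Induction on the coordinates, losing a factor \<open>c\<close> for each. It transfers
  lower bounds from cell-wise sampling to sampling from the whole distribution.\<close>

lemma ex_Pi_dominated:
  assumes "finite A" "0 \<le> c" "\<And>a. a \<in> A \<Longrightarrow> fin_pmf (p a) \<and> fin_pmf (q a)"
    and dom: "\<And>a h. a \<in> A \<Longrightarrow> (\<And>x. 0 \<le> h x) \<Longrightarrow> c * ex (p a) h \<le> ex (q a) h"
    and "\<And>f. 0 \<le> h f"
  shows "c ^ card A * ex (Pi_pmf A d p) h \<le> ex (Pi_pmf A d q) h"
  using assms
proof (induction A arbitrary: h rule: finite_induct)
  case (insert a A)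
  have IH: "c ^ card A * ex (Pi_pmf A d p) (\<lambda>f. h (f(a := x))) \<le> ex (Pi_pmf A d q) (\<lambda>f. h (f(a := x)))" for x
    using insert.prems by (intro insert.IH) auto
  have "c ^ card (insert a A) * ex (Pi_pmf (insert a A) d p) h
    = c * ex (p a) (\<lambda>x. c ^ card A * ex (Pi_pmf A d p) (\<lambda>f. h (f(a := x))))"
    using insert by (subst ex_Pi_insert) auto
  also have "\<dots> \<le> ex (q a) (\<lambda>x. c ^ card A * ex (Pi_pmf A d p) (\<lambda>f. h (f(a := x))))"
    using insert.prems by (intro insert.prems) (auto intro!: mult_nonneg_nonneg ex_nonneg)
  also have "\<dots> \<le> ex (q a) (\<lambda>x. ex (Pi_pmf A d q) (\<lambda>f. h (f(a := x))))"
    using insert.prems by (intro ex_mono IH) auto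
  also have "\<dots> = ex (Pi_pmf (insert a A) d q) h"
    using insert by (subst ex_Pi_insert) auto
  finally show ?case .
qed simp

text \<open>\<open>D\<close> is the graph to be rounded and \<open>D'\<close> the graph that
  receives it. \<open>\<delta>\<close> is both the error scale and the density threshold,
  \<open>\<tau>\<close> and \<open>\<sigma>\<close> are the least masses of the
  level-\<open>k\<close> and level-\<open>j\<close> target cells in use, \<open>\<beta>\<close>
  bounds the energy gained between \<open>j\<close> and \<open>l\<close>, and \<open>d\<close> the
  irregularity of level \<open>l\<close>. The smallness conditions involve \<open>n\<close>, but not
  the size of the support of \<open>D'\<close>.\<close>

locale similar_graphs =
  fixes D :: "'a pmf" and E :: "'a \<Rightarrow> 'a \<Rightarrow> bool" and rk :: "'a \<Rightarrow> nat"
    and D' :: "'b pmf" and E' :: "'b \<Rightarrow> 'b \<Rightarrow> bool" and rk' :: "'b \<Rightarrow> nat"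
    and k j l n :: nat and \<epsilon> \<delta> \<tau> \<sigma> \<beta> d :: real
  assumes fin: "fin_pmf D" and fin': "fin_pmf D'"
    and inj: "inj_on rk (set_pmf D)" and inj': "inj_on rk' (set_pmf D')"
    and light: "\<And>x. x \<in> set_pmf D' \<Longrightarrow> pmf D' x \<le> 1 / (real (rk' x) + 1)"
    and levels: "k \<le> j" "j \<le> l"
    and n: "card (set_pmf D) \<le> n"
    and pos: "0 < \<epsilon>" "0 < \<delta>" "0 < \<tau>" "0 < \<sigma>" "0 < \<beta>" "0 \<le> d"
    and small: "\<delta> \<le> 1 / 2" "33 * \<delta> \<le> \<epsilon>" "8 ^ k * \<tau> \<le> \<delta>" "\<sigma> \<le> 1"
      "n * (8 ^ j * \<sigma>) / \<tau> \<le> 1 / 4"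
      "n\<^sup>2 * ((4 / \<delta>\<^sup>2 * \<beta> + 1 / (real j + 1)) / \<tau>\<^sup>2) \<le> (\<delta> / 2) ^ n\<^sup>2 / 16"
      "n\<^sup>2 * (d / \<sigma>\<^sup>2) \<le> (\<delta> / 2) ^ n\<^sup>2 / 4"
    and mass_close: "(\<Sum>w | length w = k. \<bar>mass D (code D E rk k) w - mass D' (code D' E' rk' k) w\<bar>) \<le> \<delta>"
    and emass_close: "\<And>b. (\<Sum>w | length w = k. \<Sum>w' | length w' = k.
        \<bar>emass D (\<lambda>x y. E x y = b) (code D E rk k) w w' - emass D' (\<lambda>x y. E' x y = b) (code D' E' rk' k) w w'\<bar>) \<le> \<delta>"
    and energy_kj: "energy D' E' (code D' E' rk' j) - energy D' E' (code D' E' rk' k) \<le> \<delta>\<^sup>2"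
    and energy_jl: "energy D' E' (code D' E' rk' l) - energy D' E' (code D' E' rk' j) \<le> \<beta>"
    and atoms: "measure_pmf.prob D' {x. k \<le> rk' x \<and> rk' x < j} \<le> 2 * \<delta>"
    and regular: "\<And>S T. \<bar>cut_gap D' E' (code D' E' rk' l) S T\<bar> \<le> d"
begin

abbreviation \<kappa> where "\<kappa> \<equiv> code D E rk k"
abbreviation \<kappa>' where "\<kappa>' r \<equiv> code D' E' rk' r"
abbreviation m' where "m' r w \<equiv> mass D' (\<kappa>' r) w"

text \<open>The Boolean \<open>b\<close> is the status of a pair, so edges and non-edges are treated
  uniformly.\<close>

definition W where "W r b = dens D' (\<lambda>x y. E' x y = b) (\<kappa>' r)"
definition V where "V = {u \<in> set_pmf D. \<tau> \<le> m' k (\<kappa> u)}"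
definition M where "M = Pi_pmf V undefined (\<lambda>u. cell D' (\<kappa>' k) (\<kappa> u))"

text \<open>Conditions \<open>M\<close> on the level-\<open>j\<close> cells of \<open>g\<close>, and so on the rounding and its cost.\<close>

definition Mg where "Mg g = Pi_pmf V undefined (\<lambda>u. cell D' (\<kappa>' j) (\<kappa>' j (g u)))"
text \<open>Targets of rank below \<open>k\<close> are isolated by level \<open>k\<close> and hence
  hit by at most one vertex; at targets of rank at least \<open>j\<close> collisions are rare. Ranks
  in between offer neither, so vertices sent there are given up.\<close>

definition R where "R g = {u \<in> V. rk' (g u) < k \<or> j \<le> rk' (g u)}"
text \<open>If the status of a pair has density below \<open>\<delta>\<close> near its targets, the
  opposite one has density above \<open>1 - \<delta>\<close>. As
  \<open>\<delta> \<le> 1 / 2\<close>, the chosen status always has density at least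
  \<open>\<delta>\<close>.\<close>

definition pat where "pat g u v = (if \<delta> \<le> W j (E u v) (g u) (g v) then E u v else \<not> E u v)"
definition cost where "cost g = (\<Sum>u\<in>set_pmf D - R g. pmf D u)
    + (\<Sum>u\<in>V. \<Sum>v\<in>V - {u}. pmf D u * pmf D v * of_bool (pat g u v \<noteq> E u v))"
text \<open>Either level \<open>l\<close> deviates too far from the level-\<open>j\<close> densities
  on which \<open>pat\<close> relies, or two vertices meet in a light target.\<close>

definition bad where "bad f \<longleftrightarrow> (\<exists>u\<in>V. \<exists>v\<in>V - {u}. \<bar>W l True (f u) (f v) - W j True (f u) (f v)\<bar> > \<delta> / 2
    \<or> f u = f v \<and> j \<le> rk' (f u))"
text \<open>The order by \<open>rk\<close> selects one orientation of every pair, as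
  \<open>counting\<close> requires.\<close>

definition good where "good g f \<longleftrightarrow> inj_on f (R g) \<and> (\<forall>u\<in>R g. \<forall>v\<in>R g. rk u < rk v \<longrightarrow> E' (f u) (f v) = pat g u v)"

section \<open>Basic facts on the random rounding\<close>

lemma finV [simp]: "finite V" and V_sub: "V \<subseteq> set_pmf D" and card_V: "card V \<le> n"
proof -
  show "finite V" "V \<subseteq> set_pmf D" using fin by (auto simp: V_def)
  then show "card V \<le> n" using n fin card_mono order_trans by metis
qed

lemma V_mass: "u \<in> V \<Longrightarrow> \<tau> \<le> m' k (\<kappa> u)"
  by (simp add: V_def)

lemma V_cell: "u \<in> V \<Longrightarrow> \<kappa> u \<in> \<kappa>' k ` set_pmf D'"
  using V_mass pos(3) mass_pos_iff[of D' "\<kappa>' k" "\<kappa> u"] by force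

lemma fin_cell_V: "u \<in> V \<Longrightarrow> fin_pmf (cell D' (\<kappa>' k) (\<kappa> u))"
  by (intro fin_cell fin' V_cell)

lemma finM: "fin_pmf M"
  unfolding M_def by (intro fin_Pi_pmf fin_cell_V) auto

lemma set_M: "g \<in> set_pmf M \<Longrightarrow> u \<in> V \<Longrightarrow> g u \<in> set_pmf D' \<and> \<kappa>' k (g u) = \<kappa> u"
  unfolding M_def using set_cell[OF V_cell] by (auto simp: set_Pi_pmf PiE_dflt_def)

lemma finMg: "g \<in> set_pmf M \<Longrightarrow> fin_pmf (Mg g)"
  unfolding Mg_def by (intro fin_Pi_pmf fin_cell fin') (auto dest: set_M)

lemma set_Mg:
  assumes "g \<in> set_pmf M" "f \<in> set_pmf (Mg g)" "u \<in> V"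
  shows "f u \<in> set_pmf D' \<and> \<kappa>' j (f u) = \<kappa>' j (g u) \<and> \<kappa>' k (f u) = \<kappa> u"
proof -
  have "f u \<in> set_pmf (cell D' (\<kappa>' j) (\<kappa>' j (g u)))"
    using assms unfolding Mg_def by (auto simp: set_Pi_pmf PiE_dflt_def)
  then have f: "f u \<in> set_pmf D'" "\<kappa>' j (f u) = \<kappa>' j (g u)"
    using set_M[OF assms(1,3)] by (auto simp: set_cell)
  then show ?thesis using finerD[OF finer_code[OF levels(1)] f(2)] set_M[OF assms(1,3)] by simp
qed

text \<open>Level \<open>j\<close> refines level \<open>k\<close>, so \<open>bind_cell_cell\<close>
  applies in every coordinate. Bounds on events under \<open>M\<close> thus become bounds under
  \<open>Mg g\<close> on average over \<open>g\<close>, with pattern and cost already fixed by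
  \<open>g\<close>.\<close>

lemma M_resample: "M = bind_pmf M Mg"
proof -
  have "M = Pi_pmf V undefined (\<lambda>u. bind_pmf (cell D' (\<kappa>' k) (\<kappa> u)) (\<lambda>x. cell D' (\<kappa>' j) (\<kappa>' j x)))"
    unfolding M_def
    by (intro Pi_pmf_cong refl bind_cell_cell[symmetric] fin' V_cell finer_code levels)
  also have "\<dots> = bind_pmf M Mg"
    unfolding Mg_def M_def by (rule Pi_pmf_bind) simp
  finally show ?thesis .
qed

lemma W_bounded: "0 \<le> W r b x y \<and> W r b x y \<le> 1"
  unfolding W_def by (rule dens_bounded)

lemma W_True: "W r True = dens D' E' (\<kappa>' r)"
  by (simp add: W_def)

lemma W_False: "x \<in> set_pmf D' \<Longrightarrow> y \<in> set_pmf D' \<Longrightarrow> W r False x y = 1 - W r True x y"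
  using dens_not[OF fin', of x y E'] by (simp add: W_def)

lemma W_cong: "\<kappa>' r x = \<kappa>' r x' \<Longrightarrow> \<kappa>' r y = \<kappa>' r y' \<Longrightarrow> W r b x y = W r b x' y'"
  unfolding W_def by (rule dens_cong)

lemma W_diff: "x \<in> set_pmf D' \<Longrightarrow> y \<in> set_pmf D' \<Longrightarrow> \<bar>W r b x y - W s b x y\<bar> = \<bar>W r True x y - W s True x y\<bar>"
  by (cases b) (simp_all add: W_False)

section \<open>Transfer between the two graphs and expected cost of the rounding\<close>

lemma ex_words_le:
  assumes "\<And>w. 0 \<le> h w \<and> h w \<le> 1"
  shows "ex D (\<lambda>x. h (\<kappa> x)) \<le> ex D' (\<lambda>x. h (\<kappa>' k x)) + \<delta>"
proof -
  have "ex D (\<lambda>x. h (\<kappa> x)) - ex D' (\<lambda>x. h (\<kappa>' k x)) = (\<Sum>w | length w = k. (mass D \<kappa> w - m' k w) * h w)"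
    using ex_words[OF fin, of \<kappa> k h] ex_words[OF fin', of "\<kappa>' k" k h] by (simp add: sum_subtractf algebra_simps)
  also have "\<dots> \<le> (\<Sum>w | length w = k. \<bar>mass D \<kappa> w - m' k w\<bar>)"
  proof (rule sum_mono)
    fix w :: code
    show "(mass D \<kappa> w - m' k w) * h w \<le> \<bar>mass D \<kappa> w - m' k w\<bar>"
      using assms[of w] mult_mono[of "mass D \<kappa> w - m' k w" "\<bar>mass D \<kappa> w - m' k w\<bar>" "h w" 1] by simp
  qed
  finally show ?thesis using mass_close by linarith
qed

lemma ex2_words_le:
  assumes "\<And>w w'. 0 \<le> h w w' \<and> h w w' \<le> 1"
  shows "ex D (\<lambda>x. ex D (\<lambda>y. h (\<kappa> x) (\<kappa> y) * of_bool (E x y = b)))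
    \<le> ex D' (\<lambda>x. ex D' (\<lambda>y. h (\<kappa>' k x) (\<kappa>' k y) * of_bool (E' x y = b))) + \<delta>"
proof -
  let ?e = "emass D (\<lambda>x y. E x y = b) \<kappa>" and ?e' = "emass D' (\<lambda>x y. E' x y = b) (\<kappa>' k)"
  have "ex D (\<lambda>x. ex D (\<lambda>y. h (\<kappa> x) (\<kappa> y) * of_bool (E x y = b)))
    - ex D' (\<lambda>x. ex D' (\<lambda>y. h (\<kappa>' k x) (\<kappa>' k y) * of_bool (E' x y = b)))
    = (\<Sum>w | length w = k. \<Sum>w' | length w' = k. (?e w w' - ?e' w w') * h w w')"
    using ex2_words[OF fin, of \<kappa> k h "\<lambda>x y. E x y = b"] ex2_words[OF fin', of "\<kappa>' k" k h "\<lambda>x y. E' x y = b"]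
    by (simp add: sum_subtractf left_diff_distrib)
  also have "\<dots> \<le> (\<Sum>w | length w = k. \<Sum>w' | length w' = k. \<bar>?e w w' - ?e' w w'\<bar>)"
  proof (intro sum_mono)
    fix w w' :: code
    show "(?e w w' - ?e' w w') * h w w' \<le> \<bar>?e w w' - ?e' w w'\<bar>"
      using assms[of w w'] mult_mono[of "?e w w' - ?e' w w'" "\<bar>?e w w' - ?e' w w'\<bar>" "h w w'" 1] by simp
  qed
  finally show ?thesis using emass_close[of b] by linarith
qed

text \<open>There are \<open>8 ^ r\<close> words of length \<open>r\<close>, and every light one
  contributes at most \<open>s\<close>.\<close>

lemma small_cells: "ex D' (\<lambda>x. of_bool (m' r (\<kappa>' r x) < s)) \<le> 8 ^ r * s" if "0 \<le> s"
proof -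
  have "ex D' (\<lambda>x. of_bool (m' r (\<kappa>' r x) < s)) = (\<Sum>w | length w = r. m' r w * of_bool (m' r w < s))"
    using ex_words[OF fin', of "\<kappa>' r" r "\<lambda>w. of_bool (m' r w < s)"] by simp
  also have "\<dots> \<le> (\<Sum>w :: code | length w = r. s)"
    using that by (intro sum_mono) auto
  finally show ?thesis by (simp add: card_words)
qed

text \<open>The three ways of paying for the rounding: vertices whose cell is too light in the target,
  vertices sent to an atom that level \<open>k\<close> does not isolate, and changed pairs.\<close>

lemma lost_light: "(\<Sum>u\<in>set_pmf D - V. pmf D u) \<le> 2 * \<delta>"
proof -
  have "(\<Sum>u\<in>set_pmf D - V. pmf D u) = ex D (\<lambda>u. of_bool (m' k (\<kappa> u) < \<tau>))"
    unfolding ex_eq_sum[OF fin] using fin by (intro sum.mono_neutral_cong_left) (auto simp: V_def)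
  also have "\<dots> \<le> ex D' (\<lambda>x. of_bool (m' k (\<kappa>' k x) < \<tau>)) + \<delta>"
    by (rule ex_words_le[of "\<lambda>w. of_bool (m' k w < \<tau>)"]) simp
  also have "\<dots> \<le> 2 * \<delta>" using small_cells[of \<tau> k] pos small by simp
  finally show ?thesis .
qed

text \<open>The marginal of \<open>g u\<close> is the target cell with the level-\<open>k\<close>
  word of \<open>u\<close>. Passing from \<open>D\<close> to \<open>D'\<close> costs
  \<open>\<delta>\<close>; over \<open>D'\<close> these cells average to \<open>D'\<close> itself,
  where \<open>atoms\<close> gives \<open>2 * \<delta>\<close>.\<close>

lemma lost_atoms: "ex M (\<lambda>g. \<Sum>u\<in>V. pmf D u * of_bool (k \<le> rk' (g u) \<and> rk' (g u) < j)) \<le> 3 * \<delta>"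
proof -
  let ?a = "\<lambda>x. of_bool (k \<le> rk' x \<and> rk' x < j) :: real"
  let ?A = "\<lambda>w. ex (cell D' (\<kappa>' k) w) ?a"
  let ?h = "\<lambda>w. of_bool (\<tau> \<le> m' k w) * ?A w"
  have A: "0 \<le> ?A w \<and> ?A w \<le> 1" for w by (rule ex_bounded) auto
  have "ex M (\<lambda>g. \<Sum>u\<in>V. pmf D u * ?a (g u)) = (\<Sum>u\<in>V. pmf D u * ?A (\<kappa> u))"
    unfolding ex_sum[OF finM] integral_mult_right_zero by (intro sum.cong refl) (simp add: M_def ex_Pi_marginal[where h = ?a])
  also have "\<dots> = ex D (\<lambda>u. ?h (\<kappa> u))"
    unfolding ex_eq_sum[OF fin] using fin by (intro sum.mono_neutral_cong_left) (auto simp: V_def)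
  also have "\<dots> \<le> ex D' (\<lambda>x. ?h (\<kappa>' k x)) + \<delta>"
    by (rule ex_words_le[of ?h]) (use A in auto)
  also have "ex D' (\<lambda>x. ?h (\<kappa>' k x)) \<le> ex D' (\<lambda>x. ?A (\<kappa>' k x))"
    using A by (intro ex_mono fin') (auto simp: mult_left_le_one_le)
  also have "\<dots> = measure_pmf.prob D' {x. k \<le> rk' x \<and> rk' x < j}"
    unfolding ex_cell_avg[OF fin'] prob_eq_ex ..
  finally show ?thesis using atoms by simp
qed

text \<open>The averaging over level-\<open>k\<close> cells is moved from the indicator to
  \<open>E'\<close>, which becomes \<open>W k\<close>. Where \<open>W j\<close> is below
  \<open>\<delta>\<close>, \<open>W k\<close> is at most \<open>\<delta>\<close> plus its distance
  to \<open>W j\<close>, and that distance is at most \<open>\<delta>\<close> on average by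
  \<open>energy_kj\<close>.\<close>

lemma mismatch_density:
  "ex D' (\<lambda>x. ex D' (\<lambda>y. ex (cell D' (\<kappa>' k) (\<kappa>' k x)) (\<lambda>x'. ex (cell D' (\<kappa>' k) (\<kappa>' k y)) (\<lambda>y'. of_bool (W j b x' y' < \<delta>)))
      * of_bool (E' x y = b))) \<le> 2 * \<delta>"
proof -
  define q where "q w w' = ex (cell D' (\<kappa>' k) w) (\<lambda>x'. ex (cell D' (\<kappa>' k) w') (\<lambda>y'. of_bool (W j b x' y' < \<delta>)))" for w w'
  define t where "t w w' = ex (cell D' (\<kappa>' k) w) (\<lambda>x'. ex (cell D' (\<kappa>' k) w') (\<lambda>y'. of_bool (E' x' y' = b)))" for w w'
  have t: "t (\<kappa>' k x) (\<kappa>' k y) = W k b x y" for x y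
    by (simp add: t_def W_def dens_def)
  have "ex D' (\<lambda>x. ex D' (\<lambda>y. q (\<kappa>' k x) (\<kappa>' k y) * of_bool (E' x y = b)))
    = ex D' (\<lambda>x. ex D' (\<lambda>y. q (\<kappa>' k x) (\<kappa>' k y) * W k b x y))"
    unfolding W_def by (rule dens_proj[OF fin', symmetric])
  also have "\<dots> = ex D' (\<lambda>x. ex D' (\<lambda>y. t (\<kappa>' k x) (\<kappa>' k y) * q (\<kappa>' k x) (\<kappa>' k y)))"
    by (simp add: t mult.commute)
  also have "\<dots> = ex D' (\<lambda>x. ex D' (\<lambda>y. t (\<kappa>' k x) (\<kappa>' k y) * of_bool (W j b x y < \<delta>)))"
    unfolding q_def by (rule ex2_cell_avg[OF fin'])
  also have "\<dots> \<le> ex D' (\<lambda>x. ex D' (\<lambda>y. \<bar>W j True x y - W k True x y\<bar> + \<delta>))"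
  proof (intro ex_mono fin')
    fix x y assume xy: "x \<in> set_pmf D'" "y \<in> set_pmf D'"
    show "t (\<kappa>' k x) (\<kappa>' k y) * of_bool (W j b x y < \<delta>) \<le> \<bar>W j True x y - W k True x y\<bar> + \<delta>"
      using W_diff[OF xy, of j b k] pos unfolding t by (auto simp: abs_if split: if_splits)
  qed
  also have "\<dots> = ex D' (\<lambda>x. ex D' (\<lambda>y. \<bar>W j True x y - W k True x y\<bar>)) + \<delta>"
    using fin' by (simp add: ex_add)
  also have "ex D' (\<lambda>x. ex D' (\<lambda>y. \<bar>W j True x y - W k True x y\<bar>)) \<le> \<delta>"
  proof -
    have "ex D' (\<lambda>x. ex D' (\<lambda>y. \<bar>W j True x y - W k True x y\<bar>)) \<le> sqrt (energy D' E' (\<kappa>' j) - energy D' E' (\<kappa>' k))"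
      unfolding W_True by (intro dens_L1_le fin' finer_code levels)
    also have "\<dots> \<le> sqrt (\<delta>\<^sup>2)" using energy_kj by (rule real_sqrt_le_mono)
    finally show ?thesis using pos by simp
  qed
  finally show ?thesis unfolding q_def by simp
qed

text \<open>For either status of a pair, \<open>mismatch_density\<close> yields
  \<open>2 * \<delta>\<close> and the passage from \<open>D\<close> to \<open>D'\<close> another
  \<open>\<delta>\<close>.\<close>

lemma mismatch: "ex M (\<lambda>g. \<Sum>u\<in>V. \<Sum>v\<in>V - {u}. pmf D u * pmf D v * of_bool (pat g u v \<noteq> E u v)) \<le> 6 * \<delta>"
proof -
  define q where "q b w w' = ex (cell D' (\<kappa>' k) w) (\<lambda>x'. ex (cell D' (\<kappa>' k) w') (\<lambda>y'. of_bool (W j b x' y' < \<delta>)))" for b w w'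
  define h where "h b w w' = of_bool (\<tau> \<le> m' k w \<and> \<tau> \<le> m' k w') * q b w w'" for b w w'
  have q: "0 \<le> q b w w' \<and> q b w w' \<le> 1" for b w w' unfolding q_def by (intro ex_bounded) auto
  have h: "0 \<le> h b w w' \<and> h b w w' \<le> 1" for b w w' unfolding h_def using q by auto
  have pair: "ex M (\<lambda>g. of_bool (pat g u v \<noteq> E u v)) = h (E u v) (\<kappa> u) (\<kappa> v)" if "u \<in> V" "v \<in> V" "u \<noteq> v" for u v
  proof -
    have "ex M (\<lambda>g. of_bool (pat g u v \<noteq> E u v)) = ex M (\<lambda>g. of_bool (W j (E u v) (g u) (g v) < \<delta>))"
      by (intro ex_cong) (auto simp: pat_def)
    also have "\<dots> = q (E u v) (\<kappa> u) (\<kappa> v)"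
      unfolding M_def q_def using that fin_cell_V
      by (intro ex_Pi_marginal2[where h = "\<lambda>x y. of_bool (W j (E u v) x y < \<delta>)"]) auto
    finally show ?thesis using that V_mass by (simp add: h_def)
  qed
  have "ex M (\<lambda>g. \<Sum>u\<in>V. \<Sum>v\<in>V - {u}. pmf D u * pmf D v * of_bool (pat g u v \<noteq> E u v))
    = (\<Sum>u\<in>V. \<Sum>v\<in>V - {u}. pmf D u * pmf D v * h (E u v) (\<kappa> u) (\<kappa> v))"
    unfolding ex_sum[OF finM] integral_mult_right_zero by (intro sum.cong refl arg_cong2[where f = "(*)"] pair) auto
  \<comment> \<open>The diagonal was left out because independence of \<open>g u\<close> and
    \<open>g v\<close> needs \<open>u \<noteq> v\<close>; for an upper bound it may be
    restored.\<close>
  also have "\<dots> \<le> (\<Sum>u\<in>set_pmf D. \<Sum>v\<in>set_pmf D. pmf D u * pmf D v * h (E u v) (\<kappa> u) (\<kappa> v))"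
    using fin V_sub h by (intro order_trans[OF sum_mono[OF sum_mono2] sum_mono2]) (auto intro!: sum_nonneg)
  also have "\<dots> = ex D (\<lambda>x. ex D (\<lambda>y. h (E x y) (\<kappa> x) (\<kappa> y)))"
    using fin by (simp add: ex_eq_sum sum_distrib_left mult.assoc)
  also have "\<dots> = ex D (\<lambda>x. ex D (\<lambda>y. h True (\<kappa> x) (\<kappa> y) * of_bool (E x y = True) + h False (\<kappa> x) (\<kappa> y) * of_bool (E x y = False)))"
    by (intro ex_cong) (auto simp: of_bool_def)
  also have "\<dots> = ex D (\<lambda>x. ex D (\<lambda>y. h True (\<kappa> x) (\<kappa> y) * of_bool (E x y = True)))
     + ex D (\<lambda>x. ex D (\<lambda>y. h False (\<kappa> x) (\<kappa> y) * of_bool (E x y = False)))"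
    using fin by (simp only: ex_add)
  also have "\<dots> \<le> 3 * \<delta> + 3 * \<delta>"
  proof (rule add_mono)
    have "ex D (\<lambda>x. ex D (\<lambda>y. h b (\<kappa> x) (\<kappa> y) * of_bool (E x y = b))) \<le> 3 * \<delta>" for b
    proof -
      have "ex D (\<lambda>x. ex D (\<lambda>y. h b (\<kappa> x) (\<kappa> y) * of_bool (E x y = b)))
        \<le> ex D' (\<lambda>x. ex D' (\<lambda>y. h b (\<kappa>' k x) (\<kappa>' k y) * of_bool (E' x y = b))) + \<delta>"
        by (rule ex2_words_le[OF h])
      also have "ex D' (\<lambda>x. ex D' (\<lambda>y. h b (\<kappa>' k x) (\<kappa>' k y) * of_bool (E' x y = b)))
        \<le> ex D' (\<lambda>x. ex D' (\<lambda>y. q b (\<kappa>' k x) (\<kappa>' k y) * of_bool (E' x y = b)))"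
        using q by (intro ex_mono fin') (auto simp: h_def)
      also have "\<dots> \<le> 2 * \<delta>" unfolding q_def by (rule mismatch_density)
      finally show ?thesis by simp
    qed
    then show "ex D (\<lambda>x. ex D (\<lambda>y. h True (\<kappa> x) (\<kappa> y) * of_bool (E x y = True))) \<le> 3 * \<delta>"
      "ex D (\<lambda>x. ex D (\<lambda>y. h False (\<kappa> x) (\<kappa> y) * of_bool (E x y = False))) \<le> 3 * \<delta>" by blast+
  qed
  finally show ?thesis by simp
qed

lemma ex_cost: "ex M cost \<le> 11 * \<delta>"
proof -
  have "cost g = (\<Sum>u\<in>set_pmf D - V. pmf D u) + (\<Sum>u\<in>V. pmf D u * of_bool (k \<le> rk' (g u) \<and> rk' (g u) < j))
     + (\<Sum>u\<in>V. \<Sum>v\<in>V - {u}. pmf D u * pmf D v * of_bool (pat g u v \<noteq> E u v))" for g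
  proof -
    have "(\<Sum>u\<in>set_pmf D - R g. pmf D u) = (\<Sum>u\<in>(set_pmf D - V) \<union> (V - R g). pmf D u)"
      using V_sub by (intro sum.cong) (auto simp: R_def)
    also have "\<dots> = (\<Sum>u\<in>set_pmf D - V. pmf D u) + (\<Sum>u\<in>V - R g. pmf D u)"
      using fin by (intro sum.union_disjoint) auto
    also have "(\<Sum>u\<in>V - R g. pmf D u) = (\<Sum>u\<in>V. pmf D u * of_bool (k \<le> rk' (g u) \<and> rk' (g u) < j))"
      by (intro sum.mono_neutral_cong_left) (auto simp: R_def)
    finally show ?thesis unfolding cost_def by simp
  qed
  then have "ex M cost = ex M (\<lambda>g. (\<Sum>u\<in>set_pmf D - V. pmf D u) + (\<Sum>u\<in>V. pmf D u * of_bool (k \<le> rk' (g u) \<and> rk' (g u) < j))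
     + (\<Sum>u\<in>V. \<Sum>v\<in>V - {u}. pmf D u * pmf D v * of_bool (pat g u v \<noteq> E u v)))"
    by (intro ex_cong)
  also have "\<dots> = (\<Sum>u\<in>set_pmf D - V. pmf D u) + ex M (\<lambda>g. \<Sum>u\<in>V. pmf D u * of_bool (k \<le> rk' (g u) \<and> rk' (g u) < j))
     + ex M (\<lambda>g. \<Sum>u\<in>V. \<Sum>v\<in>V - {u}. pmf D u * pmf D v * of_bool (pat g u v \<noteq> E u v))"
    by (simp only: ex_add[OF finM]) simp
  finally show ?thesis using lost_light lost_atoms mismatch by linarith
qed

lemma cost_nonneg: "0 \<le> cost g"
  unfolding cost_def by (auto intro!: add_nonneg_nonneg sum_nonneg)

section \<open>Exceptional events and the choice of a rounding\<close>

lemma ex_bad: "ex M (\<lambda>f. of_bool (bad f)) \<le> (\<delta> / 2) ^ n\<^sup>2 / 16"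
proof -
  let ?p = "\<lambda>x y. of_bool (\<bar>W l True x y - W j True x y\<bar> > \<delta> / 2) + of_bool (x = y \<and> j \<le> rk' x) :: real"
  let ?c = "4 / \<delta>\<^sup>2 * \<beta> + 1 / (real j + 1)"
  \<comment> \<open>Chebyshev's inequality; the second moment is the energy difference between
    levels \<open>j\<close> and \<open>l\<close>.\<close>
  have dev: "ex D' (\<lambda>x. ex D' (\<lambda>y. of_bool (\<bar>W l True x y - W j True x y\<bar> > \<delta> / 2))) \<le> 4 / \<delta>\<^sup>2 * \<beta>"
  proof -
    have "of_bool (\<bar>W l True x y - W j True x y\<bar> > \<delta> / 2) \<le> 4 / \<delta>\<^sup>2 * (W l True x y - W j True x y)\<^sup>2" for x y
    proof (cases "\<bar>W l True x y - W j True x y\<bar> > \<delta> / 2")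
      case True
      then have "(\<delta> / 2)\<^sup>2 \<le> \<bar>W l True x y - W j True x y\<bar>\<^sup>2" using pos by (intro power_mono) auto
      then show ?thesis using pos True by (simp add: field_simps power_divide)
    qed simp
    then have "ex D' (\<lambda>x. ex D' (\<lambda>y. of_bool (\<bar>W l True x y - W j True x y\<bar> > \<delta> / 2)))
      \<le> ex D' (\<lambda>x. ex D' (\<lambda>y. 4 / \<delta>\<^sup>2 * (W l True x y - W j True x y)\<^sup>2))"
      by (intro ex_mono fin')
    also have "\<dots> = 4 / \<delta>\<^sup>2 * (energy D' E' (\<kappa>' l) - energy D' E' (\<kappa>' j))"
      unfolding W_True energy_increment[OF fin' finer_code[OF levels(2)], symmetric] integral_mult_right_zero ..
    also have "\<dots> \<le> 4 / \<delta>\<^sup>2 * \<beta>" using energy_jl by (intro mult_left_mono) auto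
    finally show ?thesis .
  qed
  \<comment> \<open>By \<open>light\<close>, a common target of rank at least \<open>j\<close> has
    weight at most \<open>1 / (real j + 1)\<close>.\<close>
  have col: "ex D' (\<lambda>x. ex D' (\<lambda>y. of_bool (x = y \<and> j \<le> rk' x))) \<le> 1 / (real j + 1)"
  proof (rule ex_le_const[OF fin'])
    fix x assume x: "x \<in> set_pmf D'"
    show "ex D' (\<lambda>y. of_bool (x = y \<and> j \<le> rk' x)) \<le> 1 / (real j + 1)"
    proof (cases "j \<le> rk' x")
      case True
      then have "ex D' (\<lambda>y. of_bool (x = y \<and> j \<le> rk' x)) = pmf D' x"
        using prob_eq_ex[of D' "\<lambda>y. y = x"] by (simp add: pmf.rep_eq eq_commute)
      also have "\<dots> \<le> 1 / (real (rk' x) + 1)" by (rule light[OF x])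
      also have "\<dots> \<le> 1 / (real j + 1)" using True by (intro divide_left_mono) auto
      finally show ?thesis .
    qed simp
  qed
  have tot: "ex D' (\<lambda>x. ex D' (?p x)) \<le> ?c"
    using dev col fin' by (simp add: ex_add)
  have "ex M (\<lambda>f. of_bool (bad f)) \<le> ex M (\<lambda>f. \<Sum>u\<in>V. \<Sum>v\<in>V - {u}. ?p (f u) (f v))"
  proof (rule ex_mono[OF finM])
    fix f
    show "of_bool (bad f) \<le> (\<Sum>u\<in>V. \<Sum>v\<in>V - {u}. ?p (f u) (f v))"
    proof (cases "bad f")
      case True
      then obtain u v where uv: "u \<in> V" "v \<in> V - {u}" "1 \<le> ?p (f u) (f v)" unfolding bad_def by fastforce
      note uv(3)
      also have "?p (f u) (f v) \<le> (\<Sum>v\<in>V - {u}. ?p (f u) (f v))"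
        using uv by (intro member_le_sum[of v _ "\<lambda>v. ?p (f u) (f v)"]) auto
      also have "\<dots> \<le> (\<Sum>u\<in>V. \<Sum>v\<in>V - {u}. ?p (f u) (f v))"
        using uv by (intro member_le_sum[of u _ "\<lambda>u. \<Sum>v\<in>V - {u}. ?p (f u) (f v)"] sum_nonneg) auto
      finally show ?thesis by simp
    qed (auto intro!: sum_nonneg)
  qed
  also have "\<dots> = (\<Sum>u\<in>V. \<Sum>v\<in>V - {u}. ex M (\<lambda>f. ?p (f u) (f v)))"
    unfolding ex_sum[OF finM] ..
  \<comment> \<open>Restricting both coordinates to cells of mass at least \<open>\<tau>\<close>
    costs the factor \<open>1 / \<tau>\<^sup>2\<close>.\<close>
  also have "\<dots> \<le> (\<Sum>u\<in>V. \<Sum>v\<in>V - {u}. ?c / \<tau>\<^sup>2)"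
  proof (intro sum_mono)
    fix u v assume uv: "u \<in> V" "v \<in> V - {u}"
    have "ex M (\<lambda>f. ?p (f u) (f v)) = ex (cell D' (\<kappa>' k) (\<kappa> u)) (\<lambda>x. ex (cell D' (\<kappa>' k) (\<kappa> v)) (?p x))"
      unfolding M_def using uv fin_cell_V by (intro ex_Pi_marginal2[where h = ?p]) auto
    also have "\<dots> \<le> ex D' (\<lambda>x. ex D' (?p x)) / \<tau>\<^sup>2"
      using uv V_mass pos by (intro ex2_cell_le fin') auto
    also have "\<dots> \<le> ?c / \<tau>\<^sup>2" using tot by (intro divide_right_mono) auto
    finally show "ex M (\<lambda>f. ?p (f u) (f v)) \<le> ?c / \<tau>\<^sup>2" .
  qed
  also have "\<dots> \<le> (\<Sum>u\<in>V. \<Sum>v\<in>V. ?c / \<tau>\<^sup>2)"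
    using pos by (intro sum_mono sum_mono2) (auto intro!: divide_nonneg_nonneg add_nonneg_nonneg)
  also have "\<dots> = real ((card V)\<^sup>2) * (?c / \<tau>\<^sup>2)" by (simp add: power2_eq_square)
  also have "\<dots> \<le> real (n\<^sup>2) * (?c / \<tau>\<^sup>2)"
    using card_V pos by (intro mult_right_mono) (auto intro!: divide_nonneg_nonneg add_nonneg_nonneg power_mono)
  also have "\<dots> \<le> (\<delta> / 2) ^ n\<^sup>2 / 16" using small(6) by (simp only: of_nat_power)
  finally show ?thesis .
qed

lemma ex_light: "ex M (\<lambda>g. of_bool (\<exists>u\<in>V. m' j (\<kappa>' j (g u)) < \<sigma>)) \<le> 1 / 4"
proof -
  let ?p = "\<lambda>x. of_bool (m' j (\<kappa>' j x) < \<sigma>) :: real"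
  have "ex M (\<lambda>g. of_bool (\<exists>u\<in>V. m' j (\<kappa>' j (g u)) < \<sigma>)) \<le> ex M (\<lambda>g. \<Sum>u\<in>V. ?p (g u))"
  proof (rule ex_mono[OF finM])
    fix g
    show "of_bool (\<exists>u\<in>V. m' j (\<kappa>' j (g u)) < \<sigma>) \<le> (\<Sum>u\<in>V. ?p (g u))"
    proof (cases "\<exists>u\<in>V. m' j (\<kappa>' j (g u)) < \<sigma>")
      case True
      then obtain u where u: "u \<in> V" "m' j (\<kappa>' j (g u)) < \<sigma>" by blast
      then have "1 \<le> ?p (g u)" by simp
      also have "\<dots> \<le> (\<Sum>u\<in>V. ?p (g u))" using u by (intro member_le_sum[of u _ "\<lambda>u. ?p (g u)"]) auto
      finally show ?thesis by simp
    qed (auto intro!: sum_nonneg)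
  qed
  also have "\<dots> = (\<Sum>u\<in>V. ex M (\<lambda>g. ?p (g u)))"
    unfolding ex_sum[OF finM] ..
  also have "\<dots> \<le> (\<Sum>u\<in>V. 8 ^ j * \<sigma> / \<tau>)"
  proof (intro sum_mono)
    fix u assume u: "u \<in> V"
    have "ex M (\<lambda>g. ?p (g u)) = ex (cell D' (\<kappa>' k) (\<kappa> u)) ?p"
      unfolding M_def using u by (intro ex_Pi_marginal) auto
    also have "\<dots> \<le> ex D' ?p / \<tau>" using u V_mass pos by (intro ex_cell_le fin') auto
    also have "\<dots> \<le> 8 ^ j * \<sigma> / \<tau>" using small_cells[of \<sigma> j] pos by (intro divide_right_mono) auto
    finally show "ex M (\<lambda>g. ?p (g u)) \<le> 8 ^ j * \<sigma> / \<tau>" .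
  qed
  also have "\<dots> = real (card V) * (8 ^ j * \<sigma> / \<tau>)" by simp
  also have "\<dots> \<le> real n * (8 ^ j * \<sigma> / \<tau>)" using card_V pos by (intro mult_right_mono) auto
  also have "\<dots> = n * (8 ^ j * \<sigma>) / \<tau>" by simp
  also note small(5)
  finally show ?thesis .
qed

text \<open>Divided by their thresholds, the three quantities have expectations at most
  \<open>1 / 3\<close>, \<open>1 / 4\<close> and \<open>1 / 4\<close>. Their sum is below 1 on
  average, hence for some \<open>g\<close>, and then so is each term.\<close>

lemma ex_choice:
  "\<exists>g\<in>set_pmf M. cost g < \<epsilon> \<and> ex (Mg g) (\<lambda>f. of_bool (bad f)) < (\<delta> / 2) ^ n\<^sup>2 / 4 \<and> (\<forall>u\<in>V. \<sigma> \<le> m' j (\<kappa>' j (g u)))"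
proof -
  let ?\<pi> = "(\<delta> / 2) ^ n\<^sup>2"
  let ?b = "\<lambda>g. ex (Mg g) (\<lambda>f. of_bool (bad f))" and ?s = "\<lambda>g. of_bool (\<exists>u\<in>V. m' j (\<kappa>' j (g u)) < \<sigma>) :: real"
  have \<pi>: "0 < ?\<pi>" using pos by simp
  have "ex M (\<lambda>g. of_bool (bad g)) = ex (bind_pmf M Mg) (\<lambda>g. of_bool (bad g))" by (simp flip: M_resample)
  also have "\<dots> = ex M ?b" by (intro ex_bind finM finMg)
  finally have b: "ex M ?b \<le> ?\<pi> / 16" using ex_bad by simp
  have "ex M (\<lambda>g. cost g / \<epsilon> + ?b g / (?\<pi> / 4) + ?s g) = ex M cost / \<epsilon> + ex M ?b / (?\<pi> / 4) + ex M ?s"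
    by (simp only: ex_add[OF finM]) simp
  also have "\<dots> \<le> 1 / 3 + 1 / 4 + 1 / 4"
  proof (intro add_mono)
    have "ex M cost \<le> \<epsilon> / 3" using ex_cost small(2) by linarith
    then show "ex M cost / \<epsilon> \<le> 1 / 3" using pos by (simp add: field_simps)
    show "ex M ?b / (?\<pi> / 4) \<le> 1 / 4" using b \<pi> by (simp add: field_simps)
  qed (rule ex_light)
  also have "\<dots> < (1 :: real)" by simp
  finally obtain g where g: "g \<in> set_pmf M" "cost g / \<epsilon> + ?b g / (?\<pi> / 4) + ?s g < 1"
    using ex_lt_imp[OF finM] by blast
  have nn: "0 \<le> cost g / \<epsilon>" "0 \<le> ?b g / (?\<pi> / 4)" "0 \<le> ?s g"
    using cost_nonneg[of g] pos \<pi> by (auto intro!: divide_nonneg_pos ex_nonneg)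
  have "cost g / \<epsilon> < 1" "?b g / (?\<pi> / 4) < 1" "?s g < 1" using g(2) nn by linarith+
  then have "cost g < \<epsilon>" "?b g < ?\<pi> / 4" "\<forall>u\<in>V. \<sigma> \<le> m' j (\<kappa>' j (g u))"
    using pos \<pi> by (auto simp: pos_divide_less_eq not_less split: if_splits)
  then show ?thesis using g(1) by blast
qed

section \<open>Counting rounded copies in the target\<close>

lemma cut_gap_cells:
  assumes a: "\<sigma> \<le> m' j w" and b: "\<sigma> \<le> m' j w'" and g: "\<And>x. 0 \<le> g x \<and> g x \<le> (1::real)" and h: "\<And>x. 0 \<le> h x \<and> h x \<le> (1::real)"
  shows "\<bar>ex (cell D' (\<kappa>' j) w) (\<lambda>x. ex (cell D' (\<kappa>' j) w') (\<lambda>y. (of_bool (E' x y = c) - W l c x y) * g x * h y))\<bar> \<le> d / \<sigma>\<^sup>2"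
proof -
  let ?\<Delta> = "\<lambda>x y. of_bool (E' x y) - W l True x y"
  have w: "w \<in> \<kappa>' j ` set_pmf D'" "w' \<in> \<kappa>' j ` set_pmf D'"
    using a b pos mass_pos_iff[of D' "\<kappa>' j"] by (metis less_le_trans)+
  \<comment> \<open>Cell indicators absorbed into the test functions turn expectations over cells
    into expectations over \<open>D'\<close>, at the price of dividing by the two masses.\<close>
  let ?g = "\<lambda>x. of_bool (\<kappa>' j x = w) * g x" and ?h = "\<lambda>y. of_bool (\<kappa>' j y = w') * h y"
  have "ex (cell D' (\<kappa>' j) w) (\<lambda>x. ex (cell D' (\<kappa>' j) w') (\<lambda>y. (of_bool (E' x y = c) - W l c x y) * g x * h y))
    = ex D' (\<lambda>x. of_bool (\<kappa>' j x = w) * (ex D' (\<lambda>y. of_bool (\<kappa>' j y = w') * ((of_bool (E' x y = c) - W l c x y) * g x * h y)) / m' j w')) / m' j w"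
    by (simp only: ex_cell[OF fin' w(1)] ex_cell[OF fin' w(2)])
  also have "\<dots> = ex D' (\<lambda>x. ex D' (\<lambda>y. (of_bool (E' x y = c) - W l c x y) * ?g x * ?h y)) / (m' j w * m' j w')"
    by (simp add: mult_ac flip: integral_mult_right_zero)
  finally have e: "ex (cell D' (\<kappa>' j) w) (\<lambda>x. ex (cell D' (\<kappa>' j) w') (\<lambda>y. (of_bool (E' x y = c) - W l c x y) * g x * h y))
    = ex D' (\<lambda>x. ex D' (\<lambda>y. (of_bool (E' x y = c) - W l c x y) * ?g x * ?h y)) / (m' j w * m' j w')" .
  have T: "\<bar>ex D' (\<lambda>x. ex D' (\<lambda>y. ?\<Delta> x y * ?g x * ?h y))\<bar> \<le> d"
  proof (rule bilinear_extreme[OF fin'])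
    show "0 \<le> ?g x \<and> ?g x \<le> 1" for x using g[of x] by simp
    show "0 \<le> ?h y \<and> ?h y \<le> 1" for y using h[of y] by simp
    show "\<bar>ex D' (\<lambda>x. ex D' (\<lambda>y. ?\<Delta> x y * of_bool (x \<in> S) * of_bool (y \<in> T)))\<bar> \<le> d" for S T
      using regular[of S T] unfolding cut_gap_def W_True .
  qed
  have "\<bar>ex D' (\<lambda>x. ex D' (\<lambda>y. (of_bool (E' x y = c) - W l c x y) * ?g x * ?h y))\<bar> \<le> d"
  proof (cases c)
    \<comment> \<open>For non-edges the deviation only changes its sign.\<close>
    case False
    have "ex D' (\<lambda>x. ex D' (\<lambda>y. (of_bool (E' x y = c) - W l c x y) * ?g x * ?h y)) = ex D' (\<lambda>x. ex D' (\<lambda>y. - (?\<Delta> x y * ?g x * ?h y)))"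
      using False by (intro ex_cong) (simp add: W_False of_bool_not_iff algebra_simps)
    also have "\<dots> = - ex D' (\<lambda>x. ex D' (\<lambda>y. ?\<Delta> x y * ?g x * ?h y))" by simp
    finally show ?thesis using T by simp
  qed (use T in simp)
  moreover have "\<sigma>\<^sup>2 \<le> m' j w * m' j w'" unfolding power2_eq_square using a b pos by (intro mult_mono) auto
  ultimately show ?thesis unfolding e abs_divide using pos
    by (intro frac_le) (auto simp: abs_mult mass_nonneg)
qed

lemma pat_likely: "g u \<in> set_pmf D' \<Longrightarrow> g v \<in> set_pmf D' \<Longrightarrow> \<delta> \<le> W j (pat g u v) (g u) (g v)"
  using small(1) by (cases "E u v") (auto simp: pat_def W_False)

text \<open>A common target of rank below \<open>k\<close> would force equal ranks of two vertices
  of \<open>D\<close>. One of rank at least \<open>k\<close> and below \<open>j\<close> would have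
  the rank of \<open>g u\<close>, which \<open>R g\<close> excludes. So the collision happens at a
  light target.\<close>

lemma not_inj_bad:
  assumes g: "g \<in> set_pmf M" and f: "f \<in> set_pmf (Mg g)" and not_inj: "\<not> inj_on f (R g)"
  shows "bad f"
proof -
  obtain u v where uv: "u \<in> R g" "v \<in> R g" "u \<noteq> v" "f u = f v" using not_inj by (auto simp: inj_on_def)
  then have V: "u \<in> V" "v \<in> V" by (auto simp: R_def)
  note fu = set_Mg[OF g f V(1)] and fv = set_Mg[OF g f V(2)]
  have "j \<le> rk' (f u)"
  proof (rule ccontr)
    assume j: "\<not> j \<le> rk' (f u)"
    show False
    proof (cases "rk' (f u) < k")
      case True
      then have "rk u = rk' (f u)" "rk v = rk' (f v)"
        using code_rk[of D' E' rk' k "f u" D E rk u] code_rk[of D' E' rk' k "f v" D E rk v] fu fv uv(4) by auto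
      then show False using uv V V_sub inj unfolding inj_on_def by (metis subsetD)
    next
      case False
      then have "rk' (g u) = rk' (f u)"
        using code_rk[of D' E' rk' j "f u" D' E' rk' "g u" "rk' (f u)"] fu j by auto
      then show False using uv(1) False j by (auto simp: R_def)
    qed
  qed
  then show ?thesis using uv V unfolding bad_def by blast
qed

text \<open>Outside \<open>bad\<close> all relevant level-\<open>l\<close> densities are at least
  \<open>\<delta> / 2\<close>, so their product has expectation at least \<open>?\<pi>\<close> minus
  the probability of \<open>bad\<close>. Passing to actual pairs costs \<open>?\<pi> / 4\<close> by
  \<open>counting\<close>, and injectivity costs the probability of \<open>bad\<close> once more;
  \<open>?\<pi> / 4\<close> remains.\<close>

lemma good_likely:
  assumes g: "g \<in> set_pmf M" and bad_g: "ex (Mg g) (\<lambda>f. of_bool (bad f)) < (\<delta> / 2) ^ n\<^sup>2 / 4"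
    and heavy: "\<And>u. u \<in> V \<Longrightarrow> \<sigma> \<le> m' j (\<kappa>' j (g u))"
  shows "(\<delta> / 2) ^ n\<^sup>2 / 4 \<le> ex (Mg g) (\<lambda>f. of_bool (good g f))"
proof -
  let ?\<pi> = "(\<delta> / 2) ^ n\<^sup>2" and ?Q = "{(u, v). u \<in> R g \<and> v \<in> R g \<and> rk u < rk v}"
  let ?F = "\<lambda>q x y. of_bool (E' x y = pat g (fst q) (snd q)) :: real" and ?W = "\<lambda>q x y. W l (pat g (fst q) (snd q)) x y"
  let ?P = "\<lambda>F f. \<Prod>q\<in>?Q. F q (f (fst q)) (f (snd q)) :: real"
  have RV: "R g \<subseteq> V" by (auto simp: R_def)
  have QV: "?Q \<subseteq> V \<times> V" using RV by auto
  then have finQ: "finite ?Q" using finite_subset finV by blast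
  have "card ?Q \<le> card (V \<times> V)" using QV by (intro card_mono) auto
  also have "\<dots> \<le> n\<^sup>2" using card_V by (simp add: card_cartesian_product power2_eq_square mult_le_mono)
  finally have card_Q: "card ?Q \<le> n\<^sup>2" .
  have \<pi>: "0 < ?\<pi>" "?\<pi> \<le> 1" using pos small(1) by (auto intro!: power_le_one)
  have "ex (Mg g) (?P ?W) - card ?Q * (d / \<sigma>\<^sup>2) \<le> ex (Mg g) (?P ?F)"
    unfolding Mg_def
  proof (rule counting[where A = V and p = "\<lambda>u. cell D' (\<kappa>' j) (\<kappa>' j (g u))" and Q = ?Q and F = ?F and W = ?W and d = "d / \<sigma>\<^sup>2" and dflt = undefined])
    show "fin_pmf (cell D' (\<kappa>' j) (\<kappa>' j (g u)))" if "u \<in> V" for u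
      using set_M[OF g that] by (intro fin_cell fin') auto
    show "\<bar>ex (cell D' (\<kappa>' j) (\<kappa>' j (g a))) (\<lambda>x. ex (cell D' (\<kappa>' j) (\<kappa>' j (g b)))
        (\<lambda>y. (?F (a, b) x y - ?W (a, b) x y) * k x * h y))\<bar> \<le> d / \<sigma>\<^sup>2"
      if "(a, b) \<in> ?Q" "\<And>x. 0 \<le> k x \<and> k x \<le> (1::real)" "\<And>x. 0 \<le> h x \<and> h x \<le> (1::real)" for a b k h
      using that RV heavy by (simp, intro cut_gap_cells) auto
  qed (use QV W_bounded in auto)
  moreover have "card ?Q * (d / \<sigma>\<^sup>2) \<le> n\<^sup>2 * (d / \<sigma>\<^sup>2)"
    using card_Q pos by (intro mult_right_mono) auto
  ultimately have F: "ex (Mg g) (?P ?W) - ?\<pi> / 4 \<le> ex (Mg g) (?P ?F)" using small(7) by linarith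
  have "ex (Mg g) (\<lambda>f. ?\<pi> - of_bool (bad f)) \<le> ex (Mg g) (?P ?W)"
  proof (intro ex_mono finMg[OF g])
    fix f assume f: "f \<in> set_pmf (Mg g)"
    show "?\<pi> - of_bool (bad f) \<le> ?P ?W f"
    proof (cases "bad f")
      case True
      have "0 \<le> ?P ?W f" using W_bounded by (intro prod_nonneg) auto
      then show ?thesis using True \<pi> by simp
    next
      case False
      have "\<delta> / 2 \<le> ?W q (f (fst q)) (f (snd q))" if q: "q \<in> ?Q" for q
      proof -
        obtain u v where uv: "q = (u, v)" "u \<in> V" "v \<in> V" "u \<noteq> v" using q RV by auto
        note fu = set_Mg[OF g f uv(2)] and fv = set_Mg[OF g f uv(3)] and gu = set_M[OF g uv(2)] and gv = set_M[OF g uv(3)]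
        have "\<delta> \<le> W j (pat g u v) (g u) (g v)" using gu gv by (intro pat_likely) auto
        also have "\<dots> = W j (pat g u v) (f u) (f v)" using fu fv by (intro W_cong) auto
        finally have "\<delta> \<le> W j (pat g u v) (f u) (f v)" .
        moreover have "\<bar>W l True (f u) (f v) - W j True (f u) (f v)\<bar> \<le> \<delta> / 2" 
        proof (rule ccontr)
          assume "\<not> ?thesis"
          then have "bad f" unfolding bad_def using uv by (intro bexI[of _ u] bexI[of _ v]) auto
          then show False using False by simp
        qed
        then have "\<bar>W l (pat g u v) (f u) (f v) - W j (pat g u v) (f u) (f v)\<bar> \<le> \<delta> / 2"
          using W_diff[of "f u" "f v" l "pat g u v" j] fu fv by simp
        ultimately have "\<delta> / 2 \<le> W l (pat g u v) (f u) (f v)" by linarith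
        then show ?thesis by (simp add: uv(1))
      qed
      then have "(\<Prod>q\<in>?Q. \<delta> / 2) \<le> ?P ?W f" using pos by (intro prod_mono) auto
      moreover have "?\<pi> \<le> (\<Prod>q\<in>?Q. \<delta> / 2)" using card_Q pos small(1) by (simp add: power_decreasing)
      ultimately show ?thesis using False by simp
    qed
  qed
  then have W: "?\<pi> - ex (Mg g) (\<lambda>f. of_bool (bad f)) \<le> ex (Mg g) (?P ?W)"
    using finMg[OF g] by (simp add: ex_diff)
  have "ex (Mg g) (\<lambda>f. ?P ?F f - of_bool (bad f)) \<le> ex (Mg g) (\<lambda>f. of_bool (good g f))"
  proof (intro ex_mono finMg[OF g])
    fix f assume f: "f \<in> set_pmf (Mg g)"
    show "?P ?F f - of_bool (bad f) \<le> of_bool (good g f)"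
    proof (cases "good g f \<or> bad f")
      case True
      have "?P ?F f \<le> 1" by (intro prod_le_1) auto
      then show ?thesis using True by auto
    next
      case False
      then obtain u v where "u \<in> R g" "v \<in> R g" "rk u < rk v" "E' (f u) (f v) \<noteq> pat g u v"
        using not_inj_bad[OF g f] unfolding good_def by blast
      then have "?P ?F f = 0" using finQ by (intro prod_zero bexI[of _ "(u, v)"]) auto
      then show ?thesis by simp
    qed
  qed
  then have "ex (Mg g) (?P ?F) - ex (Mg g) (\<lambda>f. of_bool (bad f)) \<le> ex (Mg g) (\<lambda>f. of_bool (good g f))"
    using finMg[OF g] by (simp add: ex_diff)
  then show ?thesis using F W bad_g by linarith
qed

text \<open>Independent samples of \<open>D'\<close> fall into the prescribed level-\<open>j\<close>
  cells with probability at least \<open>\<sigma>\<close> each. Hence the lower bound depends on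
  \<open>\<sigma>\<close>, \<open>n\<close> and \<open>\<delta>\<close> only and is the same for all
  targets \<open>D'\<close>.\<close>

theorem rounding_realized:
  "\<exists>A R c. R \<subseteq> A \<and> A \<subseteq> set_pmf D \<and>
     (\<Sum>u\<in>set_pmf D - R. pmf D u) + (\<Sum>u\<in>R. \<Sum>v\<in>R - {u}. pmf D u * pmf D v * of_bool (c u v \<noteq> E u v)) < \<epsilon> \<and>
     \<sigma> ^ n * ((\<delta> / 2) ^ n\<^sup>2 / 4) \<le> ex (Pi_pmf A undefined (\<lambda>_. D'))
        (\<lambda>f. of_bool (inj_on f R \<and> (\<forall>u\<in>R. \<forall>v\<in>R. rk u < rk v \<longrightarrow> E' (f u) (f v) = c u v)))"
proof -
  obtain g where g: "g \<in> set_pmf M" "cost g < \<epsilon>" "ex (Mg g) (\<lambda>f. of_bool (bad f)) < (\<delta> / 2) ^ n\<^sup>2 / 4"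
    and heavy: "\<And>u. u \<in> V \<Longrightarrow> \<sigma> \<le> m' j (\<kappa>' j (g u))"
    using ex_choice by blast
  have RV: "R g \<subseteq> V" by (auto simp: R_def)
  have "\<sigma> ^ n * ((\<delta> / 2) ^ n\<^sup>2 / 4) \<le> \<sigma> ^ card V * ex (Mg g) (\<lambda>f. of_bool (good g f))"
    using card_V pos small(4) good_likely[OF g(1,3) heavy] by (intro mult_mono power_decreasing) auto
  also have "\<dots> \<le> ex (Pi_pmf V undefined (\<lambda>_. D')) (\<lambda>f. of_bool (good g f))"
    unfolding Mg_def
  proof (rule ex_Pi_dominated)
    fix u assume u: "u \<in> V"
    show "fin_pmf (cell D' (\<kappa>' j) (\<kappa>' j (g u))) \<and> fin_pmf D'"
      using set_M[OF g(1) u] by (auto intro: fin_cell fin')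
    show "\<sigma> * ex (cell D' (\<kappa>' j) (\<kappa>' j (g u))) h \<le> ex D' h" if "\<And>x. 0 \<le> h x" for h
      using ex_cell_le[OF fin' pos(4) heavy[OF u], of h] that pos by (simp add: field_simps)
  qed (use pos in auto)
  finally have "\<sigma> ^ n * ((\<delta> / 2) ^ n\<^sup>2 / 4) \<le> ex (Pi_pmf V undefined (\<lambda>_. D')) (\<lambda>f. of_bool (good g f))" .
  moreover have "(\<Sum>u\<in>set_pmf D - R g. pmf D u)
      + (\<Sum>u\<in>R g. \<Sum>v\<in>R g - {u}. pmf D u * pmf D v * of_bool (pat g u v \<noteq> E u v)) \<le> cost g"
    unfolding cost_def using RV
    by (intro add_left_mono order_trans[OF sum_mono[OF sum_mono2] sum_mono2]) (auto intro!: sum_nonneg intro: finite_subset)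
  ultimately show ?thesis
    using g(2) RV V_sub unfolding good_def by (intro exI[of _ V] exI[of _ "R g"] exI[of _ "pat g"]) auto
qed

end

section \<open>Extendable induced subgraphs\<close>

text \<open>The embedding may go anywhere, so only the isomorphism type of the induced subgraph on
  \<open>S\<close> counts, which is all that a tester can learn.\<close>

definition extendable :: "'a ugraph set \<Rightarrow> nat \<Rightarrow> 'a ugraph \<Rightarrow> 'a set \<Rightarrow> bool" where
  "extendable P N G S \<longleftrightarrow> (\<exists>H\<in>P. card (verts H) = N \<and> (\<exists>\<phi>. inj_on \<phi> S \<and> \<phi> ` S \<subseteq> verts H \<and>
     (\<forall>x\<in>S. \<forall>y\<in>S. x \<noteq> y \<longrightarrow> ({\<phi> x, \<phi> y} \<in> edges H \<longleftrightarrow> {x, y} \<in> edges G))))"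

lemma extendableI:
  assumes "H \<in> P" "card (verts H) = N" "inj_on \<phi> S" "\<phi> ` S \<subseteq> verts H"
    "\<And>x y. x \<in> S \<Longrightarrow> y \<in> S \<Longrightarrow> x \<noteq> y \<Longrightarrow> {\<phi> x, \<phi> y} \<in> edges H \<longleftrightarrow> {x, y} \<in> edges G"
  shows "extendable P N G S"
  unfolding extendable_def using assms by (intro bexI[of _ H] conjI exI[of _ \<phi>] ballI impI)

lemma extendable_subset:
  assumes "extendable P N G S" "T \<subseteq> S"
  shows "extendable P N G T"
proof -
  obtain H \<phi> where H: "H \<in> P" "card (verts H) = N" "inj_on \<phi> S" "\<phi> ` S \<subseteq> verts H"
    and \<phi>: "\<forall>x\<in>S. \<forall>y\<in>S. x \<noteq> y \<longrightarrow> ({\<phi> x, \<phi> y} \<in> edges H \<longleftrightarrow> {x, y} \<in> edges G)"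
    using assms(1) unfolding extendable_def by (elim bexE conjE exE)
  have "inj_on \<phi> T" "\<phi> ` T \<subseteq> verts H" using H assms(2) by (auto intro: inj_on_subset)
  then show ?thesis
    by (rule extendableI[OF H(1,2)]) (rule \<phi>[rule_format]; use assms(2) in blast)
qed

lemma extendable_self: "G \<in> P \<Longrightarrow> S \<subseteq> verts G \<Longrightarrow> extendable P (card (verts G)) G S"
  unfolding extendable_def by (intro bexI[of _ G] conjI exI[of _ "\<lambda>x. x"]) (simp_all add: inj_on_def)

text \<open>As \<open>P\<close> is hereditary, vertices of the witness outside the image of
  \<open>S\<close> can be deleted until \<open>N\<close> vertices remain.\<close>

lemma extendable_shrink:
  assumes P: "graph_property P" "hereditary P" and ext: "extendable P N' G S"
    and S: "finite S" "card S \<le> N" and N: "0 < N" "N \<le> N'"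
  shows "extendable P N G S"
proof -
  obtain H \<phi> where H: "H \<in> P" "card (verts H) = N'" "inj_on \<phi> S" "\<phi> ` S \<subseteq> verts H"
    and \<phi>: "\<forall>x\<in>S. \<forall>y\<in>S. x \<noteq> y \<longrightarrow> ({\<phi> x, \<phi> y} \<in> edges H \<longleftrightarrow> {x, y} \<in> edges G)"
    using ext unfolding extendable_def by (elim bexE conjE exE)
  have "finite (verts H)" using P(1) H(1) unfolding graph_property_def simple_graph_def by blast
  then have fin: "finite (verts H - \<phi> ` S)" and "card (verts H - \<phi> ` S) = N' - card S"
    using H S by (auto simp: card_Diff_subset card_image)
  then obtain Y where Y: "Y \<subseteq> verts H - \<phi> ` S" "card Y = N - card S" "finite Y"
    using obtain_subset_with_card_n[of "N - card S" "verts H - \<phi> ` S"] N by (metis diff_le_mono)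
  let ?X = "\<phi> ` S \<union> Y"
  let ?H = "remove_verts H (verts H - ?X)"
  have vH: "verts ?H = ?X" using H Y by (auto simp: remove_verts_def)
  have "card ?X = N"
    using Y S H by (subst card_Un_disjoint) (auto simp: card_image)
  moreover from this have "?X \<noteq> {}" using N by (metis card.empty less_irrefl)
  then have "?H \<in> P" using P(2) H(1) vH unfolding hereditary_def by (metis remove_verts_def ugraph.select_convs(1))
  ultimately show ?thesis
    using vH H(3) by (intro extendableI[of ?H _ _ \<phi>]) (auto simp: remove_verts_def \<phi>)
qed

text \<open>After the witness is shrunk to \<open>card (verts G)\<close> vertices, its embedding of
  \<open>R\<close> is completed to a bijection from \<open>verts G\<close>, along which the witness
  is pulled back.\<close>

lemma extendable_realize:
  assumes P: "graph_property P" "hereditary P" and G: "simple_graph G" and R: "R \<subseteq> verts G" and f: "inj_on f R"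
    and ext: "extendable P N' G' (f ` R)" and N': "card (verts G) \<le> N'"
  shows "\<exists>H\<in>P. verts H = verts G \<and> (\<forall>x\<in>R. \<forall>y\<in>R. x \<noteq> y \<longrightarrow> ({x, y} \<in> edges H \<longleftrightarrow> {f x, f y} \<in> edges G'))"
proof -
  have finG: "finite (verts G)" "verts G \<noteq> {}" using G by (auto simp: simple_graph_def)
  have finR: "finite R" using finG R finite_subset by blast
  have "extendable P (card (verts G)) G' (f ` R)"
    using P ext finG N' finR R f by (intro extendable_shrink[OF P ext]) (auto simp: card_image card_mono card_gt_0_iff)
  then obtain H \<phi> where H: "H \<in> P" "card (verts H) = card (verts G)" "inj_on \<phi> (f ` R)" "\<phi> ` f ` R \<subseteq> verts H"
    and \<phi>f: "\<forall>x\<in>f ` R. \<forall>y\<in>f ` R. x \<noteq> y \<longrightarrow> ({\<phi> x, \<phi> y} \<in> edges H \<longleftrightarrow> {x, y} \<in> edges G')"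
    unfolding extendable_def by (elim bexE conjE exE)
  have \<phi>: "{\<phi> (f x), \<phi> (f y)} \<in> edges H \<longleftrightarrow> {f x, f y} \<in> edges G'" if "x \<in> R" "y \<in> R" "x \<noteq> y" for x y
    using that f by (intro \<phi>f[rule_format]) (auto simp: inj_on_def)
  have simple_H: "simple_graph H" using P(1) H(1) unfolding graph_property_def by blast
  then have finH: "finite (verts H)" by (simp add: simple_graph_def)
  let ?\<psi> = "\<phi> \<circ> f"
  have \<psi>: "inj_on ?\<psi> R" "?\<psi> ` R \<subseteq> verts H" using H f by (auto simp: comp_inj_on image_comp)
  have "card (verts G - R) = card (verts H - ?\<psi> ` R)"
    by (simp only: card_Diff_subset[OF finR R] card_Diff_subset[OF finite_imageI[OF finR] \<psi>(2)] H(2) card_image[OF \<psi>(1)])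
  then obtain h where h: "bij_betw h (verts G - R) (verts H - ?\<psi> ` R)"
    using finite_same_card_bij[OF finite_Diff[OF finG(1)] finite_Diff[OF finH]] by metis
  \<comment> \<open>Pairs not inside \<open>R\<close> receive whatever status this arbitrary
    completion gives; the weight missing from \<open>R\<close> will pay for them.\<close>
  define b where "b x = (if x \<in> R then ?\<psi> x else h x)" for x
  have "bij_betw b R (?\<psi> ` R)" using \<psi>(1) by (subst bij_betw_cong[of R b ?\<psi>]) (auto simp: b_def bij_betw_def)
  moreover have "bij_betw b (verts G - R) (verts H - ?\<psi> ` R)" using h by (subst bij_betw_cong[of _ b h]) (auto simp: b_def)
  ultimately have "bij_betw b (R \<union> (verts G - R)) (?\<psi> ` R \<union> (verts H - ?\<psi> ` R))"
    by (intro bij_betw_combine) auto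
  then have b: "bij_betw b (verts G) (verts H)" using R \<psi>(2) by (simp add: Un_absorb1 Un_Diff_cancel)
  define K where "K = \<lparr>verts = verts G, edges = {e. e \<subseteq> verts G \<and> card e = 2 \<and> b ` e \<in> edges H}\<rparr>"
  have simple_K: "simple_graph K" using finG by (auto simp: K_def simple_graph_def)
  have inv: "bij_betw (the_inv_into (verts G) b) (verts H) (verts K)"
    using bij_betw_the_inv_into[OF b] by (simp add: K_def)
  have bi: "b (the_inv_into (verts G) b x) = x" "the_inv_into (verts G) b x \<in> verts G" if "x \<in> verts H" for x
    using b that f_the_inv_into_f_bij_betw[OF b] bij_betwE[OF bij_betw_the_inv_into[OF b]] by auto
  have K_edge: "{x, y} \<in> edges K \<longleftrightarrow> {b x, b y} \<in> edges H" if "x \<in> verts G" "y \<in> verts G" for x y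
  proof (cases "x = y")
    case True
    then show ?thesis using simple_H simple_K by (auto simp: simple_graph_def)
  qed (use that in \<open>auto simp: K_def\<close>)
  have "isomorphic H K"
    unfolding isomorphic_def using inv bi K_edge by (intro exI[of _ "the_inv_into (verts G) b"]) auto
  then have "K \<in> P" using P(1) H(1) simple_K unfolding graph_property_def by blast
  then show ?thesis
    using R K_edge \<phi> by (intro bexI[of _ K]) (auto simp: K_def b_def subset_iff)
qed

text \<open>Each changed edge inside the support is charged to an ordered pair: one starting outside
  \<open>R\<close> if possible, otherwise the one increasing in \<open>rk\<close>. Pairs of the
  first kind weigh at most the weight missing from \<open>R\<close>, as their second vertex ranges
  over a distribution.\<close>

lemma graph_dist_le:
  fixes G H :: "'a ugraph"
  assumes G: "simple_graph G" and H: "simple_graph H" "verts H = verts G"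
    and D: "set_pmf D \<subseteq> verts G" and R: "R \<subseteq> set_pmf D"
    and rk: "inj_on (rk :: 'a \<Rightarrow> nat) R"
  shows "graph_dist D G H \<le> (\<Sum>u\<in>set_pmf D - R. pmf D u)
     + (\<Sum>u\<in>R. \<Sum>v\<in>R - {u}. pmf D u * pmf D v * of_bool (rk u < rk v \<and> ({u, v} \<in> edges H) \<noteq> ({u, v} \<in> edges G)))"
proof -
  let ?X = "set_pmf D" and ?w = "\<lambda>p. pmf D (fst p) * pmf D (snd p)"
  let ?S = "sym_diff (edges G) (edges H)"
  have finX: "finite ?X" using G D finite_subset unfolding simple_graph_def by blast
  have S2: "card e = 2 \<and> e \<subseteq> verts G" if "e \<in> ?S" for e using that G H by (auto simp: simple_graph_def)
  have "?S \<subseteq> Pow (verts G)" using S2 by blast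
  then have finS: "finite ?S" using G finite_subset unfolding simple_graph_def by (metis finite_Pow_iff)
  \<comment> \<open>Edges with an endpoint outside the support contribute 0.\<close>
  let ?S' = "{e \<in> ?S. e \<subseteq> ?X}"
  have "\<exists>u v. e = {u, v} \<and> u \<noteq> v \<and> (u \<in> R \<longrightarrow> v \<in> R \<and> rk u < rk v)" if "e \<in> ?S'" for e
  proof -
    have "e \<in> ?S" using that by blast
    then obtain u v where "e = {u, v}" "u \<noteq> v" using S2 card_2_iff by metis
    then have e: "e = {u, v}" "e = {v, u}" "u \<noteq> v" "v \<noteq> u" by auto
    show ?thesis
    proof (cases "u \<in> R \<longrightarrow> v \<in> R \<and> rk u < rk v")
      case True
      then show ?thesis using e(1,3) by (intro exI[of _ u] exI[of _ v] conjI)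
    next
      case False
      then have "v \<in> R \<longrightarrow> u \<in> R \<and> rk v < rk u" using inj_onD[OF rk, of u v] e(3) by (meson linorder_neqE_nat)
      then show ?thesis using e(2,4) by (intro exI[of _ v] exI[of _ u] conjI)
    qed
  qed
  then obtain a b where ab: "\<And>e. e \<in> ?S' \<Longrightarrow> e = {a e, b e} \<and> a e \<noteq> b e \<and> (a e \<in> R \<longrightarrow> b e \<in> R \<and> rk (a e) < rk (b e))" by metis
  let ?T1 = "(?X - R) \<times> ?X" and ?T2 = "Sigma R (\<lambda>u. {v \<in> R - {u}. rk u < rk v \<and> ({u, v} \<in> edges H) \<noteq> ({u, v} \<in> edges G)})"
  let ?p = "\<lambda>e. (a e, b e)"
  have finR: "finite R" using finX R finite_subset by blast
  have fin12: "finite ?T1" "finite ?T2" using finX finR by auto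
  have inj: "inj_on ?p ?S'" using ab by (intro inj_onI) (metis prod.inject)
  have sub: "?p ` ?S' \<subseteq> ?T1 \<union> ?T2"
  proof (rule image_subsetI)
    fix e assume e: "e \<in> ?S'"
    then have "{a e, b e} \<in> ?S" "{a e, b e} \<subseteq> ?X" "a e \<noteq> b e" "a e \<in> R \<longrightarrow> b e \<in> R \<and> rk (a e) < rk (b e)" using ab[OF e] by auto
    then show "?p e \<in> ?T1 \<union> ?T2" by auto
  qed
  have "graph_dist D G H = (\<Sum>e\<in>?S'. \<Prod>x\<in>e. pmf D x)"
    unfolding graph_dist_def
  proof (rule sum.mono_neutral_right[OF finS])
    show "\<forall>e\<in>?S - ?S'. (\<Prod>x\<in>e. pmf D x) = 0"
    proof
      fix e assume e: "e \<in> ?S - ?S'"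
      have "e \<in> ?S" using e by (rule DiffD1)
      then have "\<not> e \<subseteq> ?X" using DiffD2[OF e] by (metis (no_types, lifting) mem_Collect_eq)
      then obtain x where "x \<in> e" "x \<notin> ?X" by (meson subsetI)
      moreover have "finite e" using S2[OF \<open>e \<in> ?S\<close>] by (metis card.infinite zero_neq_numeral)
      ultimately show "(\<Prod>x\<in>e. pmf D x) = 0" by (intro prod_zero) (auto simp: set_pmf_iff)
    qed
  qed auto
  also have "\<dots> = (\<Sum>e\<in>?S'. ?w (?p e))"
  proof (rule sum.cong[OF refl])
    fix e assume "e \<in> ?S'"
    then have e: "e = {a e, b e}" and "a e \<noteq> b e" using ab by blast+
    then have "(\<Prod>x\<in>{a e, b e}. pmf D x) = ?w (?p e)" by (subst prod.insert) auto
    then show "(\<Prod>x\<in>e. pmf D x) = ?w (?p e)" by (simp only: e[symmetric])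
  qed
  also have "\<dots> = (\<Sum>p\<in>?p ` ?S'. ?w p)" using inj by (simp add: sum.reindex)
  also have "\<dots> \<le> (\<Sum>p\<in>?T1 \<union> ?T2. ?w p)" using sub fin12 by (intro sum_mono2) auto
  also have "\<dots> \<le> (\<Sum>p\<in>?T1. ?w p) + (\<Sum>p\<in>?T2. ?w p)"
    using fin12 by (simp add: sum_Un sum_nonneg)
  also have "(\<Sum>p\<in>?T1. ?w p) = (\<Sum>u\<in>?X - R. pmf D u)"
    using finX by (simp add: sum.cartesian_product' sum_pmf_eq_1 flip: sum_distrib_left)
  also have "(\<Sum>p\<in>?T2. ?w p) = (\<Sum>u\<in>R. \<Sum>v | v \<in> R - {u} \<and> rk u < rk v \<and> ({u, v} \<in> edges H) \<noteq> ({u, v} \<in> edges G). pmf D u * pmf D v)"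
    using finR by (subst sum.Sigma) (auto simp: case_prod_unfold)
  also have "\<dots> = (\<Sum>u\<in>R. \<Sum>v\<in>R - {u}. pmf D u * pmf D v * of_bool (rk u < rk v \<and> ({u, v} \<in> edges H) \<noteq> ({u, v} \<in> edges G)))"
    using finR by (intro sum.cong refl sum.mono_neutral_cong_left) auto
  finally show ?thesis by simp
qed

section \<open>The tester\<close>

text \<open>\<open>d\<close> counts the distinct samples: a new vertex receives the handle
  \<open>d\<close>, an old one a smaller handle.\<close>

primrec sampling :: "nat \<Rightarrow> nat \<Rightarrow> (nat \<Rightarrow> algorithm) \<Rightarrow> algorithm" where
  "sampling 0 d A = A d"
| "sampling (Suc m) d A = Sample (\<lambda>h. sampling m (max d (Suc h)) A)"

primrec querying :: "(nat \<times> nat) list \<Rightarrow> (nat \<times> nat) set \<Rightarrow> ((nat \<times> nat) set \<Rightarrow> bool) \<Rightarrow> algorithm" where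
  "querying [] Q v = Verdict (v Q)"
| "querying (p # ps) Q v = Query (fst p) (snd p) (\<lambda>b. querying ps (if b then insert p Q else Q) v)"

definition consistent :: "'a ugraph set \<Rightarrow> nat \<Rightarrow> nat \<Rightarrow> (nat \<times> nat) set \<Rightarrow> bool" where
  "consistent P N d Q \<longleftrightarrow> (\<exists>H\<in>P. card (verts H) = N \<and> (\<exists>\<phi>. inj_on \<phi> {..<d} \<and> \<phi> ` {..<d} \<subseteq> verts H \<and>
     (\<forall>i<d. \<forall>j<d. i \<noteq> j \<longrightarrow> ({\<phi> i, \<phi> j} \<in> edges H \<longleftrightarrow> (i, j) \<in> Q))))"

text \<open>All \<open>m * m\<close> pairs of handles are queried, also unassigned ones, which makes
  the number of accesses the same in every run; \<open>consistent\<close> only looks at handles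
  below \<open>d\<close>.\<close>

definition tester :: "'a ugraph set \<Rightarrow> nat \<Rightarrow> nat \<Rightarrow> algorithm" where
  "tester P m N = sampling m 0 (\<lambda>d. querying (List.product [0..<m] [0..<m]) {} (consistent P N d))"

lemma run_querying:
  "run_from G D (querying ps Q v) vs = return_pmf (v (Q \<union> {p \<in> set ps. edge_query G vs (fst p) (snd p)}), length ps)"
proof (induction ps arbitrary: Q)
  case (Cons p ps)
  have "(if edge_query G vs (fst p) (snd p) then insert p Q else Q) \<union> {q \<in> set ps. edge_query G vs (fst q) (snd q)}
    = Q \<union> {q \<in> set (p # ps). edge_query G vs (fst q) (snd q)}" by auto
  then show ?case by (simp add: Cons.IH)
qed simp

lemma length_remember: "length (remember vs v) = max (length vs) (Suc (handle vs v))"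
proof (cases "v \<in> set vs")
  case True
  then have "handle vs v < length vs"
    unfolding handle_def by (induction vs) auto
  then show ?thesis using True by (simp add: remember_def)
next
  case False
  then have "handle vs v = length vs" unfolding handle_def by (induction vs) auto
  then show ?thesis using False by (simp add: remember_def)
qed

text \<open>All samples can be drawn in advance, because \<open>sampling\<close> makes no decision
  before the last one.\<close>

lemma run_sampling:
  "run_from G D (sampling m (length vs) A) vs = bind_pmf (replicate_pmf m D)
     (\<lambda>xs. map_pmf (apsnd ((+) m)) (run_from G D (A (length (foldl remember vs xs))) (foldl remember vs xs)))"
proof (induction m arbitrary: vs)
  case 0
  have "apsnd (\<lambda>a. a) = (id :: bool \<times> nat \<Rightarrow> _)" by (auto simp: fun_eq_iff)
  then show ?case by (simp add: bind_return_pmf)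
next
  case (Suc m)
  have "apsnd Suc \<circ> apsnd ((+) m) = (apsnd (\<lambda>a. Suc (m + a)) :: bool \<times> nat \<Rightarrow> _)" by (auto simp: fun_eq_iff)
  then show ?case
    by (simp add: Suc.IH bind_assoc_pmf bind_return_pmf map_bind_pmf map_pmf_comp o_def flip: length_remember)
qed

lemma remember_all: "distinct vs \<Longrightarrow> distinct (foldl remember vs xs) \<and> set (foldl remember vs xs) = set vs \<union> set xs
    \<and> length (foldl remember vs xs) \<le> length vs + length xs"
proof (induction xs arbitrary: vs)
  case (Cons x xs)
  have "distinct (remember vs x)" "set (remember vs x) = insert x (set vs)" "length (remember vs x) \<le> Suc (length vs)"
    using Cons.prems by (auto simp: remember_def)
  then show ?case using Cons.IH[of "remember vs x"] by auto
qed simp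

text \<open>\<open>vs\<close> is a bijection from the handles to the sampled vertices, along which
  embeddings are carried over in both directions.\<close>

lemma consistent_iff_extendable:
  assumes vs: "distinct vs" "length vs \<le> m"
  shows "consistent P N (length vs) {p \<in> set (List.product [0..<m] [0..<m]). edge_query G vs (fst p) (snd p)}
    \<longleftrightarrow> extendable P N G (set vs)" (is "consistent P N ?d ?Q \<longleftrightarrow> _")
proof
  have Q: "(i, j) \<in> ?Q \<longleftrightarrow> {vs ! i, vs ! j} \<in> edges G" if "i < ?d" "j < ?d" for i j
    using that vs by (auto simp: edge_query_def)
  define ix where "ix = the_inv_into {..<?d} ((!) vs)"
  have bij: "bij_betw ((!) vs) {..<?d} (set vs)" using vs(1) by (intro bij_betw_nth) auto
  have ix: "ix x < ?d" "vs ! ix x = x" if "x \<in> set vs" for x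
    using bij_betwE[OF bij_betw_the_inv_into[OF bij]] f_the_inv_into_f_bij_betw[OF bij] that by (auto simp: ix_def)
  {
    assume "consistent P N ?d ?Q"
    then obtain H \<phi> where H: "H \<in> P" "card (verts H) = N" "inj_on \<phi> {..<?d}" "\<phi> ` {..<?d} \<subseteq> verts H"
      and \<phi>: "\<forall>i<?d. \<forall>j<?d. i \<noteq> j \<longrightarrow> ({\<phi> i, \<phi> j} \<in> edges H \<longleftrightarrow> (i, j) \<in> ?Q)"
      unfolding consistent_def by (elim bexE conjE exE)
    have "inj_on (\<phi> \<circ> ix) (set vs)" using H(3) ix by (intro inj_onI) (metis comp_apply inj_onD lessThan_iff)
    moreover have "{(\<phi> \<circ> ix) x, (\<phi> \<circ> ix) y} \<in> edges H \<longleftrightarrow> {x, y} \<in> edges G" if "x \<in> set vs" "y \<in> set vs" "x \<noteq> y" for x y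
    proof -
      have "ix x \<noteq> ix y" using ix that by metis
      then have "{\<phi> (ix x), \<phi> (ix y)} \<in> edges H \<longleftrightarrow> (ix x, ix y) \<in> ?Q"
        using \<phi> ix that by blast
      also have "\<dots> \<longleftrightarrow> {x, y} \<in> edges G" using Q[OF ix(1)[OF that(1)] ix(1)[OF that(2)]] ix(2) that by simp
      finally show ?thesis by simp
    qed
    ultimately show "extendable P N G (set vs)"
      using H ix by (intro extendableI[of H _ _ "\<phi> \<circ> ix"]) auto
  }
  {
    assume "extendable P N G (set vs)"
    then obtain H \<phi> where H: "H \<in> P" "card (verts H) = N" "inj_on \<phi> (set vs)" "\<phi> ` set vs \<subseteq> verts H"
      and \<phi>: "\<forall>x\<in>set vs. \<forall>y\<in>set vs. x \<noteq> y \<longrightarrow> ({\<phi> x, \<phi> y} \<in> edges H \<longleftrightarrow> {x, y} \<in> edges G)"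
      unfolding extendable_def by (elim bexE conjE exE)
    have "inj_on (\<phi> \<circ> (!) vs) {..<?d}"
      using bij H(3) by (intro comp_inj_on) (auto simp: bij_betw_def)
    moreover have "{(\<phi> \<circ> (!) vs) i, (\<phi> \<circ> (!) vs) j} \<in> edges H \<longleftrightarrow> (i, j) \<in> ?Q" if "i < ?d" "j < ?d" "i \<noteq> j" for i j
    proof -
      have "vs ! i \<noteq> vs ! j" using that vs(1) by (simp add: nth_eq_iff_index_eq)
      then have "{\<phi> (vs ! i), \<phi> (vs ! j)} \<in> edges H \<longleftrightarrow> {vs ! i, vs ! j} \<in> edges G"
        using \<phi> that by (intro \<phi>[rule_format]) auto
      also have "\<dots> \<longleftrightarrow> (i, j) \<in> ?Q" using Q[OF that(1,2)] by (rule sym)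
      finally show ?thesis by (simp only: comp_apply)
    qed
    ultimately show "consistent P N ?d ?Q"
      unfolding consistent_def using H by (intro bexI[of _ H] conjI exI[of _ "\<phi> \<circ> (!) vs"]) auto
  }
qed

lemma run_tester:
  "run G D (tester P m N) = map_pmf (\<lambda>xs. (extendable P N G (set xs), m + m * m)) (replicate_pmf m D)"
proof -
  have "run G D (tester P m N) = bind_pmf (replicate_pmf m D) (\<lambda>xs. return_pmf (consistent P N (length (foldl remember [] xs))
    {p \<in> set (List.product [0..<m] [0..<m]). edge_query G (foldl remember [] xs) (fst p) (snd p)}, m + m * m))"
    unfolding run_def tester_def using run_sampling[of G D m "[]"] by (simp add: run_querying)
  also have "\<dots> = bind_pmf (replicate_pmf m D) (\<lambda>xs. return_pmf (extendable P N G (set xs), m + m * m))"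
  proof (rule bind_pmf_cong[OF refl])
    fix xs assume "xs \<in> set_pmf (replicate_pmf m D)"
    then have "length xs = m" by (simp add: set_replicate_pmf)
    then show "return_pmf (consistent P N (length (foldl remember [] xs))
      {p \<in> set (List.product [0..<m] [0..<m]). edge_query G (foldl remember [] xs) (fst p) (snd p)}, m + m * m)
      = return_pmf (extendable P N G (set xs), m + m * m)"
      using remember_all[of "[]" xs] consistent_iff_extendable[of "foldl remember [] xs" m P N G] by simp
  qed
  finally show ?thesis by (simp add: map_pmf_def)
qed

section \<open>Acceptance probability and amplification\<close>

definition accept_prob :: "'a ugraph set \<Rightarrow> nat \<Rightarrow> 'a ugraph \<Rightarrow> 'a pmf \<Rightarrow> real" where
  "accept_prob P m G D = ex (replicate_pmf m D) (\<lambda>xs. of_bool (extendable P (card (verts G)) G (set xs)))"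

lemma fin_replicate_pmf: "fin_pmf D \<Longrightarrow> fin_pmf (replicate_pmf m D)"
  by (induction m) auto

text \<open>Extendability passes to subsets, so both blocks of samples must be extendable, and the
  blocks are independent.\<close>

lemma accept_prob_add:
  assumes "fin_pmf D"
  shows "accept_prob P (m + n) G D \<le> accept_prob P m G D * accept_prob P n G D"
proof -
  let ?e = "\<lambda>xs. of_bool (extendable P (card (verts G)) G (set xs)) :: real"
  note fin = fin_replicate_pmf[OF assms]
  have "accept_prob P (m + n) G D = ex (replicate_pmf m D) (\<lambda>xs. ex (replicate_pmf n D) (\<lambda>ys. ?e (xs @ ys)))"
    unfolding accept_prob_def replicate_pmf_distrib using fin by (simp add: ex_bind)
  also have "\<dots> \<le> ex (replicate_pmf m D) (\<lambda>xs. ex (replicate_pmf n D) (\<lambda>ys. ?e xs * ?e ys))"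
    by (intro ex_mono fin) (auto intro: extendable_subset)
  also have "\<dots> = accept_prob P m G D * accept_prob P n G D"
    unfolding accept_prob_def by simp
  finally show ?thesis .
qed

lemma accept_prob_bounds: "0 \<le> accept_prob P m G D" "accept_prob P m G D \<le> 1"
  unfolding accept_prob_def prob_eq_ex[symmetric] by auto

lemma accept_prob_mult: "fin_pmf D \<Longrightarrow> accept_prob P (r * m) G D \<le> accept_prob P m G D ^ r"
proof (induction r)
  case (Suc r)
  have "accept_prob P (Suc r * m) G D \<le> accept_prob P m G D * accept_prob P (r * m) G D"
    using accept_prob_add[OF Suc.prems] by simp
  also have "\<dots> \<le> accept_prob P m G D * accept_prob P m G D ^ r"
    using Suc accept_prob_bounds by (intro mult_left_mono) auto
  finally show ?case by simp
qed (simp add: accept_prob_bounds)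

text \<open>By \<open>accept_prob_mult\<close>, enough blocks of samples push the acceptance
  probability of far graphs to \<open>1 / 3\<close>. Members of \<open>P\<close> extend their own
  induced subgraphs, so the error is one-sided.\<close>

lemma one_sided_tester:
  fixes P :: "'a ugraph set"
  assumes detect: "\<And>\<epsilon>. 0 < \<epsilon> \<Longrightarrow> \<epsilon> < 1 \<Longrightarrow> \<exists>m \<gamma>. \<gamma> < 1 \<and> (\<forall>G D. weighted_graph G D \<longrightarrow> far_from \<epsilon> G D P \<longrightarrow> accept_prob P m G D \<le> \<gamma>)"
  shows "\<exists>(q :: real \<Rightarrow> nat) (T :: real \<Rightarrow> nat \<Rightarrow> algorithm). one_sided_VDF_tester P q T"
proof -
  have "\<exists>m. \<forall>G D. weighted_graph G D \<longrightarrow> far_from \<epsilon> G D P \<longrightarrow> accept_prob P m G D \<le> 1 / 3" if \<epsilon>: "\<epsilon> \<in> {0<..<1}" for \<epsilon>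
  proof -
    obtain m \<gamma> where \<gamma>: "\<gamma> < 1" and m: "\<And>G D. weighted_graph G D \<Longrightarrow> far_from \<epsilon> G D P \<Longrightarrow> accept_prob P m G D \<le> \<gamma>"
      using detect[of \<epsilon>] \<epsilon> by auto
    \<comment> \<open>The maximum with 0 guards against negative \<open>\<gamma>\<close>, whose
      powers need not be small in absolute value.\<close>
    obtain r where r: "(max 0 \<gamma>) ^ r < 1 / 3" using real_arch_pow_inv[of "1 / 3" "max 0 \<gamma>"] \<gamma> by auto
    have "accept_prob P (r * m) G D \<le> 1 / 3" if GD: "weighted_graph G D" "far_from \<epsilon> G D P" for G D
    proof -
      have "fin_pmf D" using GD(1) unfolding weighted_graph_def simple_graph_def using finite_subset by blast
      then have "accept_prob P (r * m) G D \<le> accept_prob P m G D ^ r" by (rule accept_prob_mult)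
      also have "\<dots> \<le> (max 0 \<gamma>) ^ r" using m[OF GD] accept_prob_bounds by (intro power_mono) auto
      finally show ?thesis using r by simp
    qed
    then show ?thesis by blast
  qed
  then obtain m where m: "\<And>\<epsilon> G D. \<epsilon> \<in> {0<..<1} \<Longrightarrow> weighted_graph G D \<Longrightarrow> far_from \<epsilon> G D P \<Longrightarrow> accept_prob P (m \<epsilon>) G D \<le> 1 / 3"
    by metis
  have "one_sided_VDF_tester P (\<lambda>\<epsilon>. m \<epsilon> + m \<epsilon> * m \<epsilon>) (\<lambda>\<epsilon>. tester P (m \<epsilon>))"
    unfolding one_sided_VDF_tester_def Let_def
  proof (intro ballI allI impI conjI)
    fix \<epsilon> :: real and G :: "'a ugraph" and D assume \<epsilon>: "\<epsilon> \<in> {0<..<1}" and GD: "weighted_graph G D"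
    show "case x of (b, c) \<Rightarrow> c \<le> m \<epsilon> + m \<epsilon> * m \<epsilon>" if "x \<in> set_pmf (run G D (tester P (m \<epsilon>) (card (verts G))))" for x
      using that by (auto simp: run_tester)
    have acc: "prob_accept G D (tester P (m \<epsilon>) (card (verts G))) = accept_prob P (m \<epsilon>) G D"
      by (simp add: prob_accept_def accept_prob_def run_tester prob_eq_ex)
    show "prob_accept G D (tester P (m \<epsilon>) (card (verts G))) = 1" if "G \<in> P"
    proof -
      have "accept_prob P (m \<epsilon>) G D = ex (replicate_pmf (m \<epsilon>) D) (\<lambda>_. 1)"
        unfolding accept_prob_def using that GD
        by (intro ex_cong) (auto simp: set_replicate_pmf weighted_graph_def lists_eq_set intro!: extendable_self)
      then show ?thesis unfolding acc by simp
    qed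
    show "prob_reject G D (tester P (m \<epsilon>) (card (verts G))) \<ge> 2 / 3" if "far_from \<epsilon> G D P"
    proof -
      have "prob_reject G D (tester P (m \<epsilon>) (card (verts G))) = 1 - prob_accept G D (tester P (m \<epsilon>) (card (verts G)))"
        unfolding prob_reject_def prob_accept_def
        by (subst measure_pmf.prob_compl[symmetric]) (auto intro!: arg_cong[where f = "measure_pmf.prob _"])
      then show ?thesis using m[OF \<epsilon> GD that] unfolding acc by simp
    qed
  qed
  then show ?thesis by blast
qed

section \<open>A convergent sequence of counterexamples\<close>

text \<open>The rank of \<open>x\<close> counts the vertices before it in the order of decreasing
  weight, with ties broken by \<open>e\<close>. The vertices up to \<open>x\<close> weigh at least
  \<open>pmf D x\<close> each and at most 1 together.\<close>

lemma rank_by_weight: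
  assumes V: "finite V" and D: "set_pmf D \<subseteq> V"
  shows "\<exists>rk :: 'a \<Rightarrow> nat. inj_on rk V \<and> (\<forall>x\<in>set_pmf D. pmf D x \<le> 1 / (real (rk x) + 1))"
proof -
  obtain e :: "'a \<Rightarrow> nat" where e: "inj_on e V" using finite_imp_inj_to_nat_seg[OF V] by blast
  define B where "B x = {y \<in> V. pmf D x < pmf D y \<or> (pmf D y = pmf D x \<and> e y < e x)}" for x
  have finB: "finite (B x)" for x using V by (simp add: B_def)
  have less: "card (B y) < card (B x)" if "y \<in> B x" for x y
  proof (rule psubset_card_mono[OF finB])
    show "B y \<subset> B x" using that by (auto simp: B_def)
  qed
  have inj: "inj_on (\<lambda>x. card (B x)) V"
  proof (rule inj_onI, rule ccontr)
    fix x y assume xy: "x \<in> V" "y \<in> V" "card (B x) = card (B y)" "x \<noteq> y"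
    then have "e x \<noteq> e y" using e by (auto simp: inj_on_def)
    then have "x \<in> B y \<or> y \<in> B x" using xy by (auto simp: B_def)
    then show False using less xy(3) by fastforce
  qed
  have "pmf D x \<le> 1 / (real (card (B x)) + 1)" if "x \<in> set_pmf D" for x
  proof -
    have "x \<notin> B x" by (simp add: B_def)
    have "(real (card (B x)) + 1) * pmf D x = (\<Sum>y\<in>insert x (B x). pmf D x)"
      using \<open>x \<notin> B x\<close> finB by (simp add: algebra_simps)
    also have "\<dots> \<le> (\<Sum>y\<in>insert x (B x). pmf D y)" by (intro sum_mono) (auto simp: B_def)
    also have "\<dots> = measure_pmf.prob D (insert x (B x))" using finB by (simp add: measure_measure_pmf_finite)
    also have "\<dots> \<le> 1" by simp
    finally show ?thesis by (simp add: field_simps)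
  qed
  then show ?thesis using inj by blast
qed

text \<open>Diagonal argument: the successive subsequences make one coordinate after the other
  converge, by compactness of the unit interval.\<close>

lemma convergent_subseq_countable:
  fixes x :: "nat \<Rightarrow> 'b :: countable \<Rightarrow> real"
  assumes x: "\<And>n b. 0 \<le> x n b \<and> x n b \<le> 1"
  shows "\<exists>s :: nat \<Rightarrow> nat. strict_mono s \<and> (\<forall>b. convergent (\<lambda>n. x (s n) b))"
proof -
  define Q where "Q n s \<longleftrightarrow> convergent (\<lambda>i. x (s i) (from_nat n))" for n and s :: "nat \<Rightarrow> nat"
  interpret subseqs Q
  proof
    fix n and s :: "nat \<Rightarrow> nat"
    have "seq_compact {0..1 :: real}" using compact_Icc compact_imp_seq_compact by blast
    moreover have "\<forall>i. x (s i) (from_nat n) \<in> {0..1}" using x by simp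
    ultimately obtain l r where "strict_mono r" "((\<lambda>i. x (s i) (from_nat n)) \<circ> r) \<longlonglongrightarrow> l"
      by (rule seq_compactE)
    then show "\<exists>r. strict_mono r \<and> Q n (s \<circ> r)"
      unfolding Q_def by (intro exI[of _ r]) (auto simp: o_def convergent_def)
  qed
  have "convergent (\<lambda>n. x (diagseq n) b)" for b
  proof -
    have "Q (to_nat b) (diagseq \<circ> (+) (Suc (to_nat b)))"
    proof (rule diagseq_holds)
      fix r s n assume "strict_mono (r :: nat \<Rightarrow> nat)" "Q n s"
      then show "Q n (s \<circ> r)" unfolding Q_def using convergent_subseq_convergent by (force simp: o_def)
    qed
    then have "convergent (\<lambda>n. x (diagseq (n + Suc (to_nat b))) b)"
      by (simp add: Q_def o_def add.commute)
    then show ?thesis by (subst (asm) convergent_ignore_initial_segment)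
  qed
  then show ?thesis using subseq_diagseq by blast
qed

lemma mono_bounded_tail:
  fixes X :: "nat \<Rightarrow> real"
  assumes "incseq X" "\<And>k. X k \<le> 1" "0 < \<theta>"
  shows "\<exists>k0. \<forall>j\<ge>k0. \<forall>k\<ge>k0. X j - X k \<le> \<theta>"
proof -
  obtain L where "X \<longlonglongrightarrow> L" using incseq_convergent[OF assms(1)] assms(2) by blast
  then have "Cauchy X" by (rule LIMSEQ_imp_Cauchy)
  then obtain k0 where "\<forall>j\<ge>k0. \<forall>k\<ge>k0. dist (X j) (X k) < \<theta>" using assms(3) unfolding Cauchy_def by blast
  then show ?thesis by (intro exI[of _ k0]) (force simp: dist_real_def)
qed

lemma convergent_sum_close:
  fixes x :: "nat \<Rightarrow> 'b \<Rightarrow> real"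
  assumes A: "finite A" and c: "\<And>a. a \<in> A \<Longrightarrow> convergent (\<lambda>i. x i a)" and \<theta>: "0 < \<theta>"
  shows "\<exists>i0. \<forall>i\<ge>i0. \<forall>i'\<ge>i0. (\<Sum>a\<in>A. \<bar>x i a - x i' a\<bar>) \<le> \<theta>"
proof -
  obtain l where l: "\<And>a. a \<in> A \<Longrightarrow> (\<lambda>i. x i a) \<longlonglongrightarrow> l a" using c unfolding convergent_def by metis
  have "(\<lambda>i. \<Sum>a\<in>A. \<bar>x i a - l a\<bar>) \<longlonglongrightarrow> (\<Sum>a\<in>A. \<bar>l a - l a\<bar>)"
    by (intro tendsto_sum tendsto_rabs tendsto_diff l tendsto_const)
  then have "\<forall>\<^sub>F i in sequentially. (\<Sum>a\<in>A. \<bar>x i a - l a\<bar>) < \<theta> / 2"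
    using \<theta> by (intro order_tendstoD(2)) auto
  then obtain i0 where i0: "\<And>i. i \<ge> i0 \<Longrightarrow> (\<Sum>a\<in>A. \<bar>x i a - l a\<bar>) < \<theta> / 2"
    unfolding eventually_sequentially by blast
  have "(\<Sum>a\<in>A. \<bar>x i a - x i' a\<bar>) \<le> \<theta>" if "i \<ge> i0" "i' \<ge> i0" for i i'
  proof -
    have "(\<Sum>a\<in>A. \<bar>x i a - x i' a\<bar>) \<le> (\<Sum>a\<in>A. \<bar>x i a - l a\<bar> + \<bar>x i' a - l a\<bar>)" by (intro sum_mono) linarith
    also have "\<dots> \<le> \<theta>" using i0[OF that(1)] i0[OF that(2)] by (simp add: sum.distrib)
    finally show ?thesis .
  qed
  then show ?thesis by blast
qed

text \<open>Links samples indexed by \<open>A\<close>, as in the rounding, with the lists drawn by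
  the tester; only the set of sampled vertices matters.\<close>

lemma ex_Pi_replicate:
  assumes "finite A" "fin_pmf D"
  shows "ex (Pi_pmf A d (\<lambda>_. D)) (\<lambda>f. h (f ` A)) = ex (replicate_pmf (card A) D) (\<lambda>xs. h (set xs))"
  using assms(1)
proof (induction A arbitrary: h rule: finite_induct)
  case (insert a A)
  have img: "(f(a := x)) ` insert a A = insert x (f ` A)" for f :: "'a \<Rightarrow> 'b" and x using insert(2) by auto
  have "ex (Pi_pmf (insert a A) d (\<lambda>_. D)) (\<lambda>f. h (f ` insert a A)) = ex D (\<lambda>x. ex (Pi_pmf A d (\<lambda>_. D)) (\<lambda>f. h (insert x (f ` A))))"
    using insert assms(2) by (subst ex_Pi_insert) (auto simp only: img)
  also have "\<dots> = ex D (\<lambda>x. ex (replicate_pmf (card A) D) (\<lambda>xs. h (insert x (set xs))))"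
    using insert.IH[of "\<lambda>S. h (insert _ S)"] by simp
  also have "\<dots> = ex (replicate_pmf (card (insert a A)) D) (\<lambda>xs. h (set xs))"
    using insert assms(2) by (simp add: ex_bind fin_replicate_pmf)
  finally show ?case .
qed simp

text \<open>By \<open>accept_prob_add\<close> acceptance is antitone in the sample size, which
  covers every \<open>A\<close> with at most \<open>m\<close> elements.\<close>

lemma reject_le:
  assumes A: "finite A" "card A \<le> m" and fin: "fin_pmf D"
  shows "ex (Pi_pmf A d (\<lambda>_. D)) (\<lambda>f. of_bool (\<not> extendable P (card (verts G)) G (f ` A))) \<le> 1 - accept_prob P m G D"
proof -
  have "ex (Pi_pmf A d (\<lambda>_. D)) (\<lambda>f. of_bool (\<not> extendable P (card (verts G)) G (f ` A))) = 1 - accept_prob P (card A) G D"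
    unfolding accept_prob_def ex_Pi_replicate[OF A(1) fin, where h = "\<lambda>S. of_bool (\<not> extendable P (card (verts G)) G S)"]
    using fin_replicate_pmf[OF fin] by (simp add: of_bool_not_iff ex_diff)
  moreover have "accept_prob P m G D \<le> accept_prob P (card A) G D"
  proof -
    have "accept_prob P (card A + (m - card A)) G D \<le> accept_prob P (card A) G D * accept_prob P (m - card A) G D"
      by (rule accept_prob_add[OF fin])
    also have "\<dots> \<le> accept_prob P (card A) G D" using accept_prob_bounds by (intro mult_left_le) auto
    finally show ?thesis using A(2) by simp
  qed
  ultimately show ?thesis by simp
qed

text \<open>Energies, cell masses, edge masses between cells and weights of ranks share one
  countable index type, so that a single subsequence makes all of them converge.\<close>

type_synonym stat = "nat + code + (bool \<times> code \<times> code) + nat"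

definition stat :: "'a pmf \<Rightarrow> ('a \<Rightarrow> 'a \<Rightarrow> bool) \<Rightarrow> ('a \<Rightarrow> nat) \<Rightarrow> stat \<Rightarrow> real" where
  "stat D E rk s = (case s of
      Inl k \<Rightarrow> energy D E (code D E rk k)
    | Inr (Inl w) \<Rightarrow> mass D (code D E rk (length w)) w
    | Inr (Inr (Inl (b, w, w'))) \<Rightarrow> emass D (\<lambda>x y. E x y = b) (code D E rk (length w)) w w'
    | Inr (Inr (Inr r)) \<Rightarrow> measure_pmf.prob D {x. rk x = r})"

lemma stat_bounds: "fin_pmf D \<Longrightarrow> 0 \<le> stat D E rk s \<and> stat D E rk s \<le> 1"
  unfolding stat_def emass_def
  by (auto simp: energy_nonneg energy_le_1 mass_def split: sum.split intro!: conjunct1[OF ex_bounded] conjunct2[OF ex_bounded] ex_bounded)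

definition adj :: "'a ugraph \<Rightarrow> 'a \<Rightarrow> 'a \<Rightarrow> bool" where
  "adj G x y \<longleftrightarrow> {x, y} \<in> edges G"

section \<open>Contradiction from a convergent sequence\<close>

locale convergent_counterexample =
  fixes P :: "'a ugraph set" and \<epsilon> :: real and G :: "nat \<Rightarrow> 'a ugraph" and D :: "nat \<Rightarrow> 'a pmf" and rk :: "nat \<Rightarrow> 'a \<Rightarrow> nat"
  assumes P: "graph_property P" "hereditary P" and \<epsilon>: "0 < \<epsilon>" "\<epsilon> < 1"
    and GD: "\<And>i. weighted_graph (G i) (D i)" and far: "\<And>i. far_from \<epsilon> (G i) (D i) P"
    and rk: "\<And>i. inj_on (rk i) (verts (G i))" "\<And>i x. x \<in> set_pmf (D i) \<Longrightarrow> pmf (D i) x \<le> 1 / (real (rk i x) + 1)"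
    and accept: "\<And>i A. finite A \<Longrightarrow> card A \<le> i \<Longrightarrow>
      ex (Pi_pmf A undefined (\<lambda>_ :: 'a. D i)) (\<lambda>f. of_bool (\<not> extendable P (card (verts (G i))) (G i) (f ` A))) \<le> 1 / (real i + 1)"
    and conv: "\<And>s. convergent (\<lambda>i. stat (D i) (adj (G i)) (rk i) s)"
begin

lemma simple: "simple_graph (G i)" and supp: "set_pmf (D i) \<subseteq> verts (G i)" and fin: "fin_pmf (D i)"
proof -
  show "simple_graph (G i)" "set_pmf (D i) \<subseteq> verts (G i)" using GD[of i] by (auto simp: weighted_graph_def)
  then show "fin_pmf (D i)" using finite_subset unfolding simple_graph_def by blast
qed

abbreviation cd where "cd i r \<equiv> code (D i) (adj (G i)) (rk i) r"

definition en where "en i k = energy (D i) (adj (G i)) (cd i k)"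
definition en_lim where "en_lim k = lim (\<lambda>i. en i k)"
definition atom where "atom i r = measure_pmf.prob (D i) {x. rk i x = r}"
definition atom_lim where "atom_lim r = lim (\<lambda>i. atom i r)"

lemma en_tendsto: "(\<lambda>i. en i k) \<longlonglongrightarrow> en_lim k"
  using conv[of "Inl k"] by (simp add: stat_def en_def en_lim_def convergent_LIMSEQ_iff)

lemma atom_tendsto: "(\<lambda>i. atom i r) \<longlonglongrightarrow> atom_lim r"
  using conv[of "Inr (Inr (Inr r))"] by (simp add: stat_def atom_def atom_lim_def convergent_LIMSEQ_iff)

lemma en_lim_mono: "incseq en_lim"
proof (rule incseq_SucI)
  fix k
  have "en i k \<le> en i (Suc k)" for i
    unfolding en_def by (intro energy_mono fin finer_code) simp
  then show "en_lim k \<le> en_lim (Suc k)"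
    by (intro LIMSEQ_le[OF en_tendsto en_tendsto]) auto
qed

lemma en_lim_le: "en_lim k \<le> 1"
  by (rule LIMSEQ_le_const2[OF en_tendsto]) (auto simp: en_def intro!: energy_le_1 fin)

lemma sum_atom: "finite A \<Longrightarrow> (\<Sum>r\<in>A. atom i r) = measure_pmf.prob (D i) {x. rk i x \<in> A}"
proof -
  assume A: "finite A"
  have "measure_pmf.prob (D i) (\<Union>r\<in>A. {x. rk i x = r}) = (\<Sum>r\<in>A. atom i r)"
    unfolding atom_def using A by (intro measure_pmf.finite_measure_finite_Union) (auto simp: disjoint_family_on_def)
  moreover have "(\<Union>r\<in>A. {x. rk i x = r}) = {x. rk i x \<in> A}" by auto
  ultimately show ?thesis by simp
qed

lemma atom_lim_sum: "incseq (\<lambda>k. \<Sum>r<k. atom_lim r)" "(\<Sum>r<k. atom_lim r) \<le> 1"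
proof -
  have "0 \<le> atom_lim r" for r
    by (rule LIMSEQ_le_const[OF atom_tendsto]) (auto simp: atom_def)
  then show "incseq (\<lambda>k. \<Sum>r<k. atom_lim r)" by (intro incseq_SucI) simp
  have "(\<lambda>i. \<Sum>r<k. atom i r) \<longlonglongrightarrow> (\<Sum>r<k. atom_lim r)" by (intro tendsto_sum atom_tendsto)
  then show "(\<Sum>r<k. atom_lim r) \<le> 1"
    by (rule LIMSEQ_le_const2) (auto simp: sum_atom)
qed

lemma mass_close:
  assumes "0 < \<theta>"
  shows "\<exists>i0. \<forall>i\<ge>i0. \<forall>i'\<ge>i0. (\<Sum>w | length w = k. \<bar>mass (D i) (cd i k) w - mass (D i') (cd i' k) w\<bar>) \<le> \<theta>"
proof (rule convergent_sum_close[OF finite_words _ assms])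
  fix w :: code assume "w \<in> {w. length w = k}"
  then show "convergent (\<lambda>i. mass (D i) (cd i k) w)" using conv[of "Inr (Inl w)"] by (auto simp: stat_def)
qed

lemma emass_close:
  assumes "0 < \<theta>"
  shows "\<exists>i0. \<forall>i\<ge>i0. \<forall>i'\<ge>i0. (\<Sum>w | length w = k. \<Sum>w' | length w' = k.
    \<bar>emass (D i) (\<lambda>x y. adj (G i) x y = b) (cd i k) w w' - emass (D i') (\<lambda>x y. adj (G i') x y = b) (cd i' k) w w'\<bar>) \<le> \<theta>"
proof -
  let ?W = "{w :: code. length w = k}"
  have "\<exists>i0. \<forall>i\<ge>i0. \<forall>i'\<ge>i0. (\<Sum>p\<in>?W \<times> ?W.
    \<bar>emass (D i) (\<lambda>x y. adj (G i) x y = b) (cd i k) (fst p) (snd p)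
     - emass (D i') (\<lambda>x y. adj (G i') x y = b) (cd i' k) (fst p) (snd p)\<bar>) \<le> \<theta>"
  proof (rule convergent_sum_close[OF _ _ assms])
    fix p assume "p \<in> ?W \<times> ?W"
    then show "convergent (\<lambda>i. emass (D i) (\<lambda>x y. adj (G i) x y = b) (cd i k) (fst p) (snd p))"
      using conv[of "Inr (Inr (Inl (b, fst p, snd p)))"] by (auto simp: stat_def)
  qed (simp add: finite_words)
  then show ?thesis by (simp add: sum.cartesian_product')
qed

text \<open>The order of the choices is essential: \<open>k\<close> comes from the limits alone, and
  \<open>i0\<close> makes the level-\<open>k\<close> statistics close. Once \<open>i\<close> is
  fixed, \<open>n\<close> is known and the parameters down to the last possible level
  \<open>J\<close> follow; only then is \<open>i'\<close> taken far enough.\<close>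

lemma contradiction: False
proof -
  define \<delta> where "\<delta> = \<epsilon> / 33"
  have \<delta>: "0 < \<delta>" "\<delta> \<le> 1 / 2" "33 * \<delta> \<le> \<epsilon>" using \<epsilon> by (auto simp: \<delta>_def)
  obtain k1 where k1: "\<And>j k. j \<ge> k1 \<Longrightarrow> k \<ge> k1 \<Longrightarrow> en_lim j - en_lim k \<le> \<delta>\<^sup>2 / 2"
    using mono_bounded_tail[OF en_lim_mono en_lim_le, of "\<delta>\<^sup>2 / 2"] \<delta> by auto
  obtain k2 where k2: "\<And>j k. j \<ge> k2 \<Longrightarrow> k \<ge> k2 \<Longrightarrow> (\<Sum>r<j. atom_lim r) - (\<Sum>r<k. atom_lim r) \<le> \<delta>"
    using mono_bounded_tail[OF atom_lim_sum, of \<delta>] \<delta> by auto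
  \<comment> \<open>Beyond \<open>k\<close> the limit energy and the total limit weight of the first
    ranks hardly grow any more.\<close>
  define k where "k = max k1 k2"
  obtain i1 where i1: "\<And>i i'. i \<ge> i1 \<Longrightarrow> i' \<ge> i1 \<Longrightarrow> (\<Sum>w | length w = k. \<bar>mass (D i) (cd i k) w - mass (D i') (cd i' k) w\<bar>) \<le> \<delta>"
    using mass_close[where \<theta> = \<delta> and k = k] \<delta> by blast
  define Q where "Q b i0 \<longleftrightarrow> (\<forall>i\<ge>i0. \<forall>i'\<ge>i0. (\<Sum>w | length w = k. \<Sum>w' | length w' = k.
    \<bar>emass (D i) (\<lambda>x y. adj (G i) x y = b) (cd i k) w w' - emass (D i') (\<lambda>x y. adj (G i') x y = b) (cd i' k) w w'\<bar>) \<le> \<delta>)" for b i0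
  have "\<exists>i0. Q b i0" for b unfolding Q_def by (rule emass_close[OF \<delta>(1)])
  then obtain i2 where i2: "\<And>b. Q b (i2 b)" by metis
  define i0 where "i0 = max i1 (max (i2 True) (i2 False))"
  have i0: "i0 \<ge> i1" "i0 \<ge> i2 b" for b by (cases b; simp add: i0_def)+
  \<comment> \<open>extendability only passes to smaller numbers of vertices\<close>
  obtain i where i: "i \<ge> i0" and least: "\<And>i'. i' \<ge> i0 \<Longrightarrow> card (verts (G i)) \<le> card (verts (G i'))"
    using ex_has_least_nat[of "\<lambda>i. i \<ge> i0" i0 "\<lambda>i. card (verts (G i))"] by auto
  define n where "n = card (set_pmf (D i))"
  have n: "0 < n" unfolding n_def using fin[of i] set_pmf_not_empty[of "D i"] by (simp add: card_gt_0_iff)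
  define \<tau> where "\<tau> = \<delta> / 8 ^ k"
  define \<pi> where "\<pi> = (\<delta> / 2) ^ n\<^sup>2"
  have \<tau>: "0 < \<tau>" "8 ^ k * \<tau> \<le> \<delta>" and \<pi>: "0 < \<pi>" using \<delta> by (auto simp: \<tau>_def \<pi>_def)
  \<comment> \<open>\<open>similar_graphs\<close> allows \<open>2 * \<rho>\<close> for the sum of
    \<open>4 / \<delta>\<^sup>2 * \<beta>\<close> and \<open>1 / (real j + 1)\<close>; each of them
    gets \<open>\<rho>\<close>.\<close>
  define \<rho> where "\<rho> = \<pi> * \<tau>\<^sup>2 / (32 * n\<^sup>2)"
  have \<rho>: "0 < \<rho>" using \<pi> \<tau> n by (simp add: \<rho>_def)
  define \<beta> where "\<beta> = \<rho> * \<delta>\<^sup>2 / 4"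
  have \<beta>: "0 < \<beta>" using \<rho> \<delta> by (simp add: \<beta>_def)
  obtain j1 where j1: "\<And>l j. l \<ge> j1 \<Longrightarrow> j \<ge> j1 \<Longrightarrow> en_lim l - en_lim j \<le> \<beta> / 3"
    using mono_bounded_tail[OF en_lim_mono en_lim_le, of "\<beta> / 3"] \<beta> by auto
  obtain j2 where j2: "1 / (real j2 + 1) < \<rho>" using reals_Archimedean[OF \<rho>] by (auto simp: inverse_eq_divide add.commute)
  define j where "j = max k (max j1 j2)"
  have j: "k \<le> j" "j1 \<le> j" "j2 \<le> j" by (auto simp: j_def)
  have "1 / (real j + 1) \<le> 1 / (real j2 + 1)" using j by (intro divide_left_mono) auto
  then have j\<rho>: "1 / (real j + 1) \<le> \<rho>" using j2 by simp
  define \<sigma> where "\<sigma> = min 1 (\<tau> / (4 * n * 8 ^ j))"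
  have \<sigma>: "0 < \<sigma>" "\<sigma> \<le> 1" "\<sigma> \<le> \<tau> / (4 * n * 8 ^ j)" using \<tau> n by (auto simp: \<sigma>_def)
  define d where "d = \<pi> * \<sigma>\<^sup>2 / (4 * n\<^sup>2)"
  have d: "0 < d" using \<pi> \<sigma> n by (simp add: d_def)
  \<comment> \<open>The regular level \<open>l\<close> depends on \<open>i'\<close>, but always lies
    between \<open>j\<close> and \<open>J\<close>; controlling the energies up to \<open>J\<close>
    in advance avoids a circular choice.\<close>
  define J where "J = j + nat \<lceil>1 / d\<^sup>2\<rceil>"
  \<comment> \<open>Energy differences of \<open>G i'\<close> exceed the limit differences
    \<open>\<delta>\<^sup>2 / 2\<close> and \<open>\<beta> / 3\<close> by at most
    \<open>2 * \<theta>\<close>, which keeps them below \<open>\<delta>\<^sup>2\<close> and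
    \<open>\<beta>\<close>.\<close>
  define \<theta> where "\<theta> = min (\<beta> / 3) (\<delta>\<^sup>2 / 4)"
  have \<theta>: "0 < \<theta>" "\<theta> \<le> \<beta> / 3" "\<theta> \<le> \<delta>\<^sup>2 / 4" using \<beta> \<delta> by (auto simp: \<theta>_def)
  have "\<forall>\<^sub>F i' in sequentially. \<bar>en i' a - en_lim a\<bar> < \<theta>" for a
    using tendstoD[OF en_tendsto \<theta>(1)] by (simp add: dist_real_def)
  then have ev1: "\<forall>\<^sub>F i' in sequentially. \<forall>a\<in>{..J}. \<bar>en i' a - en_lim a\<bar> < \<theta>"
    by (intro eventually_ball_finite) auto
  have "(\<lambda>i. \<Sum>r\<in>{k..<j}. atom i r) \<longlonglongrightarrow> (\<Sum>r\<in>{k..<j}. atom_lim r)" by (intro tendsto_sum atom_tendsto)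
  from tendstoD[OF this \<delta>(1)]
  have ev2: "\<forall>\<^sub>F i' in sequentially. \<bar>(\<Sum>r\<in>{k..<j}. atom i' r) - (\<Sum>r\<in>{k..<j}. atom_lim r)\<bar> < \<delta>"
    by (simp add: dist_real_def)
  \<comment> \<open>This is the probability that \<open>rounding_realized\<close> guarantees; in
    \<open>G i'\<close> failures of extendability must be rarer.\<close>
  have "0 < \<sigma> ^ n * (\<pi> / 4)" using \<sigma> \<pi> by simp
  from reals_Archimedean[OF this] obtain N where "inverse (real (Suc N)) < \<sigma> ^ n * (\<pi> / 4)" by blast
  then have N: "1 / (real N + 1) < \<sigma> ^ n * (\<pi> / 4)" by (simp add: inverse_eq_divide add.commute)
  have ev3: "\<forall>\<^sub>F i' in sequentially. i0 \<le> i' \<and> n \<le> i' \<and> N \<le> i'"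
    by (intro eventually_conj eventually_ge_at_top)
  from eventually_conj[OF ev1 eventually_conj[OF ev2 ev3]]
  obtain i' where en_i': "\<And>a. a \<le> J \<Longrightarrow> \<bar>en i' a - en_lim a\<bar> < \<theta>"
    and atom_i': "\<bar>(\<Sum>r\<in>{k..<j}. atom i' r) - (\<Sum>r\<in>{k..<j}. atom_lim r)\<bar> < \<delta>"
    and i': "i0 \<le> i'" "n \<le> i'" "N \<le> i'"
    unfolding eventually_sequentially by (meson atMost_iff order_refl)
  obtain l where l: "j \<le> l" "l \<le> J" and regular: "\<And>S T. \<bar>cut_gap (D i') (adj (G i')) (cd i' l) S T\<bar> \<le> d"
    using ex_regular_level[OF fin d, of j i' "adj (G i')" "rk i'"] by (auto simp: J_def)
  have kJ: "k \<le> J" "j \<le> J" using j l by auto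
  interpret T: similar_graphs "D i" "adj (G i)" "rk i" "D i'" "adj (G i')" "rk i'" k j l n \<epsilon> \<delta> \<tau> \<sigma> \<beta> d
  proof
    show "inj_on (rk i) (set_pmf (D i))" "inj_on (rk i') (set_pmf (D i'))"
      using rk(1) supp by (auto intro: inj_on_subset)
    show "n * (8 ^ j * \<sigma>) / \<tau> \<le> 1 / 4"
      using \<sigma>(3) n \<tau> by (simp add: field_simps)
    show "n\<^sup>2 * ((4 / \<delta>\<^sup>2 * \<beta> + 1 / (real j + 1)) / \<tau>\<^sup>2) \<le> (\<delta> / 2) ^ n\<^sup>2 / 16"
    proof -
      have "4 / \<delta>\<^sup>2 * \<beta> = \<rho>" using \<delta> by (simp add: \<beta>_def)
      then have "n\<^sup>2 * ((4 / \<delta>\<^sup>2 * \<beta> + 1 / (real j + 1)) / \<tau>\<^sup>2) \<le> n\<^sup>2 * ((\<rho> + \<rho>) / \<tau>\<^sup>2)"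
        using j\<rho> by (intro mult_left_mono divide_right_mono) auto
      also have "\<dots> = \<pi> / 16" using n \<tau> by (simp add: \<rho>_def field_simps)
      finally show ?thesis by (simp add: \<pi>_def)
    qed
    show "n\<^sup>2 * (d / \<sigma>\<^sup>2) \<le> (\<delta> / 2) ^ n\<^sup>2 / 4"
      using n \<sigma> by (simp add: d_def flip: \<pi>_def)
    show "(\<Sum>w | length w = k. \<bar>mass (D i) (cd i k) w - mass (D i') (cd i' k) w\<bar>) \<le> \<delta>"
      using i i' i0(1) by (intro i1) auto
    show "(\<Sum>w | length w = k. \<Sum>w' | length w' = k.
      \<bar>emass (D i) (\<lambda>x y. adj (G i) x y = b) (cd i k) w w' - emass (D i') (\<lambda>x y. adj (G i') x y = b) (cd i' k) w w'\<bar>) \<le> \<delta>" for b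
      using i i' i0(2)[of b] by (intro i2[of b, unfolded Q_def, rule_format]) auto
    show "energy (D i') (adj (G i')) (cd i' j) - energy (D i') (adj (G i')) (cd i' k) \<le> \<delta>\<^sup>2"
      using k1[of j k] j(1) en_i'[OF kJ(1)] en_i'[OF kJ(2)] \<theta>(3) unfolding en_def k_def by auto
    show "energy (D i') (adj (G i')) (cd i' l) - energy (D i') (adj (G i')) (cd i' j) \<le> \<beta>"
      using j1[of l j] j(2) l(1) en_i'[OF l(2)] en_i'[OF kJ(2)] \<theta>(2) unfolding en_def by auto
    have "measure_pmf.prob (D i') {x. k \<le> rk i' x \<and> rk i' x < j} = (\<Sum>r\<in>{k..<j}. atom i' r)"
      by (simp add: sum_atom)
    also have "\<dots> \<le> (\<Sum>r\<in>{k..<j}. atom_lim r) + \<delta>" using atom_i' by linarith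
    also have "(\<Sum>r\<in>{k..<j}. atom_lim r) = (\<Sum>r<j. atom_lim r) - (\<Sum>r<k. atom_lim r)"
      using sum_diff_nat_ivl[of 0 k j atom_lim] j(1) by (simp add: atLeast0LessThan)
    also have "\<dots> \<le> \<delta>" using k2[of j k] j(1) by (simp add: k_def)
    finally show "measure_pmf.prob (D i') {x. k \<le> rk i' x \<and> rk i' x < j} \<le> 2 * \<delta>" by simp
  qed (use fin rk(2) j l \<epsilon> \<delta> \<tau> \<sigma> \<beta> d regular in \<open>auto simp: n_def\<close>)
  obtain A R c where RA: "R \<subseteq> A" "A \<subseteq> set_pmf (D i)"
    and cost: "(\<Sum>u\<in>set_pmf (D i) - R. pmf (D i) u)
      + (\<Sum>u\<in>R. \<Sum>v\<in>R - {u}. pmf (D i) u * pmf (D i) v * of_bool (c u v \<noteq> adj (G i) u v)) < \<epsilon>"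
    and often: "\<sigma> ^ n * (\<pi> / 4) \<le> ex (Pi_pmf A undefined (\<lambda>_. D i'))
        (\<lambda>f. of_bool (inj_on f R \<and> (\<forall>u\<in>R. \<forall>v\<in>R. rk i u < rk i v \<longrightarrow> adj (G i') (f u) (f v) = c u v)))"
    using T.rounding_realized unfolding \<pi>_def by blast
  define good where "good f \<longleftrightarrow> inj_on f R \<and> (\<forall>u\<in>R. \<forall>v\<in>R. rk i u < rk i v \<longrightarrow> adj (G i') (f u) (f v) = c u v)" for f
  have finA: "finite A" and "card A \<le> n" using RA(2) fin[of i] by (auto simp: n_def intro: finite_subset card_mono)
  then have "card A \<le> i'" using i' by simp
  have "1 / (real i' + 1) \<le> 1 / (real N + 1)" using i'(3) by (intro divide_left_mono) auto
  then have "ex (Pi_pmf A undefined (\<lambda>_. D i')) (\<lambda>f. of_bool (\<not> extendable P (card (verts (G i'))) (G i') (f ` A))) < \<sigma> ^ n * (\<pi> / 4)"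
    using accept[OF finA \<open>card A \<le> i'\<close>] N by linarith
  also note often
  finally have less: "ex (Pi_pmf A undefined (\<lambda>_. D i')) (\<lambda>f. of_bool (\<not> extendable P (card (verts (G i'))) (G i') (f ` A)))
    < ex (Pi_pmf A undefined (\<lambda>_. D i')) (\<lambda>f. of_bool (good f))" unfolding good_def .
  \<comment> \<open>Realizations are likelier than failures of extendability, so some realization is
    extendable.\<close>
  have "\<exists>f. good f \<and> extendable P (card (verts (G i'))) (G i') (f ` A)"
  proof (rule ccontr)
    assume none: "\<not> ?thesis"
    have "ex (Pi_pmf A undefined (\<lambda>_. D i')) (\<lambda>f. of_bool (good f))
      \<le> ex (Pi_pmf A undefined (\<lambda>_. D i')) (\<lambda>f. of_bool (\<not> extendable P (card (verts (G i'))) (G i') (f ` A)))"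
      using none by (intro ex_mono fin_Pi_pmf finA fin) auto
    then show False using less by simp
  qed
  then obtain f where f: "inj_on f R" "\<And>u v. u \<in> R \<Longrightarrow> v \<in> R \<Longrightarrow> rk i u < rk i v \<Longrightarrow> adj (G i') (f u) (f v) = c u v"
    and ext: "extendable P (card (verts (G i'))) (G i') (f ` A)"
    unfolding good_def by blast
  have R: "R \<subseteq> set_pmf (D i)" "R \<subseteq> verts (G i)" using RA supp[of i] by auto
  have "extendable P (card (verts (G i'))) (G i') (f ` R)"
    using ext RA(1) by (rule extendable_subset[OF _ image_mono])
  from extendable_realize[OF P simple R(2) f(1) this least[OF i'(1)]]
  obtain H where H: "H \<in> P" "verts H = verts (G i)"
    and edge: "\<forall>x\<in>R. \<forall>y\<in>R. x \<noteq> y \<longrightarrow> ({x, y} \<in> edges H \<longleftrightarrow> {f x, f y} \<in> edges (G i'))"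
    by (elim bexE conjE)
  have "simple_graph H" using P(1) H(1) by (auto simp: graph_property_def)
  have "graph_dist (D i) (G i) H \<le> (\<Sum>u\<in>set_pmf (D i) - R. pmf (D i) u)
     + (\<Sum>u\<in>R. \<Sum>v\<in>R - {u}. pmf (D i) u * pmf (D i) v
          * of_bool (rk i u < rk i v \<and> ({u, v} \<in> edges H) \<noteq> ({u, v} \<in> edges (G i))))"
    using inj_on_subset[OF rk(1) R(2)] by (intro graph_dist_le simple \<open>simple_graph H\<close> H supp R) auto
  also have "\<dots> \<le> (\<Sum>u\<in>set_pmf (D i) - R. pmf (D i) u)
      + (\<Sum>u\<in>R. \<Sum>v\<in>R - {u}. pmf (D i) u * pmf (D i) v * of_bool (c u v \<noteq> adj (G i) u v))"
  proof (intro add_left_mono sum_mono mult_left_mono)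
    fix u v assume uv: "u \<in> R" "v \<in> R - {u}"
    show "of_bool (rk i u < rk i v \<and> ({u, v} \<in> edges H) \<noteq> ({u, v} \<in> edges (G i))) \<le> (of_bool (c u v \<noteq> adj (G i) u v) :: real)"
      using edge[rule_format, of u v] f(2)[of u v] uv by (auto simp: adj_def)
  qed auto
  also note cost
  finally have "graph_dist (D i) (G i) H < \<epsilon>" .
  moreover have "graph_dist (D i) (G i) H \<ge> \<epsilon>" using far[of i] H unfolding far_from_def by blast
  ultimately show False by simp
qed

end

text \<open>If no \<open>m\<close> and \<open>\<gamma>\<close> work, the choices
  \<open>\<gamma> = 1 - 1 / (real m + 1)\<close> provide a sequence of far graphs that are accepted
  too often, and a subsequence has convergent statistics.\<close>

lemma far_graphs_rejected:
  fixes P :: "'a ugraph set"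
  assumes P: "graph_property P" "hereditary P" and \<epsilon>: "0 < \<epsilon>" "\<epsilon> < 1"
  shows "\<exists>m \<gamma>. \<gamma> < 1 \<and> (\<forall>G D. weighted_graph G D \<longrightarrow> far_from \<epsilon> G D P \<longrightarrow> accept_prob P m G D \<le> \<gamma>)"
proof (rule ccontr)
  assume neg: "\<not> ?thesis"
  have "\<exists>G D. weighted_graph G D \<and> far_from \<epsilon> G D P \<and> 1 - 1 / (real m + 1) < accept_prob P m G D" for m
  proof -
    have "1 - 1 / (real m + 1) < 1" by simp
    then show ?thesis using neg by (meson not_le)
  qed
  then obtain G D where GD: "\<And>m. weighted_graph (G m) (D m)" "\<And>m. far_from \<epsilon> (G m) (D m) P"
      "\<And>m. 1 - 1 / (real m + 1) < accept_prob P m (G m) (D m)"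
    by metis
  have fin: "finite (verts (G m))" "set_pmf (D m) \<subseteq> verts (G m)" "fin_pmf (D m)" for m
    using GD(1)[of m] finite_subset by (auto simp: weighted_graph_def simple_graph_def)
  obtain rk :: "nat \<Rightarrow> 'a \<Rightarrow> nat" where rk: "\<And>m. inj_on (rk m) (verts (G m))"
      "\<And>m x. x \<in> set_pmf (D m) \<Longrightarrow> pmf (D m) x \<le> 1 / (real (rk m x) + 1)"
    using rank_by_weight[OF fin(1,2)] by metis
  obtain s :: "nat \<Rightarrow> nat" where s: "strict_mono s"
      and conv: "\<And>t. convergent (\<lambda>n. stat (D (s n)) (adj (G (s n))) (rk (s n)) t)"
    using convergent_subseq_countable[of "\<lambda>m. stat (D m) (adj (G m)) (rk m)"] stat_bounds[OF fin(3)] by blast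
  interpret convergent_counterexample P \<epsilon> "\<lambda>i. G (s i)" "\<lambda>i. D (s i)" "\<lambda>i. rk (s i)"
  proof
    fix i and A :: "'a set" assume A: "finite A" "card A \<le> i"
    \<comment> \<open>Indices only grow along the subsequence, so the sample sizes and failure
      bounds demanded at \<open>i\<close> are available at \<open>s i\<close>.\<close>
    have si: "i \<le> s i" by (rule strict_mono_imp_increasing[OF s])
    have "ex (Pi_pmf A undefined (\<lambda>_. D (s i))) (\<lambda>f. of_bool (\<not> extendable P (card (verts (G (s i)))) (G (s i)) (f ` A)))
      \<le> 1 - accept_prob P (s i) (G (s i)) (D (s i))"
      using A si by (intro reject_le fin) auto
    also have "\<dots> \<le> 1 / (real (s i) + 1)" using GD(3)[of "s i"] by linarith
    also have "\<dots> \<le> 1 / (real i + 1)" using si by (intro divide_left_mono) auto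
    finally show "ex (Pi_pmf A undefined (\<lambda>_. D (s i))) (\<lambda>f. of_bool (\<not> extendable P (card (verts (G (s i)))) (G (s i)) (f ` A))) \<le> 1 / (real i + 1)" .
  qed (use P \<epsilon> GD rk conv in auto)
  show False by (rule contradiction)
qed

theorem theorem7:
  fixes P :: "'a ugraph set"
  assumes "graph_property P" and "hereditary P"
  shows "\<exists>(q :: real \<Rightarrow> nat) (T :: real \<Rightarrow> nat \<Rightarrow> algorithm). one_sided_VDF_tester P q T"
  by (intro one_sided_tester far_graphs_rejected assms)

end
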